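(* Let $\rho\colon\mathrm{Sym}\to\mathbb{R}$ be a specialization (unital $\mathbb{R}$-algebra homomorphism). Then $\rho$ is totally Jack-positive, i.e. $\rho(J^{(\alpha)}_\lambda)\ge0$ for all $\lambda\in\mathbb{Y}$ and all $\alpha>0$, if and only if there exist $c\ge0$ and $a_1\ge a_2\ge\cdots\ge0$ with $\sum_{i=1}^\infty a_i\le c$ such that $$\rho(p_1)=c,\qquad\rho(p_k)=\sum_{i=1}^\infty a_i^k\quad\text{for all }k=2,3,\dots.$$
   Context: $\mathbb{Y}$ is the set of all partitions. $\mathrm{Sym}=\mathbb{R}[p_1,p_2,\dots]$ is the algebra of symmetric functions, $p_k$ the power sums. For $\alpha>0$, $J^{(\alpha)}_\lambda$ is the integral form of the Jack symmetric function (Macdonald, Ch. VI.10): the $J^{(\alpha)}_\lambda$ are orthogonal for $\langle p_\lambda,p_\mu\rangle=\delta_{\lambda\mu}\alpha^{\ell(\lambda)}z_\lambda$ ($z_\lambda=\prod_i i^{m_i(\lambda)}m_i(\lambda)!$), triangular with respect to dominance order in the monomial symmetric functions, and normalized so that the coefficient of $p_1^{|\lambda|}$ in $J_\lambda^{(\alpha)}$ is $1$. *)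

theory Defs
  imports "HOL-Analysis.Analysis" "HOL-Library.Multiset"
begin

section \<open>The algebra of symmetric functions\<close>

text \<open>A monomial in the variables \<open>x\<^sub>0, x\<^sub>1, x\<^sub>2, \<dots>\<close> is a finite multiset of variable
  indices: the exponent of \<open>x\<^sub>i\<close> in \<open>m\<close> is \<open>count m i\<close>, and the degree of \<open>m\<close> is \<open>size m\<close>.
  A symmetric function is a real formal power series of bounded degree, given by its coefficients,
  that is invariant under all permutations of the variables.\<close>

definition symmetric_series :: "(nat multiset \<Rightarrow> real) \<Rightarrow> bool" where
  "symmetric_series f \<longleftrightarrow>
     (\<exists>d. \<forall>m. f m \<noteq> 0 \<longrightarrow> size m \<le> d) \<and>
     (\<forall>\<pi> m. bij \<pi> \<longrightarrow> f (image_mset \<pi> m) = f m)"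

typedef symfun = "{f. symmetric_series f}"
  morphisms mcoeff Abs_symfun
  by (rule exI[of _ "\<lambda>_. 0"]) (simp add: symmetric_series_def)

setup_lifting type_definition_symfun

lemma symmetric_series_bounded:
  assumes "symmetric_series f"
  obtains d where "\<forall>m. f m \<noteq> 0 \<longrightarrow> size m \<le> d"
  using assms unfolding symmetric_series_def by blast

lemma symmetric_series_perm:
  "symmetric_series f \<Longrightarrow> bij \<pi> \<Longrightarrow> f (image_mset \<pi> m) = f m"
  unfolding symmetric_series_def by blast

lemma symmetric_seriesI:
  assumes "\<And>m. f m \<noteq> 0 \<Longrightarrow> size m \<le> d"
    and "\<And>\<pi> m. bij \<pi> \<Longrightarrow> f (image_mset \<pi> m) = f m"
  shows "symmetric_series f"
  using assms unfolding symmetric_series_def by blast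

lemma finite_mset_splits: "finite {(a, b). a + b = (m :: 'a multiset)}"
proof -
  have "finite {a. a \<subseteq># m}"
  proof (induction m)
    case (add x m)
    have "a \<in> {a. a \<subseteq># m} \<union> add_mset x ` {a. a \<subseteq># m}" if "a \<subseteq># add_mset x m" for a
    proof (cases "x \<in># a")
      case True
      then obtain a' where "a = add_mset x a'" by (meson multi_member_split)
      with that show ?thesis by auto
    next
      case False
      have "count a y \<le> count m y" for y
        using mset_subset_eq_count[OF that, of y] False
        by (cases "y = x") (auto simp: not_in_iff)
      then show ?thesis by (simp add: mset_subset_eqI)
    qed
    then have "{a. a \<subseteq># add_mset x m} \<subseteq> {a. a \<subseteq># m} \<union> add_mset x ` {a. a \<subseteq># m}" by blast
    then show ?case using add by (meson finite_UnI finite_imageI finite_subset)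
  qed simp
  moreover have "{(a, b). a + b = m} \<subseteq> (\<lambda>a. (a, m - a)) ` {a. a \<subseteq># m}" by auto
  ultimately show ?thesis by (meson finite_imageI finite_subset)
qed

lemma image_mset_bij_inv:
  assumes "bij \<pi>"
  shows "image_mset (inv \<pi>) (image_mset \<pi> m) = m" "image_mset \<pi> (image_mset (inv \<pi>) m) = m"
  using assms
  by (simp_all add: image_mset.compositionality o_def bij_is_inj bij_is_surj surj_f_inv_f)

lemma symmetric_series_mult:
  assumes f: "symmetric_series f" and g: "symmetric_series g"
  shows "symmetric_series (\<lambda>m. \<Sum>(a, b) | a + b = m. f a * g b)"
proof -
  obtain d where d: "\<forall>m. f m \<noteq> 0 \<longrightarrow> size m \<le> d" using f by (rule symmetric_series_bounded)
  obtain e where e: "\<forall>m. g m \<noteq> 0 \<longrightarrow> size m \<le> e" using g by (rule symmetric_series_bounded)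
  have "size m \<le> d + e" if nz: "(\<Sum>(a, b) | a + b = m. f a * g b) \<noteq> 0" for m
  proof -
    obtain p where p: "p \<in> {(a, b). a + b = m}" "(case p of (a, b) \<Rightarrow> f a * g b) \<noteq> 0"
      by (rule sum.not_neutral_contains_not_neutral[OF nz])
    then obtain a b where "a + b = m" "f a \<noteq> 0" "g b \<noteq> 0" by (cases p) auto
    then show ?thesis using d e by (metis add_mono size_union)
  qed
  moreover have "(\<Sum>(a, b) | a + b = image_mset \<pi> m. f a * g b) = (\<Sum>(a, b) | a + b = m. f a * g b)"
    if \<pi>: "bij \<pi>" for \<pi> m
  proof -
    note fg = symmetric_series_perm[OF f \<pi>] symmetric_series_perm[OF g \<pi>]
    note inv = image_mset_bij_inv[OF \<pi>]
    show ?thesis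
    proof (rule sum.reindex_bij_witness[where
          j = "\<lambda>(a, b). (image_mset (inv \<pi>) a, image_mset (inv \<pi>) b)" and
          i = "\<lambda>(a, b). (image_mset \<pi> a, image_mset \<pi> b)"], goal_cases)
      case (1 p)
      then show ?case by (cases p) (simp add: inv(2))
    next
      case (2 p)
      then show ?case by (cases p) (simp add: inv(1) flip: image_mset_union)
    next
      case (3 p)
      then show ?case by (cases p) (simp add: inv(1))
    next
      case (4 p)
      then show ?case by (cases p) (simp flip: image_mset_union)
    next
      case (5 p)
      obtain a b where "p = (a, b)" by (cases p)
      then show ?case using fg[of "image_mset (inv \<pi>) a"] fg[of "image_mset (inv \<pi>) b"]
        by (simp add: inv(2))
    qed
  qed
  ultimately show ?thesis by (rule symmetric_seriesI)
qed

instantiation symfun :: comm_ring_1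
begin

lift_definition zero_symfun :: symfun is "\<lambda>_. 0"
  by (simp add: symmetric_series_def)

lift_definition one_symfun :: symfun is "\<lambda>m. if m = {#} then 1 else 0"
  by (auto simp: symmetric_series_def)

lift_definition plus_symfun :: "symfun \<Rightarrow> symfun \<Rightarrow> symfun" is "\<lambda>f g m. f m + g m"
proof -
  fix f g assume f: "symmetric_series f" and g: "symmetric_series g"
  obtain d where d: "\<forall>m. f m \<noteq> 0 \<longrightarrow> size m \<le> d" using f by (rule symmetric_series_bounded)
  obtain e where e: "\<forall>m. g m \<noteq> 0 \<longrightarrow> size m \<le> e" using g by (rule symmetric_series_bounded)
  have "size m \<le> d + e" if "f m + g m \<noteq> 0" for m
    using that d e by (cases "f m = 0") (auto simp: trans_le_add1 trans_le_add2)
  then show "symmetric_series (\<lambda>m. f m + g m)"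
    by (rule symmetric_seriesI) (simp_all add: symmetric_series_perm[OF f] symmetric_series_perm[OF g])
qed

lift_definition uminus_symfun :: "symfun \<Rightarrow> symfun" is "\<lambda>f m. - f m"
  by (simp add: symmetric_series_def)

definition minus_symfun :: "symfun \<Rightarrow> symfun \<Rightarrow> symfun" where
  "minus_symfun f g = f + - g"

lift_definition times_symfun :: "symfun \<Rightarrow> symfun \<Rightarrow> symfun" is
  "\<lambda>f g m. \<Sum>(a, b) | a + b = m. f a * g b"
  by (rule symmetric_series_mult)

instance
proof
  fix f g h :: symfun
  show "f + g + h = f + (g + h)" by transfer (simp add: add.assoc)
  show "f + g = g + f" by transfer (simp add: add.commute)
  show "0 + f = f" by transfer simp
  show "- f + f = 0" by transfer simp
  show "f - g = f + - g" by (rule minus_symfun_def)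
  show "(0 :: symfun) \<noteq> 1" by transfer (metis zero_neq_one)
  show "f * g = g * f"
  proof (transfer, rule ext)
    fix f g :: "nat multiset \<Rightarrow> real" and m
    show "(\<Sum>(a, b) | a + b = m. f a * g b) = (\<Sum>(a, b) | a + b = m. g a * f b)"
      by (rule sum.reindex_bij_witness[where i = "\<lambda>(a, b). (b, a)" and j = "\<lambda>(a, b). (b, a)"])
         (auto simp: add.commute)
  qed
  show "1 * f = f"
  proof (transfer, rule ext)
    fix f :: "nat multiset \<Rightarrow> real" and m
    have "(\<Sum>(a, b) | a + b = m. (if a = {#} then 1 else 0) * f b) =
          (\<Sum>(a :: nat multiset, b) \<in> {({#}, m)}. (if a = {#} then 1 else 0) * f b)"
      by (rule sum.mono_neutral_right) (auto intro: finite_mset_splits split: if_splits)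
    then show "(\<Sum>(a, b) | a + b = m. (if a = {#} then 1 else 0) * f b) = f m" by simp
  qed
  show "(f + g) * h = f * h + g * h"
    by transfer (simp add: algebra_simps case_prod_unfold sum.distrib)
  show "f * g * h = f * (g * h)"
  proof (transfer, rule ext)
    fix f g h :: "nat multiset \<Rightarrow> real" and m
    have "(\<Sum>(a, b) | a + b = m. (\<Sum>(c, d) | c + d = a. f c * g d) * h b) =
          (\<Sum>p \<in> {(a, b). a + b = m}. \<Sum>q \<in> {(c, d). c + d = fst p}. f (fst q) * g (snd q) * h (snd p))"
      by (simp add: case_prod_unfold sum_distrib_right)
    also have "\<dots> = (\<Sum>(p, q) \<in> (SIGMA p : {(a, b). a + b = m}. {(c, d). c + d = fst p}).
                       f (fst q) * g (snd q) * h (snd p))"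
      using finite_mset_splits by (subst sum.Sigma) blast+
    also have "\<dots> = (\<Sum>(p, q) \<in> (SIGMA p : {(a, b). a + b = m}. {(c, d). c + d = snd p}).
                       f (fst p) * (g (fst q) * h (snd q)))"
      by (rule sum.reindex_bij_witness[where
            j = "\<lambda>((a, b), (c, d)). ((c, d + b), (d, b))" and
            i = "\<lambda>((a, b), (c, d)). ((a + c, d), (a, c))"])
         (auto simp: add.assoc mult.assoc)
    also have "\<dots> = (\<Sum>p \<in> {(a, b). a + b = m}. \<Sum>q \<in> {(c, d). c + d = snd p}.
                       f (fst p) * (g (fst q) * h (snd q)))"
      using finite_mset_splits by (subst sum.Sigma) blast+
    also have "\<dots> = (\<Sum>(a, b) | a + b = m. f a * (\<Sum>(c, d) | c + d = b. g c * h d))"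
      by (simp add: case_prod_unfold sum_distrib_left)
    finally show "(\<Sum>(a, b) | a + b = m. (\<Sum>(c, d) | c + d = a. f c * g d) * h b) =
                  (\<Sum>(a, b) | a + b = m. f a * (\<Sum>(c, d) | c + d = b. g c * h d))" .
  qed
qed

end

instantiation symfun :: real_algebra_1
begin

lift_definition scaleR_symfun :: "real \<Rightarrow> symfun \<Rightarrow> symfun" is "\<lambda>r f m. r * f m"
proof -
  fix r :: real and f assume f: "symmetric_series f"
  obtain d where d: "\<forall>m. f m \<noteq> 0 \<longrightarrow> size m \<le> d" using f by (rule symmetric_series_bounded)
  then show "symmetric_series (\<lambda>m. r * f m)"
    by (intro symmetric_seriesI[of _ d]) (simp_all add: symmetric_series_perm[OF f])
qed

instance
proof
  fix f g :: symfun and r s :: real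
  show "r *\<^sub>R (f + g) = r *\<^sub>R f + r *\<^sub>R g" by transfer (simp add: algebra_simps)
  show "(r + s) *\<^sub>R f = r *\<^sub>R f + s *\<^sub>R f" by transfer (simp add: algebra_simps)
  show "r *\<^sub>R s *\<^sub>R f = (r * s) *\<^sub>R f" by transfer (simp add: mult.assoc)
  show "1 *\<^sub>R f = f" by transfer simp
  show "r *\<^sub>R f * g = r *\<^sub>R (f * g)"
    by transfer (simp add: case_prod_unfold sum_distrib_left mult.assoc)
  show "f * r *\<^sub>R g = r *\<^sub>R (f * g)"
    by transfer (simp add: case_prod_unfold sum_distrib_left mult.left_commute)
qed

end


section \<open>Partitions, power sums and monomial symmetric functions\<close>

text \<open>A partition is represented by the multiset of its (positive) parts; thus
  \<open>\<ell>(\<nu>) = size \<nu>\<close>, \<open>|\<nu>| = sum_mset \<nu>\<close> and \<open>m\<^sub>i(\<nu>) = count \<nu> i\<close>.\<close>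

definition partitions :: "nat multiset set" where
  "partitions = {\<nu>. 0 \<notin># \<nu>}"

definition z_factor :: "nat multiset \<Rightarrow> real" where
  "z_factor \<nu> = (\<Prod>i\<in>set_mset \<nu>. real (i ^ count \<nu> i * fact (count \<nu> i)))"

text \<open>Dominance order \<open>\<mu> \<le> \<nu>\<close>; \<open>take k\<close> of the parts in decreasing order is the whole list when
  \<open>k\<close> exceeds the length.\<close>

definition dominated :: "nat multiset \<Rightarrow> nat multiset \<Rightarrow> bool" where
  "dominated \<mu> \<nu> \<longleftrightarrow> sum_mset \<mu> = sum_mset \<nu> \<and>
     (\<forall>k. sum_list (take k (rev (sorted_list_of_multiset \<mu>)))
        \<le> sum_list (take k (rev (sorted_list_of_multiset \<nu>))))"

text \<open>The power sum \<open>p\<^sub>k = \<Sum>\<^sub>i x\<^sub>i\<^sup>k\<close>, meaningful for \<open>k \<ge> 1\<close>.\<close>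

lift_definition power_sum :: "nat \<Rightarrow> symfun" is
  "\<lambda>k m. if \<exists>i. m = replicate_mset k i then 1 else 0"
proof -
  fix k :: nat
  have "(\<exists>i. image_mset \<pi> m = replicate_mset k i) \<longleftrightarrow> (\<exists>i. m = replicate_mset k i)"
    if "bij \<pi>" for \<pi> :: "nat \<Rightarrow> nat" and m
    by (metis image_mset_bij_inv(1)[OF that] image_replicate_mset)
  then show "symmetric_series (\<lambda>m. if \<exists>i. m = replicate_mset k i then 1 else 0)"
    unfolding symmetric_series_def by auto
qed

definition power_prod :: "nat multiset \<Rightarrow> symfun" where
  "power_prod \<nu> = (\<Prod>k\<in>#\<nu>. power_sum k)"

text \<open>The multiset of nonzero exponents of a monomial.\<close>

definition exponents :: "nat multiset \<Rightarrow> nat multiset" where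
  "exponents m = image_mset (count m) (mset_set (set_mset m))"

lift_definition monomial_sym :: "nat multiset \<Rightarrow> symfun" is
  "\<lambda>\<nu> m. if exponents m = \<nu> then 1 else 0"
proof -
  fix \<nu> :: "nat multiset"
  have "size m = sum_mset (exponents m)" for m
    unfolding exponents_def by (simp add: size_multiset_overloaded_eq sum_unfold_sum_mset)
  moreover have "exponents (image_mset \<pi> m) = exponents m"
    if \<pi>: "bij \<pi>" for \<pi> :: "nat \<Rightarrow> nat" and m
  proof -
    have inj: "inj \<pi>" using \<pi> by (rule bij_is_inj)
    have "mset_set (\<pi> ` set_mset m) = image_mset \<pi> (mset_set (set_mset m))"
      using inj by (metis image_mset_mset_set inj_on_subset subset_UNIV)
    moreover have "count (image_mset \<pi> m) (\<pi> i) = count m i" for i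
    proof -
      have "{j. j \<in># m \<and> \<pi> i = \<pi> j} = (if i \<in># m then {i} else {})"
        using inj by (auto dest: injD)
      then show ?thesis by (simp add: count_image_mset' not_in_iff)
    qed
    ultimately show ?thesis
      unfolding exponents_def by (simp add: image_mset.compositionality o_def)
  qed
  ultimately show "symmetric_series (\<lambda>m. if exponents m = \<nu> then 1 else 0)"
    unfolding symmetric_series_def by auto
qed


section \<open>Jack symmetric functions\<close>

text \<open>The coefficient of \<open>p\<^sub>\<nu>\<close> in the expansion of a symmetric function in the basis
  \<open>(p\<^sub>\<mu>)\<close>, \<open>\<mu>\<close> a partition.\<close>

definition p_coeff :: "symfun \<Rightarrow> nat multiset \<Rightarrow> real" where
  "p_coeff f \<nu> = representation (power_prod ` partitions) f (power_prod \<nu>)"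

text \<open>The bilinear form on symmetric functions with \<open>\<langle>p\<^sub>\<nu>, p\<^sub>\<mu>\<rangle> = \<delta>\<^sub>\<nu>\<^sub>\<mu> \<alpha>\<^sup>\<ell>\<^sup>(\<^sup>\<nu>\<^sup>) z\<^sub>\<nu>\<close>.\<close>

definition jack_form :: "real \<Rightarrow> symfun \<Rightarrow> symfun \<Rightarrow> real" where
  "jack_form \<alpha> f g =
     (\<Sum>\<nu> | \<nu> \<in> partitions \<and> p_coeff f \<nu> \<noteq> 0. p_coeff f \<nu> * p_coeff g \<nu> * (\<alpha> ^ size \<nu> * z_factor \<nu>))"

definition jack_family :: "real \<Rightarrow> (nat multiset \<Rightarrow> symfun) \<Rightarrow> bool" where
  "jack_family \<alpha> J \<longleftrightarrow>
     (\<forall>\<nu>\<in>partitions. \<forall>\<mu>\<in>partitions. \<nu> \<noteq> \<mu> \<longrightarrow> jack_form \<alpha> (J \<nu>) (J \<mu>) = 0) \<and>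
     (\<forall>\<nu>\<in>partitions. J \<nu> \<in> span (monomial_sym ` {\<mu> \<in> partitions. dominated \<mu> \<nu>})) \<and>
     (\<forall>\<nu>\<in>partitions. p_coeff (J \<nu>) (replicate_mset (sum_mset \<nu>) 1) = 1)"

text \<open>For \<open>\<alpha> > 0\<close> the values of a Jack family on partitions are uniquely determined (its values
  elsewhere are irrelevant), so that \<open>jack \<alpha> \<nu>\<close> is the integral form \<open>J\<^sub>\<nu>\<^sup>(\<^sup>\<alpha>\<^sup>)\<close>.\<close>

definition jack :: "real \<Rightarrow> nat multiset \<Rightarrow> symfun" where
  "jack \<alpha> \<nu> = (THE f. \<exists>J. jack_family \<alpha> J \<and> f = J \<nu>)"


section \<open>Specializations\<close>

definition specialization :: "(symfun \<Rightarrow> real) \<Rightarrow> bool" where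
  "specialization \<rho> \<longleftrightarrow> linear \<rho> \<and> \<rho> 1 = 1 \<and> (\<forall>f g. \<rho> (f * g) = \<rho> f * \<rho> g)"

definition totally_jack_positive :: "(symfun \<Rightarrow> real) \<Rightarrow> bool" where
  "totally_jack_positive \<rho> \<longleftrightarrow> (\<forall>\<nu>\<in>partitions. \<forall>\<alpha>>0. \<rho> (jack \<alpha> \<nu>) \<ge> 0)"

end

theory Submission
  imports Defs "HOL-Computational_Algebra.Polynomial_FPS" "HOL-Library.Diagonal_Subsequence"
begin

text \<open>Total Jack positivity is equivalent to \<open>\<rho>(m\<^sub>\<nu>) \<ge> 0\<close> for all \<open>\<nu>\<close>. Indeed the Jack functions are
  eigenfunctions of the Laplace--Beltrami operator, which is triangular in the monomial basis with
  nonnegative off-diagonal entries independent of \<open>\<alpha>\<close> and with eigenvalues increasing along the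
  dominance order at rate \<open>\<alpha>\<close>. Solving the eigenvalue equation downwards shows that the monic
  \<open>P\<^sub>\<nu>\<close> has nonnegative monomial coefficients and tends to \<open>m\<^sub>\<nu>\<close> as \<open>\<alpha> \<rightarrow> \<infinity>\<close>.

  The existence of the Jack functions requires enough operators to separate partitions, since
  distinct partitions may share a Laplace--Beltrami eigenvalue. These are the moments of a
  Nazarov--Sklyanin type Lax operator on \<open>w Sym[w]\<close>: they are visibly self-adjoint in the power sums, and
  triangular in the monomials because the Lax operator acts as a Dunkl operator once \<open>w\<close> is
  specialized to one of the variables.

  Finally \<open>\<rho>(m\<^sub>\<nu>) \<ge> 0\<close> for all \<open>\<nu>\<close> means that \<open>\<rho>\<close> is given by Kingman's parameters. If the values
  \<open>\<rho>(p\<^sub>k) / \<rho>(p\<^sub>1)\<^sup>k\<close> were not approximated by power sums of finite frequency vectors, then, after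
  multiplication by a high power of \<open>p\<^sub>1\<close> as in Polya's theorem, a sum of squares would produce a function
  with nonnegative coefficients and negative value; compactness of the space of decreasing frequency
  vectors concludes. Conversely the parameters are limits of evaluations at finitely many nonnegative
  variables, the deficit \<open>c - \<Sum>a\<^sub>i\<close> being spread over many small variables.\<close>

section \<open>Power sums form a basis\<close>

text \<open>\<open>jack\<close> is a definite description, so existence and uniqueness of the whole
  family at each fixed \<alpha> > 0 come before any question of sign. The obstacle is that dominance
  is a partial order: Gram-Schmidt controls only what lies below \<nu>, and incomparable partitions
  must be separated by eigenvalues. Verifications are made on coefficients of monomials in
  infinitely many variables. There a symmetric function is a function of the exponent multiset, and
  a Dunkl operator only moves units between two exponents, which is why \<open>upd2\<close> occurs
  everywhere. The bound \<open>N\<close> replaces infinite sums over powers of w; it is exact for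
  monomials of size at most \<open>N\<close>, since no exponent exceeds the size. The normalization
  of J does not affect signs: the coefficient of p_1^|\<nu>| in the monic function can be read off
  at a squarefree monomial, where the recurrence forces positivity. In Kingman's part, multiplying
  by p_1^n turns coefficients into multinomial weights times falling factorials of exponents, so a
  claim about coefficients becomes, up to O(1/n), a claim about the frequencies count/size.\<close>

lemma mcoeff_zero [simp]: "mcoeff 0 m = 0"
  by (simp add: zero_symfun.rep_eq)

lemma mcoeff_one: "mcoeff 1 m = (if m = {#} then 1 else 0)"
  by (simp add: one_symfun.rep_eq)

lemma mcoeff_add [simp]: "mcoeff (f + g) m = mcoeff f m + mcoeff g m"
  by (simp add: plus_symfun.rep_eq)

lemma mcoeff_uminus [simp]: "mcoeff (- f) m = - mcoeff f m"
  by (simp add: uminus_symfun.rep_eq)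

lemma mcoeff_diff [simp]: "mcoeff (f - g) m = mcoeff f m - mcoeff g m"
  unfolding minus_symfun_def mcoeff_add mcoeff_uminus by simp

lemma mcoeff_scaleR [simp]: "mcoeff (r *\<^sub>R f) m = r * mcoeff f m"
  by (simp add: scaleR_symfun.rep_eq)

lemma mcoeff_sum [simp]: "mcoeff (sum f A) m = (\<Sum>x\<in>A. mcoeff (f x) m)"
  by (induction A rule: infinite_finite_induct) auto

lemma symfun_eqI: "(\<And>m. mcoeff f m = mcoeff g m) \<Longrightarrow> f = g"
  by (meson ext mcoeff_inject)

lemma mcoeff_bounded: obtains n where "\<And>m. mcoeff f m \<noteq> 0 \<Longrightarrow> size m \<le> n"
  using mcoeff[of f] symmetric_series_bounded by auto

lemma mcoeff_perm: "bij \<pi> \<Longrightarrow> mcoeff f (image_mset \<pi> m) = mcoeff f m"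
  using mcoeff[of f] symmetric_series_perm by auto

section \<open>Multiplication by a power sum, seen on coefficients\<close>

text \<open>The series x_i^a f. The guard is needed because multiset subtraction truncates.\<close>

definition xmul :: "nat \<Rightarrow> nat \<Rightarrow> (nat multiset \<Rightarrow> real) \<Rightarrow> nat multiset \<Rightarrow> real" where
  "xmul i a f m = (if a \<le> count m i then f (m - replicate_mset a i) else 0)"

text \<open>Only variables occurring in \<open>m\<close> can supply a factor x_i^k, so the infinite
  sum over i collapses to \<open>set_mset m\<close>. For k > 0 the index i can be recovered from
  \<open>replicate_mset k i\<close>, so no splitting is counted twice.\<close>

lemma mcoeff_power_sum_mult:
  assumes "k > 0"
  shows "mcoeff (power_sum k * f) m = (\<Sum>i\<in>set_mset m. xmul i k (mcoeff f) m)"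
proof -
  let ?S = "{i \<in> set_mset m. k \<le> count m i}"
  let ?g = "\<lambda>i. (replicate_mset k i, m - replicate_mset k i)"
  have inj: "inj_on ?g ?S"
    using assms by (auto intro!: inj_onI simp: replicate_mset_eq_iff)
  have sub: "?g ` ?S \<subseteq> {(a, b). a + b = m}"
    by (auto simp: count_le_replicate_mset_subset_eq)
  have "mcoeff (power_sum k * f) m =
      (\<Sum>(a, b) | a + b = m. (if \<exists>i. a = replicate_mset k i then 1 else 0) * mcoeff f b)"
    by (simp add: times_symfun.rep_eq power_sum.rep_eq)
  also have "\<dots> = (\<Sum>(a, b) \<in> ?g ` ?S. (if \<exists>i. a = replicate_mset k i then 1 else 0) * mcoeff f b)"
  proof (rule sum.mono_neutral_right[OF finite_mset_splits sub], intro ballI)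
    fix p assume p: "p \<in> {(a, b). a + b = m} - ?g ` ?S"
    obtain a b where ab: "p = (a, b)" by (cases p)
    have "\<not> (\<exists>i. a = replicate_mset k i)"
    proof
      assume "\<exists>i. a = replicate_mset k i"
      then obtain i where i: "a = replicate_mset k i" by blast
      then have "p = ?g i" "i \<in> ?S"
        using p ab assms by auto
      with p show False by blast
    qed
    then show "(case p of (a, b) \<Rightarrow> (if \<exists>i. a = replicate_mset k i then 1 else 0) * mcoeff f b) = 0"
      by (simp add: ab)
  qed
  also have "\<dots> = (\<Sum>i\<in>?S. mcoeff f (m - replicate_mset k i))"
    by (subst sum.reindex[OF inj]) (auto intro!: sum.cong)
  also have "\<dots> = (\<Sum>i\<in>set_mset m. xmul i k (mcoeff f) m)"
    unfolding xmul_def by (rule sum.mono_neutral_cong_left) auto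
  finally show ?thesis .
qed

lemma power_prod_empty [simp]: "power_prod {#} = 1"
  by (simp add: power_prod_def)

lemma power_prod_add_mset [simp]: "power_prod (add_mset k \<nu>) = power_sum k * power_prod \<nu>"
  by (simp add: power_prod_def)

lemma partitions_empty [simp]: "{#} \<in> partitions"
  by (simp add: partitions_def)

lemma partitions_add_mset [simp]: "add_mset k \<nu> \<in> partitions \<longleftrightarrow> k > 0 \<and> \<nu> \<in> partitions"
  by (auto simp: partitions_def)

lemma partitions_induct [consumes 1, case_names empty add]:
  assumes "\<nu> \<in> partitions" "P {#}"
    "\<And>k \<nu>. k > 0 \<Longrightarrow> \<nu> \<in> partitions \<Longrightarrow> P \<nu> \<Longrightarrow> P (add_mset k \<nu>)"
  shows "P \<nu>"
  using assms(1)
proof (induction \<nu>)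
  case (add k \<nu>)
  then show ?case using assms(3)[of k \<nu>] by simp
qed (rule assms(2))

section \<open>Exponent types of monomials\<close>

lemma count_exponents_zero: "0 \<notin># exponents m"
  by (auto simp: exponents_def count_eq_zero_iff)

lemma exponents_partitions [simp]: "exponents m \<in> partitions"
  by (simp add: partitions_def count_exponents_zero)

lemma size_exponents: "size (exponents m) = card (set_mset m)"
  by (simp add: exponents_def)

lemma sum_mset_exponents [simp]: "sum_mset (exponents m) = size m"
  unfolding exponents_def by (simp add: size_multiset_overloaded_eq sum_unfold_sum_mset)

lemma sum_exponents: "(\<Sum>a\<in>#exponents m. g a) = (\<Sum>i\<in>set_mset m. g (count m i))"
  unfolding exponents_def by (simp add: image_mset.compositionality o_def sum_unfold_sum_mset)

lemma exponents_empty [simp]: "exponents {#} = {#}"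
  by (simp add: exponents_def)

lemma exponents_add_replicate:
  assumes "i \<notin># m" "k > 0"
  shows "exponents (m + replicate_mset k i) = add_mset k (exponents m)"
proof -
  have "set_mset (m + replicate_mset k i) = insert i (set_mset m)" using assms by auto
  moreover have "count m i = 0" using assms by (simp add: not_in_iff)
  moreover have "image_mset (\<lambda>x. count m x + (if x = i then k else 0)) (mset_set (set_mset m)) =
                 image_mset (count m) (mset_set (set_mset m))"
    using assms by (intro image_mset_cong) auto
  ultimately show ?thesis using assms
    by (auto simp: exponents_def fun_eq_iff intro!: image_mset_cong)
qed

lemma exponents_surj:
  assumes "\<nu> \<in> partitions" "finite F"
  shows "\<exists>m. exponents m = \<nu> \<and> set_mset m \<inter> F = {}"
  using assms
proof (induction rule: partitions_induct)
  case empty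
  show ?case by (rule exI[of _ "{#}"]) simp
next
  case (add k \<nu>)
  then obtain m where m: "exponents m = \<nu>" "set_mset m \<inter> F = {}" by blast
  obtain i where "i \<notin> set_mset m \<union> F"
    using ex_new_if_finite[of "set_mset m \<union> F"] add.prems infinite_UNIV_nat by auto
  then show ?case using m add.hyps exponents_add_replicate[of i m k]
    by (intro exI[of _ "m + replicate_mset k i"]) auto
qed

text \<open>A representative of the monomials of type \<nu>; by \<open>mcoeff_cong_exponents\<close>
  the coefficient there does not depend on the choice.\<close>

definition mono_of :: "nat multiset \<Rightarrow> nat multiset" where
  "mono_of \<nu> = (SOME m. exponents m = \<nu>)"

lemma exponents_mono_of [simp]: "\<nu> \<in> partitions \<Longrightarrow> exponents (mono_of \<nu>) = \<nu>"
  unfolding mono_of_def by (rule someI_ex) (use exponents_surj[of \<nu> "{}"] in auto)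

lemma size_mono_of [simp]: "\<nu> \<in> partitions \<Longrightarrow> size (mono_of \<nu>) = sum_mset \<nu>"
  using sum_mset_exponents[of "mono_of \<nu>"] by simp

lemma image_mset_set_eq_imp_bij:
  assumes "finite A" "finite B" "image_mset f (mset_set A) = image_mset g (mset_set B)"
  shows "\<exists>h. bij_betw h A B \<and> (\<forall>i\<in>A. g (h i) = f i)"
  using assms
proof (induction A arbitrary: B rule: finite_induct)
  case empty
  then show ?case by (auto simp: mset_set_empty_iff bij_betw_def)
next
  case (insert a A)
  have "f a \<in># image_mset f (mset_set (insert a A))" using insert.hyps by simp
  then have "f a \<in># image_mset g (mset_set B)" using insert.prems by simp
  then obtain b where b: "b \<in> B" "f a = g b" using insert.prems by auto
  have "mset_set B = add_mset b (mset_set (B - {b}))"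
    using b insert.prems by (metis mset_set.remove)
  then have "image_mset f (mset_set A) = image_mset g (mset_set (B - {b}))"
    using insert b by simp
  then obtain h where h: "bij_betw h A (B - {b})" "\<forall>i\<in>A. g (h i) = f i"
    using insert.IH[of "B - {b}"] insert.prems by auto
  have "bij_betw (h(a := b)) (insert a A) (insert b (B - {b}))"
    using h(1) insert.hyps by (auto simp: bij_betw_def inj_on_def)
  then show ?case using b h insert.hyps by (intro exI[of _ "h(a := b)"]) (auto simp: insert_absorb simp flip: fun_upd_def)
qed

lemma count_image_mset_inj: "inj f \<Longrightarrow> count (image_mset f m) (f i) = count m i"
  by (induction m) (auto dest: injD)

text \<open>Matching variables of equal exponent gives a bijection of the supports only. The two
  complements within the union of the supports have equal cardinality, so it extends to the union,
  and by the identity to all variables.\<close>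

lemma exponents_eq_obtain_perm:
  assumes "exponents m = exponents m'"
  obtains \<pi> where "bij \<pi>" "m' = image_mset \<pi> m"
proof -
  let ?A = "set_mset m" and ?B = "set_mset m'"
  from assms obtain g where g: "bij_betw g ?A ?B" "\<And>i. i \<in> ?A \<Longrightarrow> count m' (g i) = count m i"
    unfolding exponents_def using image_mset_set_eq_imp_bij[of ?A ?B "count m" "count m'"] by auto
  have fin: "finite (?A \<union> ?B)" by simp
  have "card (?A \<union> ?B - ?A) = card (?A \<union> ?B - ?B)"
    using bij_betw_same_card[OF g(1)] by (simp add: card_Diff_subset)
  then obtain h where h: "bij_betw h (?A \<union> ?B - ?A) (?A \<union> ?B - ?B)"
    using finite_same_card_bij[of "?A \<union> ?B - ?A" "?A \<union> ?B - ?B"] by auto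
  let ?p = "\<lambda>i. if i \<in> ?A then g i else if i \<in> ?A \<union> ?B then h i else i"
  have "bij_betw ?p ?A ?B" using g(1) by (rule bij_betw_cong[THEN iffD1, rotated]) auto
  moreover have "bij_betw ?p (?A \<union> ?B - ?A) (?A \<union> ?B - ?B)"
    using h by (rule bij_betw_cong[THEN iffD1, rotated]) auto
  ultimately have "bij_betw ?p (?A \<union> (?A \<union> ?B - ?A)) (?B \<union> (?A \<union> ?B - ?B))"
    by (rule bij_betw_combine) auto
  moreover have "bij_betw ?p (- (?A \<union> ?B)) (- (?A \<union> ?B))"
    using bij_betw_id by (rule bij_betw_cong[THEN iffD1, rotated]) (auto simp: id_def)
  ultimately have "bij_betw ?p ((?A \<union> (?A \<union> ?B - ?A)) \<union> - (?A \<union> ?B)) ((?B \<union> (?A \<union> ?B - ?B)) \<union> - (?A \<union> ?B))"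
    by (rule bij_betw_combine) auto
  moreover have "(?A \<union> (?A \<union> ?B - ?A)) \<union> - (?A \<union> ?B) = UNIV" "(?B \<union> (?A \<union> ?B - ?B)) \<union> - (?A \<union> ?B) = UNIV"
    by auto
  ultimately have bij: "bij ?p" by simp
  have "m' = image_mset ?p m"
  proof (rule multiset_eqI)
    fix x
    show "count m' x = count (image_mset ?p m) x"
    proof (cases "x \<in> ?B")
      case True
      then obtain i where i: "i \<in> ?A" "x = g i" using g(1) by (auto simp: bij_betw_def)
      have "count (image_mset ?p m) (?p i) = count m i"
        by (rule count_image_mset_inj[OF bij_is_inj[OF bij]])
      then show ?thesis using i g(2) by simp
    next
      case False
      then have "x \<notin> set_mset (image_mset ?p m)" using g(1) by (auto simp: bij_betw_def)
      then show ?thesis using False unfolding not_in_iff by (simp only:)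
    qed
  qed
  with bij that show ?thesis by blast
qed

lemma mcoeff_cong_exponents: "exponents m = exponents m' \<Longrightarrow> mcoeff f m = mcoeff f m'"
  by (erule exponents_eq_obtain_perm) (simp add: mcoeff_perm)

section \<open>Triangularity of power sum products with respect to length\<close>

lemma mcoeff_power_prod_add:
  "k > 0 \<Longrightarrow> mcoeff (power_prod (add_mset k \<nu>)) m = (\<Sum>i\<in>set_mset m. xmul i k (mcoeff (power_prod \<nu>)) m)"
  by (simp add: mcoeff_power_sum_mult)

lemma mcoeff_power_prod_nonneg: "\<nu> \<in> partitions \<Longrightarrow> mcoeff (power_prod \<nu>) m \<ge> 0"
  by (induction \<nu> arbitrary: m rule: partitions_induct)
     (auto simp: mcoeff_one mcoeff_power_prod_add xmul_def simp del: power_prod_add_mset intro!: sum_nonneg)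

lemma mcoeff_power_prod_add_nonzeroE:
  assumes "k > 0" "mcoeff (power_prod (add_mset k \<nu>)) m \<noteq> 0"
  obtains i m' where "m = m' + replicate_mset k i" "mcoeff (power_prod \<nu>) m' \<noteq> 0"
proof -
  from assms obtain i where "i \<in> set_mset m" "xmul i k (mcoeff (power_prod \<nu>)) m \<noteq> 0"
    unfolding mcoeff_power_prod_add[OF assms(1)] by (metis sum.neutral)
  then have "k \<le> count m i" "mcoeff (power_prod \<nu>) (m - replicate_mset k i) \<noteq> 0"
    by (auto simp: xmul_def split: if_splits)
  then show ?thesis using that[of "m - replicate_mset k i" i]
    by (simp add: count_le_replicate_mset_subset_eq)
qed

lemma mcoeff_power_prod_size:
  "\<nu> \<in> partitions \<Longrightarrow> mcoeff (power_prod \<nu>) m \<noteq> 0 \<Longrightarrow> size m = sum_mset \<nu>"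
proof (induction \<nu> arbitrary: m rule: partitions_induct)
  case (add k \<nu>)
  obtain i m' where "m = m' + replicate_mset k i" "mcoeff (power_prod \<nu>) m' \<noteq> 0"
    by (rule mcoeff_power_prod_add_nonzeroE[OF add.hyps(1) add.prems])
  then show ?case using add.IH[of m'] by simp
qed (simp add: mcoeff_one split: if_splits)

text \<open>Each factor p_k either brings a new variable or merges into one already present. The
  number of variables is maximal only without merging, and then the exponents are the parts.\<close>

lemma mcoeff_power_prod_card:
  "\<nu> \<in> partitions \<Longrightarrow> mcoeff (power_prod \<nu>) m \<noteq> 0 \<Longrightarrow>
    card (set_mset m) \<le> size \<nu> \<and> (card (set_mset m) = size \<nu> \<longrightarrow> exponents m = \<nu>)"
proof (induction \<nu> arbitrary: m rule: partitions_induct)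
  case (add k \<nu>)
  obtain i m' where m: "m = m' + replicate_mset k i" "mcoeff (power_prod \<nu>) m' \<noteq> 0"
    by (rule mcoeff_power_prod_add_nonzeroE[OF add.hyps(1) add.prems])
  have IH: "card (set_mset m') \<le> size \<nu>" "card (set_mset m') = size \<nu> \<Longrightarrow> exponents m' = \<nu>"
    using add.IH[OF m(2)] by auto
  have set: "set_mset m = insert i (set_mset m')" using m(1) add.hyps(1) by auto
  show ?case
  proof (cases "i \<in># m'")
    case True
    then show ?thesis using IH set by (simp add: insert_absorb)
  next
    case False
    then show ?thesis using IH set m(1) add.hyps(1) by (auto simp: exponents_add_replicate)
  qed
qed (simp add: mcoeff_one split: if_splits)

lemma mcoeff_power_prod_exponents: "mcoeff (power_prod (exponents m)) m > 0"
proof -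
  have "\<nu> \<in> partitions \<Longrightarrow> exponents m = \<nu> \<Longrightarrow> mcoeff (power_prod \<nu>) m > 0" for \<nu>
  proof (induction \<nu> arbitrary: m rule: partitions_induct)
    case empty
    then have "size m = 0" by (metis sum_mset_exponents sum_mset.empty)
    then show ?case by (simp add: mcoeff_one)
  next
    case (add k \<nu>)
    have "k \<in># exponents m" using add.prems by simp
    then obtain i where i: "i \<in># m" "count m i = k" by (auto simp: exponents_def)
    define m' where "m' = m - replicate_mset k i"
    have m': "m = m' + replicate_mset k i"
      by (rule multiset_eqI) (use i in \<open>auto simp: m'_def\<close>)
    have im': "i \<notin># m'" using i by (auto simp: m'_def not_in_iff)
    have "exponents m' = \<nu>"
      using m' exponents_add_replicate[OF im' add.hyps(1)] add.prems by simp
    then have "xmul i k (mcoeff (power_prod \<nu>)) m > 0"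
      using add.IH[of m'] i by (simp add: xmul_def m'_def)
    moreover have "xmul j k (mcoeff (power_prod \<nu>)) m \<ge> 0" for j
      using mcoeff_power_prod_nonneg[OF add.hyps(2)] by (simp add: xmul_def)
    ultimately show ?case unfolding mcoeff_power_prod_add[OF add.hyps(1)]
      using i(1) by (intro sum_pos2[of _ i]) auto
  qed
  then show ?thesis by simp
qed

lemma mcoeff_power_prod_mono_of: "\<nu> \<in> partitions \<Longrightarrow> mcoeff (power_prod \<nu>) (mono_of \<nu>) > 0"
  using mcoeff_power_prod_exponents[of "mono_of \<nu>"] by simp

lemma inj_on_power_prod: "inj_on power_prod partitions"
proof (rule inj_onI)
  fix \<mu> \<nu> assume *: "\<mu> \<in> partitions" "\<nu> \<in> partitions" "power_prod \<mu> = power_prod \<nu>"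
  have "size \<mu> \<le> size \<nu> \<and> (size \<mu> = size \<nu> \<longrightarrow> \<mu> = \<nu>)"
    using mcoeff_power_prod_card[of \<nu> "mono_of \<mu>"] mcoeff_power_prod_mono_of[of \<mu>] * size_exponents[of "mono_of \<mu>"]
    by auto
  moreover have "size \<nu> \<le> size \<mu>"
    using mcoeff_power_prod_card[of \<mu> "mono_of \<nu>"] mcoeff_power_prod_mono_of[of \<nu>] * size_exponents[of "mono_of \<nu>"]
    by auto
  ultimately show "\<mu> = \<nu>" by simp
qed

text \<open>In a vanishing combination take \<nu> of maximal length with nonzero coefficient. By
  \<open>mcoeff_power_prod_card\<close> its own monomial type occurs in no other term, so that
  coefficient cannot cancel.\<close>

lemma independent_power_prod: "independent (power_prod ` partitions)"
proof
  assume "dependent (power_prod ` partitions)"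
  then obtain U u v where U: "finite U" "U \<subseteq> power_prod ` partitions" "v \<in> U" "u v \<noteq> 0"
      "(\<Sum>v\<in>U. u v *\<^sub>R v) = 0"
    unfolding dependent_explicit by blast
  define V where "V = {\<nu> \<in> partitions. power_prod \<nu> \<in> U}"
  have UV: "U = power_prod ` V" using U(2) by (auto simp: V_def)
  have inj: "inj_on power_prod V" by (rule inj_on_subset[OF inj_on_power_prod]) (auto simp: V_def)
  have fin: "finite V" using U(1) inj unfolding UV by (rule finite_imageD)
  define W where "W = {\<nu> \<in> V. u (power_prod \<nu>) \<noteq> 0}"
  have W: "finite W" "W \<noteq> {}" using fin U(3,4) by (auto simp: W_def UV)
  obtain \<nu> where \<nu>: "\<nu> \<in> W" "\<And>\<mu>. \<mu> \<in> W \<Longrightarrow> size \<mu> \<le> size \<nu>"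
  proof -
    have "Max (size ` W) \<in> size ` W" using W by simp
    then obtain \<nu> where "\<nu> \<in> W" "size \<nu> = Max (size ` W)" by auto
    then show ?thesis using that[of \<nu>] W by simp
  qed
  have part: "\<nu> \<in> partitions" "\<nu> \<in> V" using \<nu>(1) by (auto simp: W_def V_def)
  have "0 = mcoeff (\<Sum>\<mu>\<in>V. u (power_prod \<mu>) *\<^sub>R power_prod \<mu>) (mono_of \<nu>)"
    using U(5) sum.reindex[OF inj, of "\<lambda>v. u v *\<^sub>R v"] by (simp add: UV)
  also have "\<dots> = (\<Sum>\<mu>\<in>V. u (power_prod \<mu>) * mcoeff (power_prod \<mu>) (mono_of \<nu>))" by simp
  also have "\<dots> = (\<Sum>\<mu>\<in>{\<nu>}. u (power_prod \<mu>) * mcoeff (power_prod \<mu>) (mono_of \<nu>))"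
  proof (rule sum.mono_neutral_right)
    show "\<forall>\<mu>\<in>V - {\<nu>}. u (power_prod \<mu>) * mcoeff (power_prod \<mu>) (mono_of \<nu>) = 0"
    proof
      fix \<mu> assume \<mu>: "\<mu> \<in> V - {\<nu>}"
      show "u (power_prod \<mu>) * mcoeff (power_prod \<mu>) (mono_of \<nu>) = 0"
      proof (cases "\<mu> \<in> W")
        case True
        then show ?thesis
          using mcoeff_power_prod_card[of \<mu> "mono_of \<nu>"] \<nu>(2)[of \<mu>] \<mu> part size_exponents[of "mono_of \<nu>"]
          by (auto simp: V_def)
      qed (use \<mu> in \<open>auto simp: W_def\<close>)
    qed
  qed (use fin part in auto)
  finally show False using mcoeff_power_prod_mono_of[OF part(1)] \<nu>(1) by (simp add: W_def)
qed

lemma finite_partitions_le: "finite {\<nu> \<in> partitions. sum_mset \<nu> \<le> n}"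
proof -
  have "{\<nu> \<in> partitions. sum_mset \<nu> \<le> n} \<subseteq> (\<Union>l\<le>n. multisets_of_size {..n} l)"
  proof safe
    fix \<nu> assume \<nu>: "\<nu> \<in> partitions" "sum_mset \<nu> \<le> n"
    have "size \<nu> \<le> sum_mset \<nu>" using \<nu>(1) by (induction rule: partitions_induct) auto
    moreover have "set_mset \<nu> \<subseteq> {..n}"
      using \<nu>(2) by (auto dest!: multi_member_split)
    ultimately show "\<nu> \<in> (\<Union>l\<le>n. multisets_of_size {..n} l)"
      using \<nu>(2) by (auto simp: multisets_of_size_def)
  qed
  then show ?thesis by (rule finite_subset) auto
qed

lemma finite_partitions_eq: "finite {\<nu> \<in> partitions. sum_mset \<nu> = n}"
  by (rule finite_subset[OF _ finite_partitions_le[of n]]) auto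

text \<open>Elimination by number of variables: the coefficients at monomials with the largest
  number l of variables are matched by products of l power sums, which otherwise bring in only
  monomials with fewer variables. The process ends because a monomial has at most as many variables
  as its degree.\<close>

lemma span_power_prod_le:
  assumes "\<And>m. mcoeff f m \<noteq> 0 \<Longrightarrow> size m \<le> n"
  shows "f \<in> span (power_prod ` {\<nu> \<in> partitions. sum_mset \<nu> \<le> n})"
proof -
  let ?S = "span (power_prod ` {\<nu> \<in> partitions. sum_mset \<nu> \<le> n})"
  have "(\<And>m. mcoeff f m \<noteq> 0 \<Longrightarrow> size m \<le> n \<and> card (set_mset m) < l) \<Longrightarrow> f \<in> ?S" for l
  proof (induction l arbitrary: f)
    case 0
    then have "f = 0" by (intro symfun_eqI) auto
    then show ?case by (simp add: span_zero)
  next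
    case (Suc l)
    define V where "V = {\<nu> \<in> partitions. sum_mset \<nu> \<le> n \<and> size \<nu> = l}"
    have fin: "finite V" by (rule finite_subset[OF _ finite_partitions_le[of n]]) (auto simp: V_def)
    define c where "c \<nu> = mcoeff f (mono_of \<nu>) / mcoeff (power_prod \<nu>) (mono_of \<nu>)" for \<nu>
    define g where "g = (\<Sum>\<nu>\<in>V. c \<nu> *\<^sub>R power_prod \<nu>)"
    have g: "g \<in> ?S" unfolding g_def
      by (intro span_sum span_scale span_base) (auto simp: V_def)
    have g0: "size m \<le> n \<and> card (set_mset m) \<le> l" if "mcoeff g m \<noteq> 0" for m
    proof -
      from that obtain \<nu> where \<nu>: "\<nu> \<in> V" "mcoeff (power_prod \<nu>) m \<noteq> 0"
        unfolding g_def by (auto elim!: sum.not_neutral_contains_not_neutral)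
      then show ?thesis using mcoeff_power_prod_size[of \<nu> m] mcoeff_power_prod_card[of \<nu> m]
        by (auto simp: V_def)
    qed
    have gl: "mcoeff g m = mcoeff f m" if m: "card (set_mset m) = l" for m
    proof (cases "size m \<le> n")
      case True
      have mV: "exponents m \<in> V" using m True by (simp add: V_def size_exponents)
      have "mcoeff g m = (\<Sum>\<nu>\<in>V. c \<nu> * mcoeff (power_prod \<nu>) m)" by (simp add: g_def)
      also have "\<dots> = (\<Sum>\<nu>\<in>{exponents m}. c \<nu> * mcoeff (power_prod \<nu>) m)"
      proof (rule sum.mono_neutral_right)
        show "\<forall>\<nu>\<in>V - {exponents m}. c \<nu> * mcoeff (power_prod \<nu>) m = 0"
          using mcoeff_power_prod_card[of _ m] m by (auto simp: V_def)
      qed (use fin mV in auto)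
      also have "\<dots> = mcoeff f m"
        using mcoeff_power_prod_exponents[of m] 
          mcoeff_cong_exponents[of "mono_of (exponents m)" m f]
          mcoeff_cong_exponents[of "mono_of (exponents m)" m "power_prod (exponents m)"]
        by (simp add: c_def)
      finally show ?thesis .
    next
      case False
      then show ?thesis using g0[of m] Suc.prems[of m] by metis
    qed
    have "f - g \<in> ?S"
    proof (rule Suc.IH)
      fix m assume m: "mcoeff (f - g) m \<noteq> 0"
      have "mcoeff f m \<noteq> 0 \<or> mcoeff g m \<noteq> 0" using m by auto
      then have "size m \<le> n \<and> card (set_mset m) \<le> l" using Suc.prems[of m] g0[of m] by auto
      moreover have "card (set_mset m) \<noteq> l" using m gl[of m] by auto
      ultimately show "size m \<le> n \<and> card (set_mset m) < l" by auto
    qed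
    then show ?case using span_add[OF _ g, of "f - g"] by simp
  qed
  moreover have "card (set_mset m) \<le> size m" for m :: "nat multiset"
    by (induction m) (auto intro: card_insert_le_m1 simp: card_insert_if)
  ultimately show ?thesis using assms by (metis le_imp_less_Suc le_trans)
qed

lemma span_power_prod: "f \<in> span (power_prod ` partitions)"
proof -
  obtain n where "\<And>m. mcoeff f m \<noteq> 0 \<Longrightarrow> size m \<le> n" using mcoeff_bounded[of f] by blast
  then have "f \<in> span (power_prod ` {\<nu> \<in> partitions. sum_mset \<nu> \<le> n})" by (rule span_power_prod_le)
  then show ?thesis by (rule rev_subsetD) (intro span_mono, auto)
qed

lemma linear_ext_power_prod:
  fixes F G :: "symfun \<Rightarrow> 'a::real_vector"
  assumes "linear F" "linear G" "\<And>\<nu>. \<nu> \<in> partitions \<Longrightarrow> F (power_prod \<nu>) = G (power_prod \<nu>)"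
  shows "F f = G f"
  by (rule linear_eq_on[OF assms(1,2) span_power_prod]) (use assms(3) in auto)

lemma linear_p_coeff: "linear (\<lambda>f. p_coeff f \<nu>)"
  by (rule linearI)
     (simp_all add: p_coeff_def span_power_prod independent_power_prod
        real_vector.representation_add real_vector.representation_scale)

lemma p_coeff_power_prod:
  "\<mu> \<in> partitions \<Longrightarrow> \<nu> \<in> partitions \<Longrightarrow> p_coeff (power_prod \<mu>) \<nu> = (if \<mu> = \<nu> then 1 else 0)"
  using inj_on_power_prod
  by (auto simp: p_coeff_def real_vector.representation_basis[OF independent_power_prod] inj_on_def)

lemma finite_p_coeff: "finite {\<nu> \<in> partitions. p_coeff f \<nu> \<noteq> 0}"
proof (rule finite_imageD)
  show "finite (power_prod ` {\<nu> \<in> partitions. p_coeff f \<nu> \<noteq> 0})"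
    by (rule finite_subset[OF _ real_vector.finite_representation[of "power_prod ` partitions" f]])
       (auto simp: p_coeff_def)
  show "inj_on power_prod {\<nu> \<in> partitions. p_coeff f \<nu> \<noteq> 0}"
    by (rule inj_on_subset[OF inj_on_power_prod]) auto
qed

lemma p_expansion_superset:
  assumes "finite A" "A \<subseteq> partitions" "{\<nu> \<in> partitions. p_coeff f \<nu> \<noteq> 0} \<subseteq> A"
  shows "f = (\<Sum>\<nu>\<in>A. p_coeff f \<nu> *\<^sub>R power_prod \<nu>)"
proof -
  have inj: "inj_on power_prod A" by (rule inj_on_subset[OF inj_on_power_prod assms(2)])
  let ?r = "representation (power_prod ` partitions) f"
  have "f = (\<Sum>b | ?r b \<noteq> 0. ?r b *\<^sub>R b)"
    using real_vector.sum_nonzero_representation_eq[OF independent_power_prod span_power_prod] by simp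
  also have "\<dots> = (\<Sum>b\<in>power_prod ` A. ?r b *\<^sub>R b)"
  proof (rule sum.mono_neutral_left)
    show "{b. ?r b \<noteq> 0} \<subseteq> power_prod ` A"
      using real_vector.representation_ne_zero[of "power_prod ` partitions" f] assms(3)
      by (fastforce simp: p_coeff_def)
  qed (use assms in auto)
  also have "\<dots> = (\<Sum>\<nu>\<in>A. p_coeff f \<nu> *\<^sub>R power_prod \<nu>)"
    by (simp add: sum.reindex[OF inj] p_coeff_def)
  finally show ?thesis .
qed

lemma p_expansion: "f = (\<Sum>\<nu> | \<nu> \<in> partitions \<and> p_coeff f \<nu> \<noteq> 0. p_coeff f \<nu> *\<^sub>R power_prod \<nu>)"
  by (rule p_expansion_superset[OF finite_p_coeff]) auto

section \<open>Derivatives in the power sums and the scalar product\<close>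

text \<open>The derivative with respect to p_k when p_1, p_2, ... are regarded as independent
  generators.\<close>

definition pdiff :: "nat \<Rightarrow> symfun \<Rightarrow> symfun" where
  "pdiff k = construct (power_prod ` partitions)
     (\<lambda>b. let \<nu> = inv_into partitions power_prod b in real (count \<nu> k) *\<^sub>R power_prod (\<nu> - {#k#}))"

lemma linear_pdiff: "linear (pdiff k)"
  unfolding pdiff_def by (rule linear_construct[OF independent_power_prod])

lemma pdiff_power_prod:
  "\<nu> \<in> partitions \<Longrightarrow> pdiff k (power_prod \<nu>) = real (count \<nu> k) *\<^sub>R power_prod (\<nu> - {#k#})"
  unfolding pdiff_def
  by (subst construct_basis[OF independent_power_prod])
     (auto simp: inv_into_f_f[OF inj_on_power_prod])

lemma linear_mult_left: "linear (\<lambda>f :: symfun. g * f)"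
  by (rule linearI) (auto simp: algebra_simps)

text \<open>The Leibniz rule when one factor is a generator, which is the case met in inductions
  over \<open>power_prod\<close>.\<close>

lemma pdiff_power_sum_mult:
  assumes "b > 0"
  shows "pdiff a (power_sum b * f) = (if a = b then f else 0) + power_sum b * pdiff a f"
proof (rule linear_ext_power_prod[where F = "\<lambda>f. pdiff a (power_sum b * f)" and
    G = "\<lambda>f. (if a = b then f else 0) + power_sum b * pdiff a f"])
  show "linear (\<lambda>f. pdiff a (power_sum b * f))"
    using linear_compose[OF linear_mult_left linear_pdiff] by (simp add: o_def)
  show "linear (\<lambda>f. (if a = b then f else 0) + power_sum b * pdiff a f)"
    using linear_compose[OF linear_pdiff linear_mult_left]
    by (intro linear_compose_add) (auto simp: o_def linear_iff)
  fix \<nu> assume \<nu>: "\<nu> \<in> partitions"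
  have "pdiff a (power_sum b * power_prod \<nu>) =
      real (count (add_mset b \<nu>) a) *\<^sub>R power_prod (add_mset b \<nu> - {#a#})"
    using pdiff_power_prod[of "add_mset b \<nu>" a] \<nu> assms by simp
  also have "\<dots> = (if a = b then power_prod \<nu> else 0) + power_sum b * pdiff a (power_prod \<nu>)"
  proof (cases "a = b")
    case False
    have "count \<nu> a > 0 \<Longrightarrow> add_mset b \<nu> - {#a#} = add_mset b (\<nu> - {#a#})"
      using False by (simp add: add_mset_diff_bothsides)
    then show ?thesis using False \<nu> by (cases "count \<nu> a = 0") (auto simp: pdiff_power_prod)
  next
    case True
    have "power_prod \<nu> = power_sum a * power_prod (\<nu> - {#a#})" if "count \<nu> a > 0"
      using that by (metis count_greater_zero_iff insert_DiffM power_prod_add_mset)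
    then have "real (count \<nu> a) *\<^sub>R (power_sum a * power_prod (\<nu> - {#a#})) = real (count \<nu> a) *\<^sub>R power_prod \<nu>"
      by (cases "count \<nu> a = 0") simp_all
    then have "power_sum a * pdiff a (power_prod \<nu>) = real (count \<nu> a) *\<^sub>R power_prod \<nu>"
      unfolding pdiff_power_prod[OF \<nu>] by simp
    then show ?thesis using True by (simp add: scaleR_add_left)
  qed
  finally show "pdiff a (power_sum b * power_prod \<nu>) =
      (if a = b then power_prod \<nu> else 0) + power_sum b * pdiff a (power_prod \<nu>)" .
qed

lemma z_factor_pos: "\<nu> \<in> partitions \<Longrightarrow> z_factor \<nu> > 0"
  unfolding z_factor_def partitions_def
proof (intro prod_pos ballI)
  fix i assume "\<nu> \<in> {\<nu>. 0 \<notin># \<nu>}" "i \<in> set_mset \<nu>"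
  then have "i > 0" by (cases "i = 0") auto
  then show "real (i ^ count \<nu> i * fact (count \<nu> i)) > 0" by simp
qed

text \<open>The gain is k times the new multiplicity of k. The multiplicity is what
  \<open>pdiff k\<close> produces, so k is left for the adjointness relation.\<close>

lemma z_factor_add_mset:
  "z_factor (add_mset k \<nu>) = z_factor \<nu> * (real k * real (count \<nu> k + 1))"
proof -
  let ?h = "\<lambda>\<nu> i. real (i ^ count \<nu> i * fact (count \<nu> i))"
  have sup: "z_factor \<mu> = (\<Prod>i\<in>S. ?h \<mu> i)" if "finite S" "set_mset \<mu> \<subseteq> S" for \<mu> S
    unfolding z_factor_def by (rule prod.mono_neutral_left) (use that in \<open>auto simp: not_in_iff\<close>)
  let ?S = "insert k (set_mset \<nu>)"
  have rem: "(\<Prod>i\<in>?S. h i) = h k * (\<Prod>i\<in>?S - {k}. h i)" for h :: "nat \<Rightarrow> real"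
    by (rule prod.remove) auto
  have "z_factor (add_mset k \<nu>) = ?h (add_mset k \<nu>) k * (\<Prod>i\<in>?S - {k}. ?h (add_mset k \<nu>) i)"
    by (rule trans[OF sup[of ?S "add_mset k \<nu>"] rem]) auto
  also have "(\<Prod>i\<in>?S - {k}. ?h (add_mset k \<nu>) i) = (\<Prod>i\<in>?S - {k}. ?h \<nu> i)"
    by (rule prod.cong) auto
  also have "?h (add_mset k \<nu>) k = (real k * real (count \<nu> k + 1)) * ?h \<nu> k"
  proof -
    have "real (k ^ Suc n * fact (Suc n)) = (real k * real (n + 1)) * real (k ^ n * fact n)" for n
      by (simp add: algebra_simps)
    from this[of "count \<nu> k"] show ?thesis by (simp only: count_add_mset simp_thms if_True)
  qed
  also have "\<dots> * (\<Prod>i\<in>?S - {k}. ?h \<nu> i) = z_factor \<nu> * (real k * real (count \<nu> k + 1))"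
    using sup[of ?S \<nu>] rem[of "?h \<nu>"] by (simp only: finite_insert finite_set_mset subset_insertI mult_ac)
  finally show ?thesis .
qed

lemma jack_form_superset:
  assumes "finite A" "A \<subseteq> partitions" "{\<nu> \<in> partitions. p_coeff f \<nu> \<noteq> 0} \<subseteq> A"
  shows "jack_form \<alpha> f g = (\<Sum>\<nu>\<in>A. p_coeff f \<nu> * p_coeff g \<nu> * (\<alpha> ^ size \<nu> * z_factor \<nu>))"
  unfolding jack_form_def by (rule sum.mono_neutral_left) (use assms in auto)

lemma jack_form_sym: "jack_form \<alpha> f g = jack_form \<alpha> g f"
proof -
  let ?A = "{\<nu> \<in> partitions. p_coeff f \<nu> \<noteq> 0} \<union> {\<nu> \<in> partitions. p_coeff g \<nu> \<noteq> 0}"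
  have "finite ?A" "?A \<subseteq> partitions" using finite_p_coeff by auto
  then show ?thesis
    by (subst (1 2) jack_form_superset[of ?A]) (auto simp: mult.commute)
qed

lemma linear_jack_form_right: "linear (\<lambda>g. jack_form \<alpha> f g)"
  unfolding jack_form_def
  by (rule linearI)
     (simp_all add: linear_add[OF linear_p_coeff] linear_scale[OF linear_p_coeff]
        algebra_simps sum.distrib sum_distrib_left)

lemma linear_jack_form_left: "linear (\<lambda>f. jack_form \<alpha> f g)"
  using linear_jack_form_right[of \<alpha> g] by (simp add: jack_form_sym[of \<alpha> _ g])

lemmas jack_form_simps =
  linear_add[OF linear_jack_form_right] linear_add[OF linear_jack_form_left]
  linear_diff[OF linear_jack_form_right] linear_diff[OF linear_jack_form_left]
  linear_scale[OF linear_jack_form_right] linear_scale[OF linear_jack_form_left]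
  linear_0[OF linear_jack_form_right] linear_0[OF linear_jack_form_left]
  linear_sum[OF linear_jack_form_right] linear_sum[OF linear_jack_form_left]

lemma jack_form_pos:
  assumes "\<alpha> > 0" "f \<noteq> 0"
  shows "jack_form \<alpha> f f > 0"
proof -
  let ?A = "{\<nu> \<in> partitions. p_coeff f \<nu> \<noteq> 0}"
  have "?A \<noteq> {}"
  proof
    assume "?A = {}"
    then have "f = 0" using p_expansion[of f] by simp
    with assms show False by simp
  qed
  then show ?thesis unfolding jack_form_def using assms z_factor_pos
    by (intro sum_pos finite_p_coeff) (auto simp: zero_less_mult_iff linorder_neq_iff)
qed

lemma jack_form_power_prod:
  "\<mu> \<in> partitions \<Longrightarrow> \<nu> \<in> partitions \<Longrightarrow>
    jack_form \<alpha> (power_prod \<mu>) (power_prod \<nu>) = (if \<mu> = \<nu> then \<alpha> ^ size \<mu> * z_factor \<mu> else 0)"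
  by (subst jack_form_superset[of "{\<mu>}"]) (auto simp: p_coeff_power_prod split: if_splits)

text \<open>On basis elements both sides vanish unless the right index is the left one with a part k
  added. In that case the norm grows by \<alpha> k times the new multiplicity, and differentiation
  accounts for the multiplicity.\<close>

lemma jack_form_power_sum_mult:
  assumes "k > 0"
  shows "jack_form \<alpha> (power_sum k * f) g = \<alpha> * real k * jack_form \<alpha> f (pdiff k g)"
proof (rule linear_ext_power_prod[where F = "\<lambda>f. jack_form \<alpha> (power_sum k * f) g" and
    G = "\<lambda>f. \<alpha> * real k * jack_form \<alpha> f (pdiff k g)"])
  show "linear (\<lambda>f. jack_form \<alpha> (power_sum k * f) g)"
    using linear_compose[OF linear_mult_left linear_jack_form_left] by (simp add: o_def)
  show "linear (\<lambda>f. \<alpha> * real k * jack_form \<alpha> f (pdiff k g))"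
    by (rule linearI) (auto simp: jack_form_simps algebra_simps)
  fix \<mu> assume \<mu>: "\<mu> \<in> partitions"
  show "jack_form \<alpha> (power_sum k * power_prod \<mu>) g = \<alpha> * real k * jack_form \<alpha> (power_prod \<mu>) (pdiff k g)"
  proof (rule linear_ext_power_prod[where F = "\<lambda>g. jack_form \<alpha> (power_sum k * power_prod \<mu>) g" and
      G = "\<lambda>g. \<alpha> * real k * jack_form \<alpha> (power_prod \<mu>) (pdiff k g)"])
    show "linear (\<lambda>g. jack_form \<alpha> (power_sum k * power_prod \<mu>) g)" by (rule linear_jack_form_right)
    show "linear (\<lambda>g. \<alpha> * real k * jack_form \<alpha> (power_prod \<mu>) (pdiff k g))"
      by (rule linearI) (auto simp: jack_form_simps linear_add[OF linear_pdiff] linear_scale[OF linear_pdiff] algebra_simps)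
    fix \<nu> assume \<nu>: "\<nu> \<in> partitions"
    have *: "jack_form \<alpha> (power_sum k * power_prod \<mu>) (power_prod \<nu>) =
        (if add_mset k \<mu> = \<nu> then \<alpha> ^ size \<nu> * z_factor \<nu> else 0)"
      using jack_form_power_prod[of "add_mset k \<mu>" \<nu>] \<mu> \<nu> assms by auto
    show "jack_form \<alpha> (power_sum k * power_prod \<mu>) (power_prod \<nu>) =
        \<alpha> * real k * jack_form \<alpha> (power_prod \<mu>) (pdiff k (power_prod \<nu>))"
    proof (cases "k \<in># \<nu>")
      case True
      then obtain \<nu>' where \<nu>': "\<nu> = add_mset k \<nu>'" by (metis multi_member_split)
      have part: "\<nu>' \<in> partitions" using \<nu> \<nu>' by simp
      have "pdiff k (power_prod \<nu>) = real (count \<nu>' k + 1) *\<^sub>R power_prod \<nu>'"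
        unfolding pdiff_power_prod[OF \<nu>] by (simp add: \<nu>')
      then have "jack_form \<alpha> (power_prod \<mu>) (pdiff k (power_prod \<nu>)) =
          real (count \<nu>' k + 1) * (if \<mu> = \<nu>' then \<alpha> ^ size \<mu> * z_factor \<mu> else 0)"
        using \<mu> part by (simp only: jack_form_simps jack_form_power_prod real_scaleR_def)
      then show ?thesis unfolding * by (simp add: \<nu>' z_factor_add_mset)
    next
      case False
      then show ?thesis using \<mu> \<nu> unfolding *
        by (auto simp: pdiff_power_prod not_in_iff jack_form_simps)
    qed
  qed
qed

section \<open>A self-adjoint family of operators\<close>

lemma xmul_0 [simp]: "xmul i a (\<lambda>_. 0) m = 0"
  by (simp add: xmul_def)

lemma xmul_eq_0: "count m i < a \<Longrightarrow> xmul i a f m = 0"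
  by (simp add: xmul_def)

lemma xmul_scale: "xmul i a (\<lambda>m. c * f m) m = c * xmul i a f m"
  by (simp add: xmul_def)

lemma xmul_sum: "xmul i a (\<lambda>m. \<Sum>x\<in>A. f x m) m = (\<Sum>x\<in>A. xmul i a (f x) m)"
  by (simp add: xmul_def)

lemma xmul_commute: "xmul i a (xmul j b f) m = xmul j b (xmul i a f) m"
proof -
  have "m - replicate_mset a i - replicate_mset b j = m - replicate_mset b j - replicate_mset a i"
    by (rule multiset_eqI) auto
  then show ?thesis by (auto simp: xmul_def)
qed

lemma xmul_xmul: "xmul i a (xmul i b f) m = xmul i (a + b) f m"
proof -
  have "m - replicate_mset a i - replicate_mset b i = m - replicate_mset (a + b) i"
    by (rule multiset_eqI) auto
  then show ?thesis by (auto simp: xmul_def)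
qed

lemma xmul_power_sum_mult:
  assumes "b > 0"
  shows "xmul i a (mcoeff (power_sum b * g)) m = (\<Sum>j\<in>set_mset m. xmul j b (xmul i a (mcoeff g)) m)"
proof (cases "a \<le> count m i")
  case True
  have "xmul i a (mcoeff (power_sum b * g)) m =
      (\<Sum>j\<in>set_mset (m - replicate_mset a i). xmul j b (mcoeff g) (m - replicate_mset a i))"
    using True by (simp add: xmul_def mcoeff_power_sum_mult[OF assms])
  also have "\<dots> = (\<Sum>j\<in>set_mset m. xmul j b (mcoeff g) (m - replicate_mset a i))"
  proof (rule sum.mono_neutral_left)
    show "\<forall>j\<in>set_mset m - set_mset (m - replicate_mset a i). xmul j b (mcoeff g) (m - replicate_mset a i) = 0"
      using assms by (auto intro!: xmul_eq_0 simp: not_in_iff simp del: count_diff)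
  qed (auto dest: in_diffD)
  also have "\<dots> = (\<Sum>j\<in>set_mset m. xmul j b (xmul i a (mcoeff g)) m)"
    using True by (subst xmul_commute) (simp add: xmul_def[of i a])
  finally show ?thesis .
next
  case False
  then have "xmul i a (mcoeff (power_sum b * g)) m = 0" by (simp add: xmul_def)
  moreover have "xmul j b (xmul i a (mcoeff g)) m = 0" for j
    using False by (subst xmul_commute) (simp add: xmul_def[of i a])
  ultimately show ?thesis by simp
qed

lemma linear_xmul_mcoeff: "linear F \<Longrightarrow> linear (\<lambda>f. xmul i a (mcoeff (F f)) m)"
  by (rule linearI) (auto simp: xmul_def linear_add linear_scale)

text \<open>Both sides express \<open>x\<^sub>i \<partial>f/\<partial>x\<^sub>i\<close>.\<close>

lemma euler_pdiff:
  assumes "count m i \<le> N"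
  shows "(\<Sum>a=1..N. real a * xmul i a (mcoeff (pdiff a f)) m) = real (count m i) * mcoeff f m"
proof -
  have *: "(\<Sum>a=1..N. real a * xmul i a (mcoeff (pdiff a (power_prod \<nu>))) m) =
      real (count m i) * mcoeff (power_prod \<nu>) m" if "\<nu> \<in> partitions" for \<nu>
    using that assms
  proof (induction \<nu> arbitrary: m rule: partitions_induct)
    case empty
    have "pdiff a 1 = 0" for a using pdiff_power_prod[of "{#}" a] by simp
    moreover have "mcoeff 0 = (\<lambda>_. 0)" by (simp add: fun_eq_iff)
    ultimately show ?case by (simp add: mcoeff_one)
  next
    case (add b \<nu>)
    let ?g = "power_prod \<nu>"
    have "(\<Sum>a=1..N. real a * xmul i a (mcoeff (pdiff a (power_prod (add_mset b \<nu>)))) m) =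
        (\<Sum>a=1..N. real a * xmul i a (mcoeff (if a = b then ?g else 0)) m) +
        (\<Sum>a=1..N. real a * xmul i a (mcoeff (power_sum b * pdiff a ?g)) m)"
      unfolding power_prod_add_mset pdiff_power_sum_mult[OF add.hyps(1)] sum.distrib[symmetric]
      by (intro sum.cong) (auto simp: xmul_def distrib_left)
    also have "(\<Sum>a=1..N. real a * xmul i a (mcoeff (if a = b then ?g else 0)) m) =
        (\<Sum>a=1..N. if a = b then real b * xmul i b (mcoeff ?g) m else 0)"
      by (intro sum.cong) (auto simp: xmul_def)
    also have "\<dots> = real b * xmul i b (mcoeff ?g) m"
      using add.prems add.hyps(1) by (auto simp: xmul_def)
    also have "(\<Sum>a=1..N. real a * xmul i a (mcoeff (power_sum b * pdiff a ?g)) m) =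
        (\<Sum>j\<in>set_mset m. xmul j b (\<lambda>m. \<Sum>a=1..N. real a * xmul i a (mcoeff (pdiff a ?g)) m) m)"
      unfolding xmul_power_sum_mult[OF add.hyps(1)] xmul_sum xmul_scale sum_distrib_left
      by (rule sum.swap)
    \<comment> \<open>Removing x_j^b lowers the exponent of x_i by b exactly when j = i. The
      resulting correction cancels the term that comes from differentiating the new factor
      p_b.\<close>
    also have "\<dots> = (\<Sum>j\<in>set_mset m. real (count m i) * xmul j b (mcoeff ?g) m -
        (if j = i then real b * xmul i b (mcoeff ?g) m else 0))"
    proof (rule sum.cong)
      fix j
      show "xmul j b (\<lambda>m. \<Sum>a=1..N. real a * xmul i a (mcoeff (pdiff a ?g)) m) m =
          real (count m i) * xmul j b (mcoeff ?g) m - (if j = i then real b * xmul i b (mcoeff ?g) m else 0)"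
      proof (cases "b \<le> count m j")
        case True
        have "count (m - replicate_mset b j) i \<le> N" using add.prems by simp
        from add.IH[OF this] True show ?thesis
          by (auto simp: xmul_def algebra_simps)
      qed (auto simp: xmul_def)
    qed simp
    also have "\<dots> = real (count m i) * (\<Sum>j\<in>set_mset m. xmul j b (mcoeff ?g) m) -
        (if i \<in># m then real b * xmul i b (mcoeff ?g) m else 0)"
      by (simp add: sum_subtractf sum_distrib_left)
    also have "(\<Sum>j\<in>set_mset m. xmul j b (mcoeff ?g) m) = mcoeff (power_prod (add_mset b \<nu>)) m"
      by (rule mcoeff_power_prod_add[symmetric, OF add.hyps(1)])
    also have "(if i \<in># m then real b * xmul i b (mcoeff ?g) m else 0) = real b * xmul i b (mcoeff ?g) m"
      using add.hyps(1) by (auto simp: xmul_def not_in_iff)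
    finally show ?case by simp
  qed
  show ?thesis
  proof (rule linear_ext_power_prod[where F = "\<lambda>f. \<Sum>a=1..N. real a * xmul i a (mcoeff (pdiff a f)) m" and
      G = "\<lambda>f. real (count m i) * mcoeff f m"])
    show "linear (\<lambda>f. \<Sum>a=1..N. real a * xmul i a (mcoeff (pdiff a f)) m)"
      using linear_xmul_mcoeff[OF linear_pdiff]
      by (intro linear_compose_sum ballI) (auto simp: linear_iff algebra_simps)
    show "linear (\<lambda>f. real (count m i) * mcoeff f m)"
      by (rule linearI) (auto simp: algebra_simps)
  qed (rule *)
qed

text \<open>An element \<open>\<Sum>\<^sub>a w\<^sup>a G\<^sub>a\<close> of \<open>w Sym[w]\<close> is encoded by \<open>G\<close>; its value at \<open>0\<close> is ignored and \<open>N\<close> truncates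
  the sums over \<open>a\<close>, which is harmless in degrees up to \<open>N\<close>. On such elements \<open>lax\<close> is
  \<open>\<alpha> w \<partial>\<^sub>w - (w \<partial>\<^sub>w - 1) + \<Sum>\<^sub>k w\<^sup>k p\<^sub>k\<^sup>* + \<Sum>\<^sub>k w\<^sup>-\<^sup>k p\<^sub>k\<close>, where \<open>p\<^sub>k\<^sup>* = \<alpha> k \<partial>/\<partial>p\<^sub>k\<close> is the adjoint of multiplication by \<open>p\<^sub>k\<close> and only
  positive powers of \<open>w\<close> are kept.
  The maps \<open>wlift\<close> and \<open>wproj\<close> are adjoint to each other.\<close>

definition wlift :: "real \<Rightarrow> symfun \<Rightarrow> nat \<Rightarrow> symfun" where
  "wlift \<alpha> f a = (\<alpha> * real a) *\<^sub>R pdiff a f"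

definition wproj :: "nat \<Rightarrow> (nat \<Rightarrow> symfun) \<Rightarrow> symfun" where
  "wproj N G = (\<Sum>a=1..N. power_sum a * G a)"

definition lax :: "real \<Rightarrow> nat \<Rightarrow> (nat \<Rightarrow> symfun) \<Rightarrow> nat \<Rightarrow> symfun" where
  "lax \<alpha> N G c = (\<alpha> * real c - (real c - 1)) *\<^sub>R G c
     + (\<Sum>a=1..<c. (\<alpha> * real (c - a)) *\<^sub>R pdiff (c - a) (G a))
     + (\<Sum>a=Suc c..N. power_sum (a - c) * G a)"

definition ham :: "real \<Rightarrow> nat \<Rightarrow> nat \<Rightarrow> symfun \<Rightarrow> symfun" where
  "ham \<alpha> N k f = wproj N ((lax \<alpha> N ^^ k) (wlift \<alpha> f))"

definition wform :: "real \<Rightarrow> nat \<Rightarrow> (nat \<Rightarrow> symfun) \<Rightarrow> (nat \<Rightarrow> symfun) \<Rightarrow> real" where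
  "wform \<alpha> N G H = (\<Sum>a=1..N. jack_form \<alpha> (G a) (H a))"

lemma wform_sym: "wform \<alpha> N G H = wform \<alpha> N H G"
  by (simp add: wform_def jack_form_sym)

lemma wform_wlift: "jack_form \<alpha> (wproj N G) f = wform \<alpha> N G (wlift \<alpha> f)"
  unfolding wform_def wproj_def wlift_def jack_form_simps
  by (intro sum.cong) (auto simp: jack_form_power_sum_mult)

lemma sum_pairs_swap:
  fixes F :: "nat \<Rightarrow> nat \<Rightarrow> 'a::comm_monoid_add"
  shows "(\<Sum>c=1..N. \<Sum>a=Suc c..N. F c a) = (\<Sum>a=1..N. \<Sum>c=1..<a. F c a)"
  unfolding sum.Sigma[OF finite_atLeastAtMost ballI, OF finite_atLeastAtMost]
    sum.Sigma[OF finite_atLeastAtMost ballI, OF finite_atLeastLessThan]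
  by (rule sum.reindex_bij_witness[where i = "\<lambda>(a, b). (b, a)" and j = "\<lambda>(a, b). (b, a)"]) auto

text \<open>The diagonal part is scalar. The part raising the power of w and the part lowering it
  are adjoint to each other, and the truncation respects this: both run over the pairs 1 <= a < c <=
  N.\<close>

lemma wform_lax:
  "wform \<alpha> N (lax \<alpha> N G) H = wform \<alpha> N G (lax \<alpha> N H)"
proof -
  let ?U = "\<lambda>G H. \<Sum>c=1..N. \<Sum>a=1..<c. \<alpha> * real (c - a) * jack_form \<alpha> (pdiff (c - a) (G a)) (H c)"
  let ?D = "\<lambda>G H. \<Sum>c=1..N. (\<alpha> * real c - (real c - 1)) * jack_form \<alpha> (G c) (H c)"
  have *: "wform \<alpha> N (lax \<alpha> N G) H = ?D G H + ?U G H + ?U H G" for G H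
  proof -
    have "(\<Sum>c=1..N. \<Sum>a=Suc c..N. jack_form \<alpha> (power_sum (a - c) * G a) (H c)) =
        (\<Sum>c=1..N. \<Sum>a=Suc c..N. \<alpha> * real (a - c) * jack_form \<alpha> (pdiff (a - c) (H c)) (G a))"
    proof (intro sum.cong refl)
      fix c a assume "a \<in> {Suc c..N}"
      then have "a - c > 0" by auto
      from jack_form_power_sum_mult[OF this] show "jack_form \<alpha> (power_sum (a - c) * G a) (H c) =
          \<alpha> * real (a - c) * jack_form \<alpha> (pdiff (a - c) (H c)) (G a)"
        by (simp add: jack_form_sym[of \<alpha> "G a"])
    qed
    also have "\<dots> = ?U H G" by (rule sum_pairs_swap)
    finally show ?thesis
      unfolding wform_def lax_def jack_form_simps by (simp add: sum.distrib)
  qed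
  show ?thesis unfolding *[of G H] wform_sym[of \<alpha> N G] *[of H G]
    by (simp add: jack_form_sym)
qed

text \<open>\<open>ham\<close> has the form B' L^k B with L self-adjoint and B' =
  \<open>wproj\<close> adjoint to B = \<open>wlift\<close>.\<close>

lemma ham_selfadjoint: "jack_form \<alpha> (ham \<alpha> N k f) g = jack_form \<alpha> f (ham \<alpha> N k g)"
proof -
  have "wform \<alpha> N ((lax \<alpha> N ^^ k) G) H = wform \<alpha> N G ((lax \<alpha> N ^^ k) H)" for G H
  proof (induction k arbitrary: H)
    case (Suc k)
    have "wform \<alpha> N ((lax \<alpha> N ^^ Suc k) G) H = wform \<alpha> N G ((lax \<alpha> N ^^ k) (lax \<alpha> N H))"
      by (simp add: wform_lax Suc.IH)
    then show ?case by (simp add: funpow_swap1)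
  qed simp
  then have "jack_form \<alpha> (ham \<alpha> N k f) g = wform \<alpha> N (wlift \<alpha> f) ((lax \<alpha> N ^^ k) (wlift \<alpha> g))"
    unfolding ham_def wform_wlift by simp
  also have "\<dots> = jack_form \<alpha> (ham \<alpha> N k g) f"
    unfolding ham_def wform_wlift by (rule wform_sym)
  finally show ?thesis by (simp add: jack_form_sym)
qed

text \<open>Substituting \<open>w = x\<^sub>i\<close>. In these terms \<open>lax\<close> becomes the Dunkl operator of \<open>wseries_lax\<close> below.\<close>

definition wseries :: "nat \<Rightarrow> (nat \<Rightarrow> symfun) \<Rightarrow> nat \<Rightarrow> nat multiset \<Rightarrow> real" where
  "wseries N G i m = (\<Sum>a=1..N. xmul i a (mcoeff (G a)) m)"

lemma mcoeff_wproj: "mcoeff (wproj N G) m = (\<Sum>i\<in>set_mset m. wseries N G i m)"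
proof -
  have "mcoeff (wproj N G) m = (\<Sum>a=1..N. \<Sum>i\<in>set_mset m. xmul i a (mcoeff (G a)) m)"
    unfolding wproj_def mcoeff_sum by (intro sum.cong) (auto simp: mcoeff_power_sum_mult)
  also have "\<dots> = (\<Sum>i\<in>set_mset m. wseries N G i m)"
    unfolding wseries_def by (rule sum.swap)
  finally show ?thesis .
qed

lemma wseries_wlift:
  assumes "count m i \<le> N"
  shows "wseries N (wlift \<alpha> f) i m = \<alpha> * real (count m i) * mcoeff f m"
proof -
  have "wseries N (wlift \<alpha> f) i m = \<alpha> * (\<Sum>a=1..N. real a * xmul i a (mcoeff (pdiff a f)) m)"
    unfolding wseries_def wlift_def sum_distrib_left by (intro sum.cong) (auto simp: xmul_def)
  also have "\<dots> = \<alpha> * (real (count m i) * mcoeff f m)" by (simp only: euler_pdiff[OF assms])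
  finally show ?thesis by simp
qed

lemma wseries_perm:
  assumes "bij \<pi>"
  shows "wseries N G (\<pi> i) (image_mset \<pi> m) = wseries N G i m"
  unfolding wseries_def
proof (intro sum.cong refl)
  fix a
  show "xmul (\<pi> i) a (mcoeff (G a)) (image_mset \<pi> m) = xmul i a (mcoeff (G a)) m"
  proof (cases "a \<le> count m i")
    case True
    then have "replicate_mset a i \<subseteq># m" by (simp add: count_le_replicate_mset_subset_eq)
    then have "image_mset \<pi> (m - replicate_mset a i) = image_mset \<pi> m - replicate_mset a (\<pi> i)"
      by (simp add: image_mset_Diff)
    then show ?thesis using True mcoeff_perm[OF assms, of "G a" "m - replicate_mset a i"]
      by (simp add: xmul_def count_image_mset_inj[OF bij_is_inj[OF assms]])
  qed (simp add: xmul_def count_image_mset_inj[OF bij_is_inj[OF assms]])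
qed

section \<open>Moves between two exponents and the Dunkl form of the Lax operator\<close>

text \<open>For i \<noteq> j: the exponents of x_i and x_j become x and y, all others stay. Divided
  differences in x_i, x_j act within such a family.\<close>

definition upd2 :: "nat multiset \<Rightarrow> nat \<Rightarrow> nat \<Rightarrow> nat \<Rightarrow> nat \<Rightarrow> nat multiset" where
  "upd2 m i j x y = filter_mset (\<lambda>k. k \<noteq> i \<and> k \<noteq> j) m + replicate_mset x i + replicate_mset y j"

lemma count_upd2: "i \<noteq> j \<Longrightarrow> count (upd2 m i j x y) k = (if k = i then x else if k = j then y else count m k)"
  by (auto simp: upd2_def)

lemma upd2_id: "i \<noteq> j \<Longrightarrow> upd2 m i j (count m i) (count m j) = m"
  by (rule multiset_eqI) (simp add: count_upd2)

lemma image_mset_transpose_upd2: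
  assumes "i \<noteq> j"
  shows "image_mset (Transposition.transpose i j) (upd2 m i j x y) = upd2 m i j y x"
proof (rule multiset_eqI)
  fix k
  have "count (image_mset (Transposition.transpose i j) (upd2 m i j x y)) (Transposition.transpose i j (Transposition.transpose i j k)) =
      count (upd2 m i j x y) (Transposition.transpose i j k)"
    by (rule count_image_mset_inj) (rule bij_is_inj, simp)
  then show "count (image_mset (Transposition.transpose i j) (upd2 m i j x y)) k = count (upd2 m i j y x) k"
    using assms by (auto simp: count_upd2 Transposition.transpose_def)
qed

lemma mcoeff_upd2_swap: "i \<noteq> j \<Longrightarrow> mcoeff f (upd2 m i j x y) = mcoeff f (upd2 m i j y x)"
  using mcoeff_perm[of "Transposition.transpose i j" f "upd2 m i j x y"] by (simp add: image_mset_transpose_upd2)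

lemma wseries_upd2_swap:
  "i \<noteq> j \<Longrightarrow> wseries N G i (upd2 m i j x y) = wseries N G j (upd2 m i j y x)"
  using wseries_perm[of "Transposition.transpose i j" N G i "upd2 m i j x y"] by (simp add: image_mset_transpose_upd2)

lemma xmul_upd2:
  assumes "i \<noteq> j"
  shows "xmul i a f (upd2 m i j x y) = (if a \<le> x then f (upd2 m i j (x - a) y) else 0)"
    "xmul j a f (upd2 m i j x y) = (if a \<le> y then f (upd2 m i j x (y - a)) else 0)"
proof -
  have "upd2 m i j x y - replicate_mset a i = upd2 m i j (x - a) y"
       "upd2 m i j x y - replicate_mset a j = upd2 m i j x (y - a)"
    by (rule multiset_eqI, use assms in \<open>simp add: count_upd2\<close>)+
  then show "xmul i a f (upd2 m i j x y) = (if a \<le> x then f (upd2 m i j (x - a) y) else 0)"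
    "xmul j a f (upd2 m i j x y) = (if a \<le> y then f (upd2 m i j x (y - a)) else 0)"
    using assms by (simp_all add: xmul_def count_upd2)
qed

lemma size_upd2:
  assumes "i \<noteq> j" "x + y = count m i + count m j"
  shows "size (upd2 m i j x y) = size m"
proof -
  have "size (upd2 m i j x y) = size (upd2 m i j (count m i) (count m j))"
    using assms(2) by (simp add: upd2_def)
  then show ?thesis by (simp add: upd2_id[OF assms(1)])
qed

text \<open>The left side is a sum over a range of length a - 1, written as the difference of two
  longer ranges. Symmetry of h lets the second range be read with swapped exponents, so that every
  term on the right subtracts all of a from the first exponent.\<close>

lemma spread_sum_ge:
  fixes h :: "nat \<Rightarrow> nat \<Rightarrow> real"
  assumes sym: "\<And>x y. h x y = h y x" and "a \<ge> 1" "q \<le> p"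
  shows "(\<Sum>c=1..<a. if c \<le> p \<and> a - c \<le> q then h (p - c) (q - (a - c)) else 0) =
    (\<Sum>s=1..q. if a \<le> p + s then h (p + s - a) (q - s) else 0) -
    (\<Sum>s<q. if a \<le> q - s then h (q - s - a) (p + s) else 0)"
proof -
  \<comment> \<open>\<open>F s\<close> belongs to the exponents (p + s, q - s) with x_i^a removed.
    It vanishes for s > q, which permits raising the upper limit q to a + q - 1.\<close>
  define F where "F s = (if a \<le> p + s \<and> s \<le> q then h (p + s - a) (q - s) else 0)" for s
  have "(\<Sum>c=1..<a. if c \<le> p \<and> a - c \<le> q then h (p - c) (q - (a - c)) else 0) = (\<Sum>s=1..<a. F s)"
    by (rule sum.reindex_bij_witness[where i = "\<lambda>s. a - s" and j = "\<lambda>c. a - c"])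
       (auto simp: F_def intro!: arg_cong2[where f = h])
  moreover have "(\<Sum>s<q. if a \<le> q - s then h (q - s - a) (p + s) else 0) = (\<Sum>s=a..<a+q. F s)"
    by (rule sum.reindex_bij_witness[where i = "\<lambda>s. s - a" and j = "\<lambda>s. s + a"])
       (auto simp: F_def sym[of _ "p + _"] intro!: arg_cong2[where f = h])
  moreover have "(\<Sum>s=1..q. if a \<le> p + s then h (p + s - a) (q - s) else 0) = (\<Sum>s=1..q. F s)"
    by (rule sum.cong) (auto simp: F_def)
  moreover have "(\<Sum>s=1..q. F s) = (\<Sum>s=1..<a+q. F s)"
    by (rule sum.mono_neutral_left) (use \<open>a \<ge> 1\<close> in \<open>auto simp: F_def\<close>)
  moreover have "(\<Sum>s=1..<a+q. F s) = (\<Sum>s=1..<a. F s) + (\<Sum>s=a..<a+q. F s)"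
    using \<open>a \<ge> 1\<close> by (simp add: sum.atLeastLessThan_concat)
  ultimately show ?thesis by simp
qed

text \<open>The reflection c \<mapsto> a - c together with the symmetry of h exchanges p and q, so
  the case q <= p suffices.\<close>

lemma spread_sum:
  fixes h :: "nat \<Rightarrow> nat \<Rightarrow> real"
  assumes sym: "\<And>x y. h x y = h y x" and "a \<ge> 1"
  shows "(\<Sum>c=1..<a. if c \<le> p \<and> a - c \<le> q then h (p - c) (q - (a - c)) else 0) =
    (\<Sum>s=1..min p q. if a \<le> max p q + s then h (max p q + s - a) (min p q - s) else 0) -
    (\<Sum>s<min p q. if a \<le> min p q - s then h (min p q - s - a) (max p q + s) else 0)"
proof (cases "q \<le> p")
  case True
  then have "max p q = p" "min p q = q" by auto
  then show ?thesis using spread_sum_ge[of h a q p, OF sym assms(2) True] by (simp only:)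
next
  case False
  have "(\<Sum>c=1..<a. if c \<le> p \<and> a - c \<le> q then h (p - c) (q - (a - c)) else 0) =
      (\<Sum>c=1..<a. if c \<le> q \<and> a - c \<le> p then h (q - c) (p - (a - c)) else 0)"
    by (rule sum.reindex_bij_witness[where i = "\<lambda>s. a - s" and j = "\<lambda>c. a - c"])
       (auto intro: sym)
  also have "\<dots> = (\<Sum>s=1..p. if a \<le> q + s then h (q + s - a) (p - s) else 0) -
      (\<Sum>s<p. if a \<le> p - s then h (p - s - a) (q + s) else 0)"
    using False by (intro spread_sum_ge sym assms(2)) simp
  finally show ?thesis using False by (simp add: max_absorb2 min_absorb1)
qed

text \<open>Multiplication by (x_i^a x_j - x_i x_j^a) / (x_i - x_j), rewritten with x_i^a as an
  inert factor. The remaining moves never narrow the gap between the exponents of x_i and x_j; this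
  is the source of triangularity.\<close>

lemma xmul_spread:
  fixes m :: "nat multiset" and f :: symfun
  assumes "i \<noteq> j" "a \<ge> 1"
  defines "p \<equiv> count m i" and "q \<equiv> count m j"
  shows "(\<Sum>c=1..<a. xmul j (a - c) (xmul i c (mcoeff f)) m) =
    (\<Sum>s=1..min p q. xmul i a (mcoeff f) (upd2 m i j (max p q + s) (min p q - s))) -
    (\<Sum>s<min p q. xmul i a (mcoeff f) (upd2 m i j (min p q - s) (max p q + s)))"
proof -
  define h where "h x y = mcoeff f (upd2 m i j x y)" for x y
  have sym: "h x y = h y x" for x y unfolding h_def by (rule mcoeff_upd2_swap[OF assms(1)])
  have "(\<Sum>c=1..<a. xmul j (a - c) (xmul i c (mcoeff f)) m) =
      (\<Sum>c=1..<a. if c \<le> p \<and> a - c \<le> q then h (p - c) (q - (a - c)) else 0)"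
  proof (intro sum.cong refl)
    fix c
    have "xmul j (a - c) (xmul i c (mcoeff f)) (upd2 m i j p q) =
        (if c \<le> p \<and> a - c \<le> q then h (p - c) (q - (a - c)) else 0)"
      by (simp add: xmul_upd2[OF assms(1)] h_def)
    then show "xmul j (a - c) (xmul i c (mcoeff f)) m =
        (if c \<le> p \<and> a - c \<le> q then h (p - c) (q - (a - c)) else 0)"
      by (simp add: p_def q_def upd2_id[OF assms(1)])
  qed
  also note spread_sum[of h a p q, OF sym assms(2)]
  finally show ?thesis
    unfolding xmul_upd2[OF assms(1)] h_def .
qed

text \<open>Put w = x_i. The degree a in w contributes \<alpha> a, and the derivatives contribute
  \<alpha> (\<open>count m i\<close> - a) by \<open>euler_pdiff\<close>, together \<alpha> times the
  exponent of x_i. In the multiplications by power sums the variable x_i itself contributes a - 1,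
  which the term -(w d/dw - 1) cancels. The other variables give divided differences.\<close>

lemma wseries_lax:
  assumes i: "i \<in># m" and N: "size m \<le> N"
  shows "wseries N (lax \<alpha> N G) i m = \<alpha> * real (count m i) * wseries N G i m +
    (\<Sum>j\<in>set_mset m - {i}.
      (\<Sum>s=1..min (count m i) (count m j).
         wseries N G i (upd2 m i j (max (count m i) (count m j) + s) (min (count m i) (count m j) - s))) -
      (\<Sum>s<min (count m i) (count m j).
         wseries N G i (upd2 m i j (min (count m i) (count m j) - s) (max (count m i) (count m j) + s))))"
    (is "_ = _ + ?S")
proof -
  define X where "X a = xmul i a (mcoeff (G a)) m" for a
  have cN: "count m i \<le> N" using N count_le_size[of m i] by simp
  have "wseries N (lax \<alpha> N G) i m =
      (\<Sum>c=1..N. (\<alpha> * real c - (real c - 1)) * X c) +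
      (\<Sum>c=1..N. \<Sum>a=1..<c. \<alpha> * real (c - a) * xmul i c (mcoeff (pdiff (c - a) (G a))) m) +
      (\<Sum>c=1..N. \<Sum>a=Suc c..N. xmul i c (mcoeff (power_sum (a - c) * G a)) m)"
    unfolding wseries_def lax_def sum.distrib[symmetric]
    by (intro sum.cong refl) (simp add: xmul_def X_def)
  also have "(\<Sum>c=1..N. \<Sum>a=1..<c. \<alpha> * real (c - a) * xmul i c (mcoeff (pdiff (c - a) (G a))) m) =
      (\<Sum>a=1..N. \<Sum>c=Suc a..N. \<alpha> * real (c - a) * xmul i c (mcoeff (pdiff (c - a) (G a))) m)"
    by (rule sum_pairs_swap[symmetric])
  also have "\<dots> = (\<Sum>a=1..N. \<alpha> * (real (count m i) - real a) * X a)"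
  proof (intro sum.cong refl)
    fix a assume a: "a \<in> {1..N}"
    show "(\<Sum>c=Suc a..N. \<alpha> * real (c - a) * xmul i c (mcoeff (pdiff (c - a) (G a))) m) =
        \<alpha> * (real (count m i) - real a) * X a"
    proof (cases "a \<le> count m i")
      case True
      let ?m = "m - replicate_mset a i"
      have "(\<Sum>c=Suc a..N. \<alpha> * real (c - a) * xmul i c (mcoeff (pdiff (c - a) (G a))) m) =
          (\<Sum>k=1..N-a. \<alpha> * (real k * xmul i k (mcoeff (pdiff k (G a))) ?m))"
      proof (rule sum.reindex_bij_witness[where i = "\<lambda>k. a + k" and j = "\<lambda>c. c - a"])
        fix c assume c: "c \<in> {Suc a..N}"
        then have "xmul i c (mcoeff (pdiff (c - a) (G a))) m =
            xmul i a (xmul i (c - a) (mcoeff (pdiff (c - a) (G a)))) m" by (simp add: xmul_xmul)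
        also have "\<dots> = xmul i (c - a) (mcoeff (pdiff (c - a) (G a))) ?m"
          using True by (simp add: xmul_def[of i a])
        finally show "\<alpha> * (real (c - a) * xmul i (c - a) (mcoeff (pdiff (c - a) (G a))) ?m) =
            \<alpha> * real (c - a) * xmul i c (mcoeff (pdiff (c - a) (G a))) m" by simp
      qed auto
      also have "\<dots> = \<alpha> * (real (count ?m i) * mcoeff (G a) ?m)"
        unfolding sum_distrib_left[symmetric] using cN by (subst euler_pdiff) auto
      finally show ?thesis using True by (simp add: X_def xmul_def)
    next
      case False
      then show ?thesis by (simp add: X_def xmul_eq_0)
    qed
  qed
  also have "(\<Sum>c=1..N. \<Sum>a=Suc c..N. xmul i c (mcoeff (power_sum (a - c) * G a)) m) =
      (\<Sum>a=1..N. \<Sum>c=1..<a. xmul i c (mcoeff (power_sum (a - c) * G a)) m)"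
    by (rule sum_pairs_swap)
  also have "\<dots> = (\<Sum>a=1..N. (real a - 1) * X a +
      (\<Sum>j\<in>set_mset m - {i}. \<Sum>c=1..<a. xmul j (a - c) (xmul i c (mcoeff (G a))) m))"
  proof (intro sum.cong refl)
    fix a assume a: "a \<in> {1..N}"
    have "(\<Sum>c=1..<a. xmul i c (mcoeff (power_sum (a - c) * G a)) m) =
        (\<Sum>c=1..<a. \<Sum>j\<in>set_mset m. xmul j (a - c) (xmul i c (mcoeff (G a))) m)"
      by (intro sum.cong refl) (simp add: xmul_power_sum_mult)
    also have "\<dots> = (\<Sum>j\<in>set_mset m. \<Sum>c=1..<a. xmul j (a - c) (xmul i c (mcoeff (G a))) m)"
      by (rule sum.swap)
    also have "\<dots> = (\<Sum>c=1..<a. xmul i (a - c) (xmul i c (mcoeff (G a))) m) +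
        (\<Sum>j\<in>set_mset m - {i}. \<Sum>c=1..<a. xmul j (a - c) (xmul i c (mcoeff (G a))) m)"
      using i by (simp add: sum.remove)
    also have "(\<Sum>c=1..<a. xmul i (a - c) (xmul i c (mcoeff (G a))) m) = (\<Sum>c=1..<a. X a)"
      by (intro sum.cong refl) (simp add: xmul_xmul X_def)
    also have "\<dots> = (real a - 1) * X a" using a by (simp add: of_nat_diff)
    finally show "(\<Sum>c=1..<a. xmul i c (mcoeff (power_sum (a - c) * G a)) m) = (real a - 1) * X a +
        (\<Sum>j\<in>set_mset m - {i}. \<Sum>c=1..<a. xmul j (a - c) (xmul i c (mcoeff (G a))) m)" .
  qed
  also have "\<dots> = (\<Sum>a=1..N. (real a - 1) * X a) +
      (\<Sum>j\<in>set_mset m - {i}. \<Sum>a=1..N. \<Sum>c=1..<a. xmul j (a - c) (xmul i c (mcoeff (G a))) m)"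
    unfolding sum.distrib by (subst sum.swap) simp
  also have "(\<Sum>j\<in>set_mset m - {i}. \<Sum>a=1..N. \<Sum>c=1..<a. xmul j (a - c) (xmul i c (mcoeff (G a))) m) = ?S"
  proof (intro sum.cong refl)
    fix j assume "j \<in> set_mset m - {i}"
    then have ij: "i \<noteq> j" by auto
    have "(\<Sum>a=1..N. \<Sum>c=1..<a. xmul j (a - c) (xmul i c (mcoeff (G a))) m) =
      (\<Sum>a=1..N.
       (\<Sum>s=1..min (count m i) (count m j). xmul i a (mcoeff (G a))
         (upd2 m i j (max (count m i) (count m j) + s) (min (count m i) (count m j) - s))) -
       (\<Sum>s<min (count m i) (count m j). xmul i a (mcoeff (G a))
         (upd2 m i j (min (count m i) (count m j) - s) (max (count m i) (count m j) + s))))"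
      by (intro sum.cong refl xmul_spread ij) simp
    then show "(\<Sum>a=1..N. \<Sum>c=1..<a. xmul j (a - c) (xmul i c (mcoeff (G a))) m) =
      (\<Sum>s=1..min (count m i) (count m j).
         wseries N G i (upd2 m i j (max (count m i) (count m j) + s) (min (count m i) (count m j) - s))) -
      (\<Sum>s<min (count m i) (count m j).
         wseries N G i (upd2 m i j (min (count m i) (count m j) - s) (max (count m i) (count m j) + s)))"
      unfolding wseries_def sum_subtractf by (subst (1 2) sum.swap) simp
  qed
  also have "(\<Sum>c=1..N. (\<alpha> * real c - (real c - 1)) * X c) +
      (\<Sum>a=1..N. \<alpha> * (real (count m i) - real a) * X a) + ((\<Sum>a=1..N. (real a - 1) * X a) + ?S) =
      (\<Sum>a=1..N. \<alpha> * real (count m i) * X a) + ?S"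
    by (simp add: algebra_simps flip: sum.distrib)
  also have "(\<Sum>a=1..N. \<alpha> * real (count m i) * X a) = \<alpha> * real (count m i) * wseries N G i m"
    by (simp add: wseries_def X_def sum_distrib_left)
  finally show ?thesis .
qed

section \<open>Dominance order and triangularity\<close>

text \<open>Truncated subtraction makes this the sum of the positive parts (a - t)^+, the convex
  dual of the partial sums; it describes dominance without sorting.\<close>

definition excess :: "nat \<Rightarrow> nat multiset \<Rightarrow> nat" where
  "excess t \<nu> = (\<Sum>a\<in>#\<nu>. a - t)"

lemma sum_list_ge_threshold:
  fixes ys :: "nat list"
  shows "(\<And>y. y \<in> set ys \<Longrightarrow> t \<le> y) \<Longrightarrow> sum_list ys = length ys * t + (\<Sum>y\<leftarrow>ys. y - t)"
proof (induction ys)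
  case (Cons a ys)
  then have "sum_list ys = length ys * t + (\<Sum>y\<leftarrow>ys. y - t)" "t \<le> a" by auto
  then show ?case by simp
qed simp

lemma sum_list_le_threshold:
  fixes ys :: "nat list"
  shows "(\<And>y. y \<in> set ys \<Longrightarrow> y \<le> t) \<Longrightarrow> (\<Sum>y\<leftarrow>ys. y - t) = 0"
  by (induction ys) auto

lemma sum_list_take_le: "sum_list (take k xs) \<le> k * t + (\<Sum>x\<leftarrow>xs. x - t)" for xs :: "nat list"
proof (induction xs arbitrary: k)
  case (Cons x xs)
  then show ?case
  proof (cases k)
    case (Suc k')
    then show ?thesis using Cons.IH[of k'] by simp
  qed simp
qed simp

lemma sum_list_take_eq:
  fixes xs :: "nat list"
  assumes "\<And>x. x \<in> set (take k xs) \<Longrightarrow> t \<le> x" "\<And>x. x \<in> set (drop k xs) \<Longrightarrow> x \<le> t" "k \<le> length xs"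
  shows "sum_list (take k xs) = k * t + (\<Sum>x\<leftarrow>xs. x - t)"
proof -
  have "(\<Sum>x\<leftarrow>xs. x - t) = (\<Sum>x\<leftarrow>take k xs. x - t) + (\<Sum>x\<leftarrow>drop k xs. x - t)"
    by (metis append_take_drop_id map_append sum_list_append)
  then show ?thesis
    using sum_list_ge_threshold[of "take k xs" t] sum_list_le_threshold[of "drop k xs" t] assms by simp
qed

lemma excess_sorted_list: "excess t \<nu> = (\<Sum>x\<leftarrow>rev (sorted_list_of_multiset \<nu>). x - t)"
proof -
  have "(\<Sum>x\<leftarrow>rev (sorted_list_of_multiset \<nu>). x - t) = sum_mset (mset (map (\<lambda>x. x - t) (rev (sorted_list_of_multiset \<nu>))))"
    by (rule sum_mset_sum_list[symmetric])
  then show ?thesis by (simp add: excess_def)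
qed

text \<open>The sum of the k largest parts is the minimum over t of k t + excess at t. One direction
  takes for k the number of parts of \<mu> above t, the other takes for t the k-th part of
  \<nu>.\<close>

lemma dominated_iff_excess:
  "dominated \<mu> \<nu> \<longleftrightarrow> sum_mset \<mu> = sum_mset \<nu> \<and> (\<forall>t. excess t \<mu> \<le> excess t \<nu>)"
proof -
  define xs ys where xs: "xs = rev (sorted_list_of_multiset \<mu>)" and ys: "ys = rev (sorted_list_of_multiset \<nu>)"
  have sorted: "sorted_wrt (\<ge>) xs" "sorted_wrt (\<ge>) ys"
    by (simp_all add: xs ys sorted_wrt_rev)
  have "(\<forall>k. sum_list (take k xs) \<le> sum_list (take k ys)) \<longleftrightarrow>
      (\<forall>t. (\<Sum>x\<leftarrow>xs. x - t) \<le> (\<Sum>x\<leftarrow>ys. x - t))"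
  proof safe
    fix t assume *: "\<forall>k. sum_list (take k xs) \<le> sum_list (take k ys)"
    define k where "k = length (takeWhile (\<lambda>x. t < x) xs)"
    have take: "take k xs = takeWhile (\<lambda>x. t < x) xs" "drop k xs = dropWhile (\<lambda>x. t < x) xs"
      unfolding k_def by (simp_all add: takeWhile_eq_take[symmetric] dropWhile_eq_drop[symmetric])
    have "x \<le> t" if x: "x \<in> set (drop k xs)" for x
    proof -
      from x have ne: "dropWhile (\<lambda>x. t < x) xs \<noteq> []" unfolding take(2) by (metis empty_iff list.set(1))
      have hd: "\<not> t < hd (dropWhile (\<lambda>x. t < x) xs)" using hd_dropWhile[OF ne] .
      have "sorted_wrt (\<ge>) (dropWhile (\<lambda>x. t < x) xs)" using sorted(1) by (metis sorted_wrt_drop take(2))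
      then have "x \<le> hd (dropWhile (\<lambda>x. t < x) xs)" using x ne
        by (cases "dropWhile (\<lambda>x. t < x) xs") (auto simp: take)
      then show ?thesis using hd by simp
    qed
    moreover have "t \<le> x" if "x \<in> set (take k xs)" for x
      using that by (auto simp: take dest: set_takeWhileD)
    moreover have "k \<le> length xs" by (simp add: k_def length_takeWhile_le)
    ultimately have "sum_list (take k xs) = k * t + (\<Sum>x\<leftarrow>xs. x - t)" by (intro sum_list_take_eq)
    moreover have "sum_list (take k ys) \<le> k * t + (\<Sum>x\<leftarrow>ys. x - t)" by (rule sum_list_take_le)
    moreover have "sum_list (take k xs) \<le> sum_list (take k ys)" using * by blast
    ultimately show "(\<Sum>x\<leftarrow>xs. x - t) \<le> (\<Sum>x\<leftarrow>ys. x - t)" by linarith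
  next
    fix k assume *: "\<forall>t. (\<Sum>x\<leftarrow>xs. x - t) \<le> (\<Sum>x\<leftarrow>ys. x - t)"
    have "\<exists>t. k * t + (\<Sum>x\<leftarrow>ys. x - t) \<le> sum_list (take k ys)"
    \<comment> \<open>No k-th part exists here: for k = 0 a threshold above all parts attains the
      minimum, for large k the threshold 0.\<close>
    proof (cases "k = 0 \<or> k > length ys")
      case True
      then show ?thesis
      proof
        assume "k = 0"
        moreover have "(\<Sum>x\<leftarrow>ys. x - sum_list ys) = 0"
          by (rule sum_list_le_threshold) (auto intro: member_le_sum_list)
        ultimately show ?thesis by (intro exI[of _ "sum_list ys"]) simp
      next
        assume "k > length ys"
        then show ?thesis by (intro exI[of _ 0]) simp
      qed
    next
      case False
      let ?t = "ys ! (k - 1)"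
      have "sum_list (take k ys) = k * ?t + (\<Sum>x\<leftarrow>ys. x - ?t)"
      proof (rule sum_list_take_eq)
        fix x assume "x \<in> set (take k ys)"
        then obtain i where i: "i < k" "x = ys ! i" "i < length ys" by (auto simp: in_set_conv_nth)
        show "?t \<le> x"
        proof (cases "i = k - 1")
          case False
          then show ?thesis using sorted_wrt_nth_less[OF sorted(2), of i "k - 1"] i \<open>\<not> (k = 0 \<or> k > length ys)\<close> by auto
        qed (simp add: i)
      next
        fix x assume "x \<in> set (drop k ys)"
        then obtain i where "i < length (drop k ys)" "x = drop k ys ! i" by (metis in_set_conv_nth)
        then have "k + i < length ys" "x = ys ! (k + i)" by auto
        then show "x \<le> ?t" using sorted_wrt_nth_less[OF sorted(2), of "k - 1" "k + i"] False by auto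
      qed (use False in simp)
      then show ?thesis by (intro exI[of _ ?t]) simp
    qed
    then obtain t where t: "k * t + (\<Sum>x\<leftarrow>ys. x - t) \<le> sum_list (take k ys)" by blast
    have "sum_list (take k xs) \<le> k * t + (\<Sum>x\<leftarrow>xs. x - t)" by (rule sum_list_take_le)
    also have "\<dots> \<le> k * t + (\<Sum>x\<leftarrow>ys. x - t)" using * by simp
    finally show "sum_list (take k xs) \<le> sum_list (take k ys)" using t by simp
  qed
  then show ?thesis unfolding dominated_def excess_sorted_list xs ys by simp
qed

lemma dominated_refl [simp]: "dominated \<nu> \<nu>"
  by (simp add: dominated_def)

lemma dominated_trans: "dominated \<mu> \<nu> \<Longrightarrow> dominated \<nu> \<kappa> \<Longrightarrow> dominated \<mu> \<kappa>"
  unfolding dominated_def by (auto intro: le_trans)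

lemma dominated_sum: "dominated \<mu> \<nu> \<Longrightarrow> sum_mset \<mu> = sum_mset \<nu>"
  by (simp add: dominated_def)

text \<open>The column of index t + 1 of the Young diagram, that is, a part of the conjugate
  partition.\<close>

definition nparts_gt :: "nat \<Rightarrow> nat multiset \<Rightarrow> nat" where
  "nparts_gt t \<nu> = size (filter_mset (\<lambda>a. a > t) \<nu>)"

lemma excess_Suc: "excess t \<nu> = excess (Suc t) \<nu> + nparts_gt t \<nu>"
  unfolding excess_def nparts_gt_def by (induction \<nu>) auto

lemma excess_0: "excess 0 \<nu> = sum_mset \<nu>"
  by (simp add: excess_def)

lemma nparts_gt_Suc: "nparts_gt t \<nu> = nparts_gt (Suc t) \<nu> + count \<nu> (Suc t)"
  unfolding nparts_gt_def by (induction \<nu>) auto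

lemma nparts_gt_antimono: "nparts_gt (Suc t) \<nu> \<le> nparts_gt t \<nu>"
  by (subst (2) nparts_gt_Suc) simp

text \<open>First differences of the excess are the column lengths, and their differences are the
  multiplicities. Only parts equal to 0 stay invisible, and a partition has none.\<close>

lemma dominated_antisym:
  assumes "dominated \<mu> \<nu>" "dominated \<nu> \<mu>" "\<mu> \<in> partitions" "\<nu> \<in> partitions"
  shows "\<mu> = \<nu>"
proof -
  have e: "excess t \<mu> = excess t \<nu>" for t
    using assms(1,2) unfolding dominated_iff_excess by (simp add: le_antisym)
  have n: "nparts_gt t \<mu> = nparts_gt t \<nu>" for t
    using excess_Suc[of t \<mu>] excess_Suc[of t \<nu>] e[of t] e[of "Suc t"] by simp
  show ?thesis
  proof (rule multiset_eqI)
    fix a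
    show "count \<mu> a = count \<nu> a"
    proof (cases a)
      case 0
      then show ?thesis using assms(3,4) by (simp add: partitions_def not_in_iff)
    next
      case (Suc t)
      then show ?thesis using nparts_gt_Suc[of t \<mu>] nparts_gt_Suc[of t \<nu>] n[of t] n[of "Suc t"] by simp
    qed
  qed
qed

section \<open>Two quantities monotone along dominance\<close>

definition sqsum :: "nat multiset \<Rightarrow> nat" where
  "sqsum \<nu> = (\<Sum>a\<in>#\<nu>. a * a)"

text \<open>For each part a the sum of (a - t)^+ over t >= 1 is a (a - 1) / 2.\<close>

lemma sqsum_eq_excess:
  assumes "\<And>a. a \<in># \<nu> \<Longrightarrow> a \<le> B"
  shows "sqsum \<nu> = sum_mset \<nu> + 2 * (\<Sum>t=1..B. excess t \<nu>)"
proof -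
  have *: "a * a = a + 2 * (\<Sum>t=1..B. a - t)" if "a \<le> B" for a B :: nat
    using that
  proof (induction a)
    case (Suc a)
    have "(\<Sum>t=1..B. Suc a - t) = (\<Sum>t=1..B. (a - t) + (if t \<le> a then 1 else 0))"
      by (rule sum.cong) auto
    also have "\<dots> = (\<Sum>t=1..B. a - t) + card {t \<in> {1..B}. t \<le> a}"
      by (simp add: sum.distrib flip: sum.inter_filter)
    also have "{t \<in> {1..B}. t \<le> a} = {1..a}" using Suc.prems by auto
    finally show ?case using Suc by simp
  qed simp
  show ?thesis using assms unfolding sqsum_def excess_def
  proof (induction \<nu>)
    case (add x \<nu>)
    have "x * x = x + 2 * (\<Sum>t=1..B. x - t)" using *[of x B] add.prems by simp
    then show ?case using add by (simp add: sum.distrib)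
  qed simp
qed

lemma member_le_sum_mset: "a \<in># \<nu> \<Longrightarrow> a \<le> sum_mset \<nu>" for a :: nat
  by (auto dest!: multi_member_split)

text \<open>Some excess must grow strictly, by antisymmetry, and the corresponding t lies between 1
  and |\<nu>|. Thus \<open>sqsum\<close> is a natural-number rank for inductions along
  dominance.\<close>

lemma sqsum_strict_mono:
  assumes "dominated \<mu> \<nu>" "\<mu> \<noteq> \<nu>" "\<mu> \<in> partitions" "\<nu> \<in> partitions"
  shows "sqsum \<mu> < sqsum \<nu>"
proof -
  let ?B = "sum_mset \<nu>"
  have sum: "sum_mset \<mu> = sum_mset \<nu>" and le: "\<And>t. excess t \<mu> \<le> excess t \<nu>"
    using assms(1) unfolding dominated_iff_excess by auto
  obtain t where t: "excess t \<mu> < excess t \<nu>"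
  proof (rule ccontr)
    assume "\<not> thesis"
    then have "\<forall>t. \<not> excess t \<mu> < excess t \<nu>" using that by blast
    then have "dominated \<nu> \<mu>" using sum unfolding dominated_iff_excess by (simp add: not_less)
    then show False using dominated_antisym assms by blast
  qed
  have "t \<noteq> 0" using t sum by (intro notI) (simp add: excess_0)
  moreover have "t \<le> ?B"
  proof (rule ccontr)
    assume "\<not> t \<le> ?B"
    then have "excess t \<nu> = 0" unfolding excess_def
      by (auto simp: sum_mset_0_iff dest!: member_le_sum_mset)
    then show False using t by simp
  qed
  ultimately have "t \<in> {1..?B}" by simp
  then have "(\<Sum>t=1..?B. excess t \<mu>) < (\<Sum>t=1..?B. excess t \<nu>)"
    using t le by (intro sum_strict_mono_ex1) auto
  moreover have "sqsum \<mu> = sum_mset \<mu> + 2 * (\<Sum>t=1..?B. excess t \<mu>)"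
    using sum by (intro sqsum_eq_excess) (auto dest: member_le_sum_mset)
  moreover have "sqsum \<nu> = sum_mset \<nu> + 2 * (\<Sum>t=1..?B. excess t \<nu>)"
    by (intro sqsum_eq_excess) (rule member_le_sum_mset)
  ultimately show ?thesis using sum by simp
qed

text \<open>This is \<open>\<Sum>\<^sub>i\<^sub>,\<^sub>j min(\<nu>\<^sub>i, \<nu>\<^sub>j)\<close>, see \<open>minsum_exponents\<close>; the form chosen here makes it comparable along the
  dominance order by summation by parts.\<close>

definition minsum :: "nat multiset \<Rightarrow> real" where
  "minsum \<nu> = (\<Sum>t<sum_mset \<nu>. (real (nparts_gt t \<nu>))\<^sup>2)"

text \<open>For column lengths G of \<nu> and H of \<mu> one has H^2 - G^2 >= 2 G (H - G). The sum
  of G (H - G) is nonnegative by Abel summation: G decreases, and the partial sums of H - G are the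
  differences \<open>d\<close> of the excesses.\<close>

lemma minsum_antimono:
  assumes "dominated \<mu> \<nu>"
  shows "minsum \<nu> \<le> minsum \<mu>"
proof -
  let ?B = "sum_mset \<nu>"
  have sum: "sum_mset \<mu> = sum_mset \<nu>" and le: "\<And>t. excess t \<mu> \<le> excess t \<nu>"
    using assms(1) unfolding dominated_iff_excess by auto
  define d where "d t = real (excess t \<nu>) - real (excess t \<mu>)" for t
  define G H where G: "G t = real (nparts_gt t \<nu>)" and H: "H t = real (nparts_gt t \<mu>)" for t
  have d: "d t \<ge> 0" "d 0 = 0" for t using le[of t] sum by (auto simp: d_def excess_0)
  have HG: "H t - G t = d (Suc t) - d t" for t
    using excess_Suc[of t \<mu>] excess_Suc[of t \<nu>] by (simp add: G H d_def)
  have "(\<Sum>t<B. G t * (d (Suc t) - d t)) = G B * d B - G 0 * d 0 + (\<Sum>t<B. (G t - G (Suc t)) * d (Suc t))" for B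
    by (induction B) (auto simp: algebra_simps)
  moreover have "G t \<ge> G (Suc t)" "G t \<ge> 0" for t using nparts_gt_antimono[of t \<nu>] by (auto simp: G)
  ultimately have "(\<Sum>t<?B. G t * (H t - G t)) \<ge> 0"
    unfolding HG using d by (auto intro!: add_nonneg_nonneg sum_nonneg mult_nonneg_nonneg)
  moreover have "(\<Sum>t<?B. (H t)\<^sup>2) - (\<Sum>t<?B. (G t)\<^sup>2) \<ge> 2 * (\<Sum>t<?B. G t * (H t - G t))"
  proof -
    have "2 * (G t * (H t - G t)) \<le> (H t)\<^sup>2 - (G t)\<^sup>2" for t
      using zero_le_power2[of "H t - G t"] by (simp add: power2_eq_square algebra_simps)
    then show ?thesis unfolding sum_distrib_left sum_subtractf[symmetric] by (intro sum_mono)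
  qed
  ultimately show ?thesis unfolding minsum_def sum by (simp add: G H)
qed

text \<open>min(a, b) counts the levels t lying below both a and b; exchanging the sums leaves the
  squared column length at each level.\<close>

lemma minsum_exponents:
  "(\<Sum>i\<in>set_mset m. \<Sum>j\<in>set_mset m. real (min (count m i) (count m j))) = minsum (exponents m)"
proof -
  have np: "real (nparts_gt t (exponents m)) = (\<Sum>i\<in>set_mset m. if t < count m i then 1 else 0)" for t
  proof -
    have "nparts_gt t \<nu> = (\<Sum>a\<in>#\<nu>. if t < a then 1 else 0)" for \<nu>
      unfolding nparts_gt_def by (induction \<nu>) auto
    then show ?thesis by (auto simp: sum_exponents intro!: sum.cong)
  qed
  have m: "real (min (count m i) (count m j)) = (\<Sum>t<size m. (if t < count m i then 1 else 0) * (if t < count m j then 1 else 0))" for i j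
  proof -
    have "(\<Sum>t<size m. (if t < count m i then 1 else 0) * (if t < count m j then 1 else (0::real))) =
        (\<Sum>t<size m. if t < min (count m i) (count m j) then 1 else 0)" by (rule sum.cong) auto
    also have "\<dots> = real (card {t \<in> {..<size m}. t < min (count m i) (count m j)})"
      by (simp flip: sum.inter_filter)
    also have "{t \<in> {..<size m}. t < min (count m i) (count m j)} = {..<min (count m i) (count m j)}"
      using count_le_size[of m i] by auto
    finally show ?thesis by simp
  qed
  have "(\<Sum>i\<in>set_mset m. \<Sum>j\<in>set_mset m. real (min (count m i) (count m j))) =
    (\<Sum>t<size m. \<Sum>i\<in>set_mset m. \<Sum>j\<in>set_mset m. (if t < count m i then 1 else 0) * (if t < count m j then 1 else 0))"
    unfolding m by (subst sum.swap[of _ "{..<size m}"], subst sum.swap[of _ "{..<size m}"]) simp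
  then show ?thesis
    unfolding minsum_def np power2_eq_square sum_product by simp
qed

section \<open>Triangularity of the moments of the Lax operator\<close>

definition lax_series :: "real \<Rightarrow> nat \<Rightarrow> symfun \<Rightarrow> nat \<Rightarrow> nat \<Rightarrow> nat multiset \<Rightarrow> real" where
  "lax_series \<alpha> N f k i m = wseries N ((lax \<alpha> N ^^ k) (wlift \<alpha> f)) i m"

lemma mcoeff_ham: "mcoeff (ham \<alpha> N k f) m = (\<Sum>i\<in>set_mset m. lax_series \<alpha> N f k i m)"
  by (simp add: ham_def mcoeff_wproj lax_series_def)

lemma lax_series_0: "size m \<le> N \<Longrightarrow> lax_series \<alpha> N f 0 i m = \<alpha> * real (count m i) * mcoeff f m"
  using count_le_size[of m i] by (simp add: lax_series_def wseries_wlift)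

lemma lax_series_Suc:
  assumes "i \<in># m" "size m \<le> N"
  shows "lax_series \<alpha> N f (Suc k) i m = \<alpha> * real (count m i) * lax_series \<alpha> N f k i m +
    (\<Sum>j\<in>set_mset m - {i}.
      (\<Sum>s=1..min (count m i) (count m j).
         lax_series \<alpha> N f k i (upd2 m i j (max (count m i) (count m j) + s) (min (count m i) (count m j) - s))) -
      (\<Sum>s<min (count m i) (count m j).
         lax_series \<alpha> N f k i (upd2 m i j (min (count m i) (count m j) - s) (max (count m i) (count m j) + s))))"
  unfolding lax_series_def funpow.simps o_def by (rule wseries_lax[OF assms])

lemma lax_series_upd2_swap: "i \<noteq> j \<Longrightarrow> lax_series \<alpha> N f k i (upd2 m i j x y) = lax_series \<alpha> N f k j (upd2 m i j y x)"
  unfolding lax_series_def by (rule wseries_upd2_swap)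

lemma excess_exponents:
  assumes "finite S" "set_mset m \<subseteq> S"
  shows "excess t (exponents m) = (\<Sum>i\<in>S. count m i - t)"
  unfolding excess_def sum_exponents
  by (rule sum.mono_neutral_left) (use assms in \<open>auto simp: not_in_iff\<close>)

lemma set_upd2: "set_mset (upd2 m i j x y) \<subseteq> insert i (insert j (set_mset m))"
  by (auto simp: upd2_def split: if_splits)

lemma sum_upd2:
  fixes g :: "nat \<Rightarrow> 'a::comm_monoid_add" and m :: "nat multiset"
  assumes "i \<noteq> j"
  defines "S \<equiv> insert i (insert j (set_mset m))"
  shows "(\<Sum>k\<in>S. g (count (upd2 m i j x y) k)) = g x + (g y + (\<Sum>k\<in>S - {i, j}. g (count m k)))"
proof -
  have "S = insert i (insert j (S - {i, j}))" by (auto simp: S_def)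
  then have "(\<Sum>k\<in>S. g (count (upd2 m i j x y) k)) =
      (\<Sum>k\<in>insert i (insert j (S - {i, j})). g (count (upd2 m i j x y) k))" by simp
  also have "\<dots> = g x + (g y + (\<Sum>k\<in>S - {i, j}. g (count (upd2 m i j x y) k)))"
    using assms(1) by (subst sum.insert, simp add: S_def, simp, subst sum.insert) (auto simp: S_def count_upd2)
  also have "(\<Sum>k\<in>S - {i, j}. g (count (upd2 m i j x y) k)) = (\<Sum>k\<in>S - {i, j}. g (count m k))"
    using assms(1) by (intro sum.cong) (auto simp: count_upd2)
  finally show ?thesis .
qed

text \<open>Widening two exponents with fixed sum increases every excess, since x \<mapsto> (x -
  t)^+ is convex.\<close>

lemma dominated_upd2:
  fixes m :: "nat multiset"
  assumes ij: "i \<noteq> j" and s: "s \<le> min (count m i) (count m j)"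
  defines "M \<equiv> max (count m i) (count m j)" and "mm \<equiv> min (count m i) (count m j)"
  shows "dominated (exponents m) (exponents (upd2 m i j (M + s) (mm - s)))"
    and "dominated (exponents m) (exponents (upd2 m i j (mm - s) (M + s)))"
proof -
  have *: "dominated (exponents m) (exponents (upd2 m i j x y))"
    if xy: "x + y = count m i + count m j"
      "\<And>t. (count m i - t) + (count m j - t) \<le> (x - t) + (y - t)" for x y
    unfolding dominated_iff_excess
  proof (intro conjI allI)
    show "sum_mset (exponents m) = sum_mset (exponents (upd2 m i j x y))"
      using size_upd2[OF ij xy(1)] by simp
    fix t
    let ?S = "insert i (insert j (set_mset m))"
    have "excess t (exponents m) = (\<Sum>k\<in>?S. count m k - t)"
      by (rule excess_exponents) auto
    also have "\<dots> = (\<Sum>k\<in>?S. count (upd2 m i j (count m i) (count m j)) k - t)"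
      by (simp add: upd2_id[OF ij])
    also have "\<dots> \<le> (\<Sum>k\<in>?S. count (upd2 m i j x y) k - t)"
      unfolding sum_upd2[OF ij, of "\<lambda>c. c - t"] using xy(2)[of t] by simp
    also have "\<dots> = excess t (exponents (upd2 m i j x y))"
      by (rule excess_exponents[symmetric]) (use set_upd2 in auto)
    finally show "excess t (exponents m) \<le> excess t (exponents (upd2 m i j x y))" .
  qed
  show "dominated (exponents m) (exponents (upd2 m i j (M + s) (mm - s)))"
    by (rule *) (use s in \<open>auto simp: M_def mm_def\<close>)
  show "dominated (exponents m) (exponents (upd2 m i j (mm - s) (M + s)))"
    by (rule *) (use s in \<open>auto simp: M_def mm_def\<close>)
qed

text \<open>The increase is 2 s (M - mm + s), which is positive for s >= 1; so a genuine move goes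
  strictly up in dominance.\<close>

lemma sqsum_upd2:
  fixes m :: "nat multiset"
  assumes ij: "i \<noteq> j" and s: "s \<le> min (count m i) (count m j)" "s \<ge> 1"
  defines "M \<equiv> max (count m i) (count m j)" and "mm \<equiv> min (count m i) (count m j)"
  shows "sqsum (exponents m) < sqsum (exponents (upd2 m i j (M + s) (mm - s)))"
    and "sqsum (exponents m) < sqsum (exponents (upd2 m i j (mm - s) (M + s)))"
proof -
  let ?S = "insert i (insert j (set_mset m))"
  have sq: "sqsum (exponents m') = (\<Sum>k\<in>?S. count m' k * count m' k)" if "set_mset m' \<subseteq> ?S" for m'
    unfolding sqsum_def sum_exponents
    by (rule sum.mono_neutral_left) (use that in \<open>auto simp: not_in_iff\<close>)
  have sq_upd: "sqsum (exponents (upd2 m i j x y)) = x * x + (y * y + (\<Sum>k\<in>?S - {i, j}. count m k * count m k))" for x y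
    unfolding sq[OF set_upd2] by (rule sum_upd2[OF ij, of "\<lambda>c. c * c"])
  have m: "sqsum (exponents m) = count m i * count m i + (count m j * count m j + (\<Sum>k\<in>?S - {i, j}. count m k * count m k))"
    using sq_upd[of "count m i" "count m j"] by (simp add: upd2_id[OF ij])
  obtain r where r: "mm = r + s" using s(1) by (metis le_add_diff_inverse2 mm_def)
  have "count m i * count m i + count m j * count m j = M * M + mm * mm"
    by (auto simp: M_def mm_def max_def min_def)
  also have "\<dots> < (M + s) * (M + s) + (mm - s) * (mm - s)"
  proof -
    have "r + s \<le> M" using r by (simp add: M_def mm_def)
    then have "r * s < M * s" using s(2) by simp
    moreover have "(M + s) * (M + s) + (r + s - s) * (r + s - s) = M * M + r * r + 2 * (M * s) + s * s"
      by (simp add: algebra_simps)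
    moreover have "M * M + (r + s) * (r + s) = M * M + r * r + 2 * (r * s) + s * s"
      by (simp add: algebra_simps)
    ultimately show ?thesis unfolding r by linarith
  qed
  finally have "count m i * count m i + count m j * count m j < (M + s) * (M + s) + (mm - s) * (mm - s)" .
  then show "sqsum (exponents m) < sqsum (exponents (upd2 m i j (M + s) (mm - s)))"
    and "sqsum (exponents m) < sqsum (exponents (upd2 m i j (mm - s) (M + s)))"
    unfolding m sq_upd by simp_all
qed

text \<open>Coefficient form of membership in the span of the monomial functions below \<nu>, see
  \<open>span_dominated_iff\<close>.\<close>

definition supported :: "nat multiset \<Rightarrow> symfun \<Rightarrow> bool" where
  "supported \<nu> f \<longleftrightarrow> (\<forall>m. mcoeff f m \<noteq> 0 \<longrightarrow> dominated (exponents m) \<nu>)"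

text \<open>The recursion refers only to \<open>m\<close> and to types weakly above it, so not lying
  below \<nu> is inherited by all terms.\<close>

lemma lax_series_supported:
  assumes f: "supported \<nu> f" and "\<not> dominated (exponents m) \<nu>" "i \<in># m" "size m \<le> N"
  shows "lax_series \<alpha> N f k i m = 0"
  using assms(2-)
proof (induction k arbitrary: m)
  case 0
  then show ?case using f by (auto simp: lax_series_0 supported_def)
next
  case (Suc k)
  let ?M = "\<lambda>j. max (count m i) (count m j)" and ?m = "\<lambda>j. min (count m i) (count m j)"
  have "lax_series \<alpha> N f k i (upd2 m i j (?M j + s) (?m j - s)) = 0"
    if "i \<noteq> j" "s \<le> ?m j" for j s
  proof (rule Suc.IH)
    show "\<not> dominated (exponents (upd2 m i j (?M j + s) (?m j - s))) \<nu>"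
      using dominated_upd2(1)[OF that] Suc.prems(1) dominated_trans by blast
    show "i \<in># upd2 m i j (?M j + s) (?m j - s)"
      using Suc.prems(2) that by (auto simp: count_upd2 max_def simp flip: count_greater_zero_iff)
    show "size (upd2 m i j (?M j + s) (?m j - s)) \<le> N"
      using Suc.prems(3) that by (subst size_upd2) auto
  qed
  moreover have "lax_series \<alpha> N f k i (upd2 m i j (?m j - s) (?M j + s)) = 0"
    if "i \<noteq> j" "s < ?m j" for j s
  proof (rule Suc.IH)
    show "\<not> dominated (exponents (upd2 m i j (?m j - s) (?M j + s))) \<nu>"
      using dominated_upd2(2)[of i j s m] that Suc.prems(1) dominated_trans by (meson less_imp_le)
    show "i \<in># upd2 m i j (?m j - s) (?M j + s)"
      using that by (simp add: count_upd2 flip: count_greater_zero_iff)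
    show "size (upd2 m i j (?m j - s) (?M j + s)) \<le> N"
      using Suc.prems(3) that by (subst size_upd2) auto
  qed
  moreover have "lax_series \<alpha> N f k i m = 0" by (rule Suc.IH) (use Suc.prems in auto)
  ultimately show ?case using Suc.prems by (simp add: lax_series_Suc)
qed

text \<open>The action of the Lax operator on the terms of exponent type \<open>\<nu>\<close> of a series supported below \<open>\<nu>\<close>.\<close>

primrec top_vec :: "real \<Rightarrow> nat multiset \<Rightarrow> nat \<Rightarrow> nat \<Rightarrow> real" where
  "top_vec \<alpha> m 0 i = \<alpha> * real (count m i)"
| "top_vec \<alpha> m (Suc k) i = \<alpha> * real (count m i) * top_vec \<alpha> m k i -
     (\<Sum>j\<in>set_mset m - {i}. top_vec \<alpha> m k (if count m i \<le> count m j then i else j))"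

definition top_eigenvalue :: "real \<Rightarrow> nat \<Rightarrow> nat multiset \<Rightarrow> real" where
  "top_eigenvalue \<alpha> k m = (\<Sum>i\<in>set_mset m. top_vec \<alpha> m k i)"

text \<open>At the top type every move with s >= 1 leaves the support. What survives is the term s =
  0 of the subtracted sum: there x_i carries the smaller exponent, so it is the value at i, or after
  exchanging the variables the value at j.\<close>

lemma lax_series_top:
  assumes f: "supported (exponents m) f" and "i \<in># m" "size m \<le> N"
  shows "lax_series \<alpha> N f k i m = top_vec \<alpha> m k i * mcoeff f m"
  using assms(2,3)
proof (induction k arbitrary: i)
  case 0
  then show ?case by (simp add: lax_series_0)
next
  case (Suc k)
  let ?M = "\<lambda>j. max (count m i) (count m j)" and ?m = "\<lambda>j. min (count m i) (count m j)"
  have z1: "lax_series \<alpha> N f k i (upd2 m i j (?M j + s) (?m j - s)) = 0"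
    if "i \<noteq> j" "s \<le> ?m j" "s \<ge> 1" for j s
  proof (rule lax_series_supported[OF f])
    show "\<not> dominated (exponents (upd2 m i j (?M j + s) (?m j - s))) (exponents m)"
      using dominated_upd2(1)[OF that(1,2)] sqsum_upd2(1)[OF that] dominated_antisym
      by (metis exponents_partitions less_irrefl)
    show "i \<in># upd2 m i j (?M j + s) (?m j - s)"
      using Suc.prems(1) that by (simp add: count_upd2 flip: count_greater_zero_iff)
    show "size (upd2 m i j (?M j + s) (?m j - s)) \<le> N"
      using Suc.prems(2) that by (subst size_upd2) auto
  qed
  have z2: "lax_series \<alpha> N f k i (upd2 m i j (?m j - s) (?M j + s)) = 0"
    if "i \<noteq> j" "s < ?m j" "s \<ge> 1" for j s
  proof (rule lax_series_supported[OF f])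
    show "\<not> dominated (exponents (upd2 m i j (?m j - s) (?M j + s))) (exponents m)"
      using dominated_upd2(2)[of i j s m] sqsum_upd2(2)[of i j s m] that dominated_antisym
      by (metis exponents_partitions less_imp_le less_irrefl)
    show "i \<in># upd2 m i j (?m j - s) (?M j + s)"
      using that by (simp add: count_upd2 flip: count_greater_zero_iff)
    show "size (upd2 m i j (?m j - s) (?M j + s)) \<le> N"
      using Suc.prems(2) that by (subst size_upd2) auto
  qed
  have "lax_series \<alpha> N f (Suc k) i m = \<alpha> * real (count m i) * lax_series \<alpha> N f k i m +
      (\<Sum>j\<in>set_mset m - {i}. - lax_series \<alpha> N f k (if count m i \<le> count m j then i else j) m)"
    unfolding lax_series_Suc[OF Suc.prems]
  proof (intro arg_cong2[where f = "(+)"] refl sum.cong)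
    fix j assume j: "j \<in> set_mset m - {i}"
    then have ij: "i \<noteq> j" by auto
    have "(\<Sum>s=1..?m j. lax_series \<alpha> N f k i (upd2 m i j (?M j + s) (?m j - s))) = 0"
      using z1[OF ij] by simp
    moreover have "(\<Sum>s<?m j. lax_series \<alpha> N f k i (upd2 m i j (?m j - s) (?M j + s))) =
        (\<Sum>s\<in>{0}. lax_series \<alpha> N f k i (upd2 m i j (?m j - s) (?M j + s)))"
      by (rule sum.mono_neutral_right) (use z2[OF ij] j Suc.prems(1) in auto)
    moreover have "lax_series \<alpha> N f k i (upd2 m i j (?m j) (?M j)) = lax_series \<alpha> N f k (if count m i \<le> count m j then i else j) m"
    proof (cases "count m i \<le> count m j")
      case True
      then show ?thesis by (simp add: upd2_id[OF ij] min_absorb1 max_absorb2)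
    next
      case False
      then have "?m j = count m j" "?M j = count m i" by auto
      then show ?thesis using False lax_series_upd2_swap[OF ij, of \<alpha> N f k m "count m j" "count m i"]
        by (simp add: upd2_id[OF ij])
    qed
    ultimately show "(\<Sum>s=1..?m j. lax_series \<alpha> N f k i (upd2 m i j (?M j + s) (?m j - s))) -
        (\<Sum>s<?m j. lax_series \<alpha> N f k i (upd2 m i j (?m j - s) (?M j + s))) =
        - lax_series \<alpha> N f k (if count m i \<le> count m j then i else j) m" by simp
  qed
  also have "(\<Sum>j\<in>set_mset m - {i}. - lax_series \<alpha> N f k (if count m i \<le> count m j then i else j) m) =
      (\<Sum>j\<in>set_mset m - {i}. - (top_vec \<alpha> m k (if count m i \<le> count m j then i else j) * mcoeff f m))"
    by (intro sum.cong refl arg_cong[where f = uminus] Suc.IH) (use Suc.prems in auto)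
  finally show ?case
    by (simp add: Suc.IH[OF Suc.prems] sum_negf sum_distrib_left algebra_simps)
qed

section \<open>Preservation of degree\<close>

definition homogeneous :: "nat \<Rightarrow> symfun \<Rightarrow> bool" where
  "homogeneous n f \<longleftrightarrow> (\<forall>m. mcoeff f m \<noteq> 0 \<longrightarrow> size m = n)"

text \<open>Dropping the power sum products of other degrees from the expansion does not change f,
  and the expansion is unique.\<close>

lemma homogeneous_p_coeff:
  assumes f: "homogeneous n f" and \<nu>: "\<nu> \<in> partitions" "p_coeff f \<nu> \<noteq> 0"
  shows "sum_mset \<nu> = n"
proof (rule ccontr)
  assume ne: "sum_mset \<nu> \<noteq> n"
  define A where "A = {\<nu> \<in> partitions. p_coeff f \<nu> \<noteq> 0}"
  define g where "g = (\<Sum>\<mu>\<in>{\<mu>\<in>A. sum_mset \<mu> = n}. p_coeff f \<mu> *\<^sub>R power_prod \<mu>)"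
  have fin: "finite A" unfolding A_def by (rule finite_p_coeff)
  have "mcoeff f m = mcoeff g m" for m
  proof (cases "size m = n")
    case True
    have "mcoeff f m = (\<Sum>\<mu>\<in>A. p_coeff f \<mu> * mcoeff (power_prod \<mu>) m)"
      by (subst p_expansion[of f]) (simp add: A_def)
    also have "\<dots> = (\<Sum>\<mu>\<in>{\<mu>\<in>A. sum_mset \<mu> = n}. p_coeff f \<mu> * mcoeff (power_prod \<mu>) m)"
      using fin mcoeff_power_prod_size[of _ m] True
      by (intro sum.mono_neutral_right) (auto simp: A_def)
    finally show ?thesis by (simp add: g_def)
  next
    case False
    have "mcoeff (power_prod \<mu>) m = 0" if "\<mu> \<in> A" "sum_mset \<mu> = n" for \<mu>
      using mcoeff_power_prod_size[of \<mu> m] that False by (auto simp: A_def)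
    then have "mcoeff g m = 0" by (simp add: g_def)
    then show ?thesis using f False by (auto simp: homogeneous_def)
  qed
  then have "f = g" by (rule symfun_eqI)
  then have "p_coeff f \<nu> = p_coeff g \<nu>" by simp
  also have "\<dots> = (\<Sum>\<mu>\<in>{\<mu>\<in>A. sum_mset \<mu> = n}. p_coeff f \<mu> * p_coeff (power_prod \<mu>) \<nu>)"
    unfolding g_def linear_sum[OF linear_p_coeff] linear_scale[OF linear_p_coeff] by simp
  also have "\<dots> = 0"
    using ne \<nu>(1) by (intro sum.neutral) (auto simp: A_def p_coeff_power_prod)
  finally show False using \<nu>(2) by simp
qed

lemma homogeneous_pdiff:
  assumes f: "homogeneous n f" and "mcoeff (pdiff k f) m \<noteq> 0"
  shows "size m + k = n"
proof -
  have "pdiff k f = (\<Sum>\<nu> | \<nu> \<in> partitions \<and> p_coeff f \<nu> \<noteq> 0. p_coeff f \<nu> *\<^sub>R pdiff k (power_prod \<nu>))"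
    by (subst p_expansion[of f]) (simp add: linear_sum[OF linear_pdiff] linear_scale[OF linear_pdiff])
  then have "(\<Sum>\<nu> | \<nu> \<in> partitions \<and> p_coeff f \<nu> \<noteq> 0. p_coeff f \<nu> * mcoeff (pdiff k (power_prod \<nu>)) m) \<noteq> 0"
    using assms(2) by simp
  then obtain \<nu> where \<nu>: "\<nu> \<in> partitions" "p_coeff f \<nu> \<noteq> 0" "mcoeff (pdiff k (power_prod \<nu>)) m \<noteq> 0"
    by (auto elim!: sum.not_neutral_contains_not_neutral)
  then have k: "k \<in># \<nu>" "mcoeff (power_prod (\<nu> - {#k#})) m \<noteq> 0"
    by (auto simp: pdiff_power_prod split: if_splits)
  then obtain \<nu>' where \<nu>': "\<nu> = add_mset k \<nu>'" by (metis multi_member_split)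
  then have "size m = sum_mset \<nu>'" using k \<nu>(1) by (intro mcoeff_power_prod_size) auto
  moreover have "sum_mset \<nu> = n" by (rule homogeneous_p_coeff[OF f \<nu>(1,2)])
  ultimately show ?thesis by (simp add: \<nu>')
qed

text \<open>With w of degree 1 the Lax operator preserves the total degree n. Powers of w above n
  are treated separately because n - a is truncated subtraction.\<close>

lemma lax_homogeneous:
  assumes "\<And>a. a \<le> n \<Longrightarrow> homogeneous (n - a) (G a)" "\<And>a. a > n \<Longrightarrow> G a = 0"
  shows "(c \<le> n \<longrightarrow> homogeneous (n - c) (lax \<alpha> N G c)) \<and> (c > n \<longrightarrow> lax \<alpha> N G c = 0)"
proof -
  have *: "size m + c = n" if m: "mcoeff (lax \<alpha> N G c) m \<noteq> 0" for m
  proof -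
    have G: "size m + a = n" if "mcoeff (G a) m \<noteq> 0" for m a
      using assms(1)[of a] assms(2)[of a] that by (cases "a \<le> n") (auto simp: homogeneous_def)
    consider "mcoeff (G c) m \<noteq> 0" | a where "a \<in> {1..<c}" "mcoeff (pdiff (c - a) (G a)) m \<noteq> 0"
      | a where "a \<in> {Suc c..N}" "mcoeff (power_sum (a - c) * G a) m \<noteq> 0"
    proof (rule ccontr)
      assume *: "\<not> thesis"
      then have "mcoeff (G c) m = 0" "\<forall>a\<in>{1..<c}. mcoeff (pdiff (c - a) (G a)) m = 0"
        "\<forall>a\<in>{Suc c..N}. mcoeff (power_sum (a - c) * G a) m = 0" using that by blast+
      then have "mcoeff (lax \<alpha> N G c) m = 0" by (simp add: lax_def)
      with m show False by simp
    qed
    then show ?thesis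
    proof cases
      case 1
      then show ?thesis by (rule G)
    next
      case (2 a)
      then have "G a \<noteq> 0" by (auto simp: linear_0[OF linear_pdiff])
      then have a: "a \<le> n" using assms(2)[of a] by (meson not_le)
      have "size m + (c - a) = n - a" by (rule homogeneous_pdiff[OF assms(1)[OF a] 2(2)])
      then show ?thesis using 2(1) a by auto
    next
      case (3 a)
      then have "a - c > 0" by auto
      then obtain i where "xmul i (a - c) (mcoeff (G a)) m \<noteq> 0"
        using 3(2) by (auto simp: mcoeff_power_sum_mult elim!: sum.not_neutral_contains_not_neutral)
      then have i: "a - c \<le> count m i" "mcoeff (G a) (m - replicate_mset (a - c) i) \<noteq> 0"
        by (auto simp: xmul_def split: if_splits)
      then have "size (m - replicate_mset (a - c) i) + a = n" by (intro G)
      moreover have "size (m - replicate_mset (a - c) i) = size m - (a - c)"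
        using i(1) by (simp add: size_Diff_submset count_le_replicate_mset_subset_eq)
      moreover have "a - c \<le> size m" using i(1) count_le_size[of m i] by simp
      ultimately show ?thesis using 3(1) by auto
    qed
  qed
  show ?thesis
  proof (intro conjI impI)
    assume "c \<le> n"
    then show "homogeneous (n - c) (lax \<alpha> N G c)" using * by (fastforce simp: homogeneous_def)
  next
    assume "c > n"
    then show "lax \<alpha> N G c = 0" using * by (intro symfun_eqI) fastforce
  qed
qed

lemma homogeneous_ham:
  assumes f: "homogeneous n f"
  shows "homogeneous n (ham \<alpha> N k f)"
proof -
  define G where "G = (lax \<alpha> N ^^ k) (wlift \<alpha> f)"
  have "(\<forall>a\<le>n. homogeneous (n - a) (G a)) \<and> (\<forall>a>n. G a = 0)"
    unfolding G_def
  proof (induction k)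
    case 0
    have "size m + a = n" if "mcoeff (wlift \<alpha> f a) m \<noteq> 0" for a m
      using that homogeneous_pdiff[OF f, of a m] by (auto simp: wlift_def)
    then show ?case by (fastforce simp: homogeneous_def intro!: symfun_eqI)
  next
    case (Suc k)
    then show ?case using lax_homogeneous[of n "(lax \<alpha> N ^^ k) (wlift \<alpha> f)"] by auto
  qed
  then have G: "size m + a = n" if "mcoeff (G a) m \<noteq> 0" for m a
    using that by (cases "a \<le> n") (auto simp: homogeneous_def)
  show ?thesis unfolding homogeneous_def ham_def G_def[symmetric] mcoeff_wproj
  proof (intro allI impI)
    fix m assume "(\<Sum>i\<in>set_mset m. wseries N G i m) \<noteq> 0"
    then obtain i a where "xmul i a (mcoeff (G a)) m \<noteq> 0"
      unfolding wseries_def by (metis (no_types, lifting) sum.not_neutral_contains_not_neutral)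
    then have i: "a \<le> count m i" "mcoeff (G a) (m - replicate_mset a i) \<noteq> 0"
      by (auto simp: xmul_def split: if_splits)
    then have "size (m - replicate_mset a i) + a = n" by (intro G)
    moreover have "size (m - replicate_mset a i) = size m - a"
      using i(1) by (simp add: size_Diff_submset count_le_replicate_mset_subset_eq)
    moreover have "a \<le> size m" using i(1) count_le_size[of m i] by simp
    ultimately show "size m = n" by auto
  qed
qed

lemma supported_homogeneous: "supported \<nu> f \<Longrightarrow> homogeneous (sum_mset \<nu>) f"
  unfolding supported_def homogeneous_def using dominated_sum by fastforce

text \<open>By homogeneity only monomials of size |\<nu>| <= N can occur, and for those the
  truncated recursion is exact.\<close>

lemma supported_ham:
  assumes f: "supported \<nu> f" and N: "sum_mset \<nu> \<le> N"
  shows "supported \<nu> (ham \<alpha> N k f)"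
  unfolding supported_def
proof (intro allI impI, rule ccontr)
  fix m assume m: "mcoeff (ham \<alpha> N k f) m \<noteq> 0" "\<not> dominated (exponents m) \<nu>"
  have "size m = sum_mset \<nu>"
    using homogeneous_ham[OF supported_homogeneous[OF f]] m(1) by (auto simp: homogeneous_def)
  then have "mcoeff (ham \<alpha> N k f) m = 0"
    unfolding mcoeff_ham using N by (intro sum.neutral ballI lax_series_supported[OF f m(2)]) auto
  with m(1) show False by simp
qed

lemma ham_top:
  assumes "supported (exponents m) f" "size m \<le> N"
  shows "mcoeff (ham \<alpha> N k f) m = top_eigenvalue \<alpha> k m * mcoeff f m"
  unfolding mcoeff_ham top_eigenvalue_def sum_distrib_right
  by (intro sum.cong refl lax_series_top assms)

section \<open>The top coefficients separate partitions\<close>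

text \<open>Adding the term j = i completes the subtracted sum to all of \<open>set_mset m\<close>,
  where i and j play the same role. Hence the side chosen in the recursion at a tie is
  immaterial.\<close>

lemma top_vec_ties:
  assumes "count m i = count m j" "i \<in># m" "j \<in># m"
  shows "top_vec \<alpha> m k i = top_vec \<alpha> m k j"
proof (induction k)
  case 0
  then show ?case using assms by simp
next
  case (Suc k)
  have *: "top_vec \<alpha> m (Suc k) i = (\<alpha> * real (count m i) + 1) * top_vec \<alpha> m k i -
      (\<Sum>a\<in>set_mset m. top_vec \<alpha> m k (if count m i \<le> count m a then i else a))" if "i \<in># m" for i
    using that by (simp add: sum.remove[of "set_mset m" i] algebra_simps)
  have "top_vec \<alpha> m k (if count m i \<le> count m a then i else a) = top_vec \<alpha> m k (if count m j \<le> count m a then j else a)" for a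
    using Suc assms by simp
  then show ?case unfolding *[OF assms(2)] *[OF assms(3)] using Suc assms(1) by simp
qed

text \<open>Each of the i variables before i contributes the entry at i itself, each later one its
  own entry: the matrix is upper triangular with diagonal \<alpha> \<nu>_i - i.\<close>

lemma top_vec_decreasing:
  assumes set: "set_mset m = {..<l}" and mono: "\<And>i j. i \<le> j \<Longrightarrow> count m j \<le> count m i" and i: "i < l"
  shows "top_vec \<alpha> m (Suc k) i = (\<alpha> * real (count m i) - real i) * top_vec \<alpha> m k i - (\<Sum>a\<in>{Suc i..<l}. top_vec \<alpha> m k a)"
proof -
  have split: "{..<l} - {i} = {..<i} \<union> {Suc i..<l}" using i by auto
  have "(\<Sum>j\<in>set_mset m - {i}. top_vec \<alpha> m k (if count m i \<le> count m j then i else j)) =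
      (\<Sum>j\<in>{..<i}. top_vec \<alpha> m k (if count m i \<le> count m j then i else j)) +
      (\<Sum>j\<in>{Suc i..<l}. top_vec \<alpha> m k (if count m i \<le> count m j then i else j))"
    unfolding set split by (rule sum.union_disjoint) auto
  also have "(\<Sum>j\<in>{..<i}. top_vec \<alpha> m k (if count m i \<le> count m j then i else j)) = (\<Sum>j\<in>{..<i}. top_vec \<alpha> m k i)"
    by (intro sum.cong refl) (use mono in auto)
  also have "(\<Sum>j\<in>{Suc i..<l}. top_vec \<alpha> m k (if count m i \<le> count m j then i else j)) =
      (\<Sum>j\<in>{Suc i..<l}. top_vec \<alpha> m k j)"
  proof (intro sum.cong refl)
    fix j assume j: "j \<in> {Suc i..<l}"
    show "top_vec \<alpha> m k (if count m i \<le> count m j then i else j) = top_vec \<alpha> m k j"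
      using top_vec_ties[of m i j] mono[of i j] j i set by auto
  qed
  finally show ?thesis by (simp add: algebra_simps)
qed

text \<open>With \<open>U = 1/X - 1\<close> and parts \<open>\<nu>\<^sub>0 \<ge> \<nu>\<^sub>1 \<ge> \<dots>\<close>, the generating function of the top eigenvalues is, up to trivial
  factors, Kerov's product \<open>\<Prod>\<^sub>i (U - \<alpha> \<nu>\<^sub>i + i) / (U - \<alpha> \<nu>\<^sub>i + i + 1)\<close>.\<close>

lemma top_eigenvalue_product:
  fixes m :: "nat multiset" and \<alpha> :: real
  assumes set: "set_mset m = {..<l}" and mono: "\<And>i j. i \<le> j \<Longrightarrow> count m j \<le> count m i" and "l \<le> N"
  defines "b \<equiv> \<lambda>i. real i - \<alpha> * real (count m i)"
  shows "(1 - fps_X - fps_X * (fps_X * Abs_fps (\<lambda>k. top_eigenvalue \<alpha> k m))) * (\<Prod>i<N. 1 + fps_const (b i) * fps_X) =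
    (1 + fps_const (real N - 1) * fps_X) * (\<Prod>i<N. 1 + fps_const (b i - 1) * fps_X)"
proof -
  define Y where "Y i = (if i < l then Abs_fps (\<lambda>k. top_vec \<alpha> m k i) else 0)" for i
  define S where "S i = (\<Sum>a\<in>{i..<N}. Y a)" for i
  have c0: "count m i = 0" if "i \<ge> l" for i
    using set that by (metis lessThan_iff not_in_iff not_less)
  \<comment> \<open>The generating function of the triangular recursion; the padding indices i >= l
    stand for zero parts and give 0 = 0.\<close>
  have Y: "(1 + fps_const (b i) * fps_X) * Y i = fps_const (\<alpha> * real (count m i)) - fps_X * S (Suc i)" if "i < N" for i
  proof (cases "i < l")
    case True
    have S: "fps_nth (S (Suc i)) k = (\<Sum>a\<in>{Suc i..<l}. top_vec \<alpha> m k a)" for k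
    proof -
      have "fps_nth (S (Suc i)) k = (\<Sum>a\<in>{Suc i..<N}. fps_nth (Y a) k)" by (simp add: S_def fps_sum_nth)
      also have "\<dots> = (\<Sum>a\<in>{Suc i..<l}. fps_nth (Y a) k)"
        by (rule sum.mono_neutral_right) (use \<open>l \<le> N\<close> in \<open>auto simp: Y_def\<close>)
      finally show ?thesis by (simp add: Y_def)
    qed
    show ?thesis
    proof (rule fps_ext)
      fix k
      show "fps_nth ((1 + fps_const (b i) * fps_X) * Y i) k = fps_nth (fps_const (\<alpha> * real (count m i)) - fps_X * S (Suc i)) k"
        using True top_vec_decreasing[OF set mono True]
        by (cases k) (auto simp: Y_def distrib_right S b_def mult.assoc algebra_simps)
    qed
  next
    case False
    then have "Y i = 0" "count m i = 0" using c0 by (auto simp: Y_def)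
    moreover have "S (Suc i) = 0" using False by (auto simp: S_def Y_def)
    ultimately show ?thesis by simp
  qed
  \<comment> \<open>\<open>Z\<close> interpolates between the first factors of the two sides:
    \<open>Z 0\<close> is the one on the left, \<open>Z N\<close> the one on the right, and each
    step trades one linear factor.\<close>
  define Z where "Z i = 1 + fps_const (real i - 1) * fps_X - fps_X * (fps_X * S i)" for i
  have step: "Z i * (1 + fps_const (b i) * fps_X) = Z (Suc i) * (1 + fps_const (b i - 1) * fps_X)" if i: "i < N" for i
  proof -
    have Si: "S i = Y i + S (Suc i)" using i by (simp add: S_def sum.atLeast_Suc_lessThan)
    let ?k = "1 + fps_const (b i) * fps_X" and ?x = "fps_X :: real fps"
    have c: "fps_const (real i - 1) = fps_const (real i) - 1" "fps_const (b i - 1) = fps_const (b i) - 1"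
        "fps_const (\<alpha> * real (count m i)) = fps_const (real i) - fps_const (b i)"
      by (simp_all add: b_def flip: fps_const_1_eq_1)
    have ring: "k * y = r - c - x * t \<Longrightarrow> k = 1 + c * x \<Longrightarrow>
        (1 + (r - 1) * x - x * (x * (y + t))) * k = (1 + r * x - x * (x * t)) * (1 + (c - 1) * x)"
      for x y t k r c :: "real fps" by algebra
    have "Z i * ?k = (1 + fps_const (real i) * ?x - ?x * (?x * S (Suc i))) * (1 + (fps_const (b i) - 1) * ?x)"
      unfolding Z_def Si c(1) by (rule ring[OF Y[OF i, unfolded c(3)] refl])
    also note c(2)[symmetric]
    finally show ?thesis by (simp add: Z_def)
  qed
  have "Z 0 * (\<Prod>i<n. 1 + fps_const (b i) * fps_X) = Z n * (\<Prod>i<n. 1 + fps_const (b i - 1) * fps_X)" if "n \<le> N" for n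
    using that
  proof (induction n)
    case (Suc n)
    then have "Z 0 * (\<Prod>i<Suc n. 1 + fps_const (b i) * fps_X) =
        (Z n * (1 + fps_const (b n) * fps_X)) * (\<Prod>i<n. 1 + fps_const (b i - 1) * fps_X)"
      by (simp add: mult_ac)
    also have "\<dots> = Z (Suc n) * (\<Prod>i<Suc n. 1 + fps_const (b i - 1) * fps_X)"
      using Suc.prems by (subst step) (auto simp: mult_ac)
    finally show ?case .
  qed simp
  from this[of N] have "Z 0 * (\<Prod>i<N. 1 + fps_const (b i) * fps_X) = Z N * (\<Prod>i<N. 1 + fps_const (b i - 1) * fps_X)"
    by simp
  moreover have "Z N = 1 + fps_const (real N - 1) * fps_X" by (simp add: Z_def S_def)
  moreover have "S 0 = Abs_fps (\<lambda>k. top_eigenvalue \<alpha> k m)"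
  proof (rule fps_ext)
    fix k
    have "fps_nth (S 0) k = (\<Sum>a\<in>{0..<N}. fps_nth (Y a) k)" by (simp add: S_def fps_sum_nth)
    also have "\<dots> = (\<Sum>a\<in>{..<l}. fps_nth (Y a) k)"
      by (rule sum.mono_neutral_right) (use \<open>l \<le> N\<close> in \<open>auto simp: Y_def\<close>)
    finally show "fps_nth (S 0) k = fps_nth (Abs_fps (\<lambda>k. top_eigenvalue \<alpha> k m)) k" by (simp add: Y_def top_eigenvalue_def set)
  qed
  moreover have "fps_const (- 1) = (- 1 :: real fps)" by (metis fps_const_1_eq_1 fps_const_neg)
  then have "Z 0 = 1 - fps_X - fps_X * (fps_X * S 0)" by (simp add: Z_def)
  ultimately show ?thesis by simp
qed

text \<open>The quotient of the two products is invariant under \<open>x \<mapsto> x + 1\<close> and tends to \<open>1\<close>.\<close>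

lemma shifted_products_eq:
  fixes b b' :: "nat \<Rightarrow> real"
  assumes eq: "\<And>x. x \<noteq> 0 \<Longrightarrow> (\<Prod>i<N. x + b i - 1) * (\<Prod>i<N. x + b' i) = (\<Prod>i<N. x + b' i - 1) * (\<Prod>i<N. x + b i)"
  shows "(\<Prod>i<N. x + b i) = (\<Prod>i<N. x + b' i)"
proof -
  define P where "P = (\<Prod>i<N. [:b i, 1:])"
  define Q where "Q = (\<Prod>i<N. [:b' i, 1:])"
  have P: "poly P x = (\<Prod>i<N. x + b i)" "poly Q x = (\<Prod>i<N. x + b' i)" for x
    by (simp_all add: P_def Q_def poly_prod add.commute)
  define R where "R x = poly P x / poly Q x" for x
  \<comment> \<open>\<open>K\<close> exceeds all |b i| and |b' i|, so both products are positive
    from there on.\<close>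
  define K where "K = 1 + (\<Sum>i<N. \<bar>b i\<bar> + \<bar>b' i\<bar>)"
  have "\<bar>b i\<bar> + \<bar>b' i\<bar> \<le> (\<Sum>i<N. \<bar>b i\<bar> + \<bar>b' i\<bar>)" if "i < N" for i
    by (rule member_le_sum) (use that in auto)
  then have K: "\<bar>b i\<bar> < K" "\<bar>b' i\<bar> < K" if "i < N" for i
    using that unfolding K_def by (smt (verit))+
  have K0: "K > 0" unfolding K_def by (intro add_pos_nonneg sum_nonneg) auto
  have pos: "poly P x > 0" "poly Q x > 0" if "x \<ge> K" for x
    unfolding P using K that by (auto intro!: prod_pos simp: abs_less_iff) (smt (verit))+
  have step: "R (x + 1) = R x" if "x \<ge> K" for x
  proof -
    \<comment> \<open>The hypothesis at x + 1 turns the shift by -1 into a comparison of x with x +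
      1.\<close>
    have "poly P x * poly Q (x + 1) = poly Q x * poly P (x + 1)"
      using eq[of "x + 1"] that K0 by (simp add: P algebra_simps)
    then show ?thesis using pos[of x] pos[of "x + 1"] that by (simp add: R_def field_simps)
  qed
  have Rn: "R (x + real n) = R x" if "x \<ge> K" for x n
  proof (induction n)
    case (Suc n)
    have "R (x + real (Suc n)) = R (x + real n + 1)" by (simp add: algebra_simps)
    also have "\<dots> = R (x + real n)" using that by (intro step) simp
    finally show ?case using Suc by simp
  qed simp
  have lim: "(R \<longlongrightarrow> 1) at_top"
  proof -
    have "((\<lambda>x. \<Prod>i<N. (x + b i) / (x + b' i)) \<longlongrightarrow> (\<Prod>i<N. 1)) at_top"
    proof (intro tendsto_prod)
      fix i
      have *: "((\<lambda>x. 1 + (b i - b' i) / (x + b' i)) \<longlongrightarrow> 1 + 0) at_top"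
        by (intro tendsto_intros tendsto_divide_0[OF tendsto_const]
            filterlim_at_top_imp_at_infinity filterlim_tendsto_add_at_top[OF tendsto_const filterlim_ident, simplified add.commute])
      show "((\<lambda>x. (x + b i) / (x + b' i)) \<longlongrightarrow> 1) at_top"
      proof (rule Lim_transform_eventually[OF *[simplified]])
        show "\<forall>\<^sub>F x in at_top. 1 + (b i - b' i) / (x + b' i) = (x + b i) / (x + b' i)"
          using eventually_gt_at_top[of "- b' i"]
          by eventually_elim (auto simp: field_simps)
      qed
    qed
    moreover have "R = (\<lambda>x. \<Prod>i<N. (x + b i) / (x + b' i))"
      by (simp add: R_def P prod_dividef fun_eq_iff)
    ultimately show ?thesis by simp
  qed
  have "R x = 1" if "x \<ge> K" for x
  proof -
    have "filterlim (\<lambda>n. x + real n) at_top sequentially"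
      by (intro filterlim_tendsto_add_at_top[OF tendsto_const] filterlim_real_sequentially)
    then have "(\<lambda>n. R (x + real n)) \<longlonglongrightarrow> 1" using lim by (rule filterlim_compose[rotated])
    then have "(\<lambda>n :: nat. R x) \<longlonglongrightarrow> 1" by (simp add: Rn[OF that])
    then show ?thesis by (simp add: tendsto_const_iff)
  qed
  then have "poly P x = poly Q x" if "x \<ge> K" for x using pos[OF that] that by (simp add: R_def field_simps)
  then have "{K..} \<subseteq> {x. poly (P - Q) x = 0}" by auto
  moreover have "infinite {K..}" by (rule infinite_Ici)
  ultimately have "P - Q = 0" using poly_roots_finite[of "P - Q"] finite_subset by blast
  then show ?thesis using P by simp
qed

text \<open>The index of a value is the number of smaller values in the common image.\<close>

lemma strict_mono_same_set:
  fixes b b' :: "nat \<Rightarrow> real"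
  assumes b: "\<And>i j. i < j \<Longrightarrow> b i < b j" and b': "\<And>i j. i < j \<Longrightarrow> b' i < b' j"
    and eq: "b ` {..<N} = b' ` {..<N}" and i: "i < N"
  shows "b i = b' i"
proof -
  obtain j where j: "j < N" "b i = b' j" using eq i by (metis (no_types, lifting) imageE imageI lessThan_iff)
  have sm: "strict_mono b" "strict_mono b'" using b b' by (auto intro: strict_monoI)
  have "{y \<in> b ` {..<N}. y < b i} = b ` {..<i}" "{y \<in> b' ` {..<N}. y < b' j} = b' ` {..<j}"
    using i j(1) strict_mono_less[OF sm(1)] strict_mono_less[OF sm(2)] by auto
  then have "b ` {..<i} = b' ` {..<j}" using eq j(2) by simp
  moreover have "card (b ` {..<i}) = i" "card (b' ` {..<j}) = j"
    using card_image[OF strict_mono_imp_inj_on[OF sm(1)], of "{..<i}"]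
      card_image[OF strict_mono_imp_inj_on[OF sm(2)], of "{..<j}"] by simp_all
  ultimately show ?thesis using j(2) by simp
qed

text \<open>Equal eigenvalues give equal Kerov products, and the shift argument then identifies the
  numbers i - \<alpha> \<nu>_i as sets. They increase strictly in i, so their order gives back the
  parts.\<close>

lemma top_eigenvalue_separates:
  fixes m m' :: "nat multiset"
  assumes \<alpha>: "\<alpha> > 0"
    and m: "set_mset m = {..<l}" "\<And>i j. i \<le> j \<Longrightarrow> count m j \<le> count m i"
    and m': "set_mset m' = {..<l'}" "\<And>i j. i \<le> j \<Longrightarrow> count m' j \<le> count m' i"
    and eq: "\<And>k. top_eigenvalue \<alpha> k m = top_eigenvalue \<alpha> k m'"
  shows "m = m'"
proof -
  \<comment> \<open>Padding both partitions by zero parts to a common \<open>N\<close> makes the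
    prefactor \<open>n\<close> the same for both.\<close>
  define N where "N = max l l' + 1"
  define b b' where "b = (\<lambda>i. real i - \<alpha> * real (count m i))" and "b' = (\<lambda>i. real i - \<alpha> * real (count m' i))"
  define E :: "real fps" where "E = 1 - fps_X - fps_X * (fps_X * Abs_fps (\<lambda>k. top_eigenvalue \<alpha> k m))"
  define p where "p c = (\<Prod>i<N. [:1, c i:])" for c :: "nat \<Rightarrow> real"
  have p: "fps_of_poly (p c) = (\<Prod>i<N. 1 + fps_const (c i) * fps_X)" for c
    unfolding p_def by (simp add: fps_of_poly_prod fps_of_poly_pCons algebra_simps)
  define n where "n = [:1, real N - 1:]"
  have n: "fps_of_poly n = 1 + fps_const (real N - 1) * fps_X"
    unfolding n_def by (simp add: fps_of_poly_pCons algebra_simps)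
  have 1: "E * fps_of_poly (p b) = fps_of_poly n * fps_of_poly (p (\<lambda>i. b i - 1))"
    unfolding E_def p n b_def by (rule top_eigenvalue_product[OF m]) (auto simp: N_def)
  have 2: "E * fps_of_poly (p b') = fps_of_poly n * fps_of_poly (p (\<lambda>i. b' i - 1))"
    unfolding E_def p n b'_def eq by (rule top_eigenvalue_product[OF m']) (auto simp: N_def)
  have "fps_nth E 0 = 1" by (simp add: E_def)
  then have E: "E \<noteq> 0" by auto
  have n0: "fps_of_poly n \<noteq> 0" by (simp add: n_def)
  have "E * (fps_of_poly n * (fps_of_poly (p (\<lambda>i. b i - 1)) * fps_of_poly (p b'))) =
      E * (fps_of_poly n * (fps_of_poly (p (\<lambda>i. b' i - 1)) * fps_of_poly (p b)))"
  proof -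
    have "E * (fps_of_poly n * (fps_of_poly (p (\<lambda>i. b i - 1)) * fps_of_poly (p b'))) =
        (fps_of_poly n * fps_of_poly (p (\<lambda>i. b i - 1))) * (E * fps_of_poly (p b'))"
      by (simp only: mult_ac)
    also have "\<dots> = (E * fps_of_poly (p b)) * (fps_of_poly n * fps_of_poly (p (\<lambda>i. b' i - 1)))"
      by (simp only: 1 2)
    finally show ?thesis by (simp only: mult_ac)
  qed
  then have "fps_of_poly (p (\<lambda>i. b i - 1) * p b') = fps_of_poly (p (\<lambda>i. b' i - 1) * p b)"
    using E n0 by (simp add: fps_of_poly_mult)
  then have pp: "p (\<lambda>i. b i - 1) * p b' = p (\<lambda>i. b' i - 1) * p b" by (simp only: fps_of_poly_eq_iff)
  have "(\<Prod>i<N. x + b i - 1) * (\<Prod>i<N. x + b' i) = (\<Prod>i<N. x + b' i - 1) * (\<Prod>i<N. x + b i)" if x: "x \<noteq> 0" for x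
  proof -
    \<comment> \<open>Substituting X = 1/x and clearing denominators turns 1 + c X into x +
      c.\<close>
    have px: "x ^ N * poly (p c) (1 / x) = (\<Prod>i<N. x + c i)" for c
    proof -
      have "x ^ N * poly (p c) (1 / x) = (\<Prod>i<N. x * (1 + c i / x))"
        by (simp add: p_def poly_prod prod.distrib)
      also have "\<dots> = (\<Prod>i<N. x + c i)" using x by (intro prod.cong) (auto simp: field_simps)
      finally show ?thesis .
    qed
    have "(x ^ N * poly (p (\<lambda>i. b i - 1)) (1 / x)) * (x ^ N * poly (p b') (1 / x)) =
        (x ^ N * poly (p (\<lambda>i. b' i - 1)) (1 / x)) * (x ^ N * poly (p b) (1 / x))"
      using arg_cong[OF pp, of "\<lambda>q. poly q (1 / x)"] by (simp add: mult_ac)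
    then show ?thesis unfolding px by (simp add: add_diff_eq)
  qed
  then have PQ: "(\<Prod>i<N. x + b i) = (\<Prod>i<N. x + b' i)" for x by (rule shifted_products_eq)
  have "b ` {..<N} = b' ` {..<N}"
  proof -
    have mem: "y \<in> c ` {..<N} \<longleftrightarrow> (\<Prod>i<N. (- y) + c i) = 0" for c :: "nat \<Rightarrow> real" and y by auto
    show ?thesis by (rule set_eqI) (simp only: mem PQ)
  qed
  moreover have "b i < b j" if "i < j" for i j
  proof -
    have "\<alpha> * real (count m j) \<le> \<alpha> * real (count m i)"
      using m(2)[of i j] that \<alpha> by (intro mult_left_mono) auto
    then show ?thesis using that by (simp add: b_def)
  qed
  moreover have "b' i < b' j" if "i < j" for i j
  proof -
    have "\<alpha> * real (count m' j) \<le> \<alpha> * real (count m' i)"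
      using m'(2)[of i j] that \<alpha> by (intro mult_left_mono) auto
    then show ?thesis using that by (simp add: b'_def)
  qed
  ultimately have bb: "b i = b' i" if "i < N" for i using strict_mono_same_set[of b b' N i] that by blast
  show ?thesis
  proof (rule multiset_eqI)
    fix i
    show "count m i = count m' i"
    proof (cases "i < N")
      case True
      then show ?thesis using bb[OF True] \<alpha> by (simp add: b_def b'_def)
    next
      case False
      then have "i \<notin># m" "i \<notin># m'" using m(1) m'(1) by (auto simp: N_def)
      then show ?thesis by (simp add: not_in_iff)
    qed
  qed
qed

lemma ex_decreasing_monomial:
  assumes "\<nu> \<in> partitions"
  shows "\<exists>m l. exponents m = \<nu> \<and> set_mset m = {..<l} \<and> (\<forall>i j. i \<le> j \<longrightarrow> count m j \<le> count m i)"
proof -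
  define xs where "xs = rev (sorted_list_of_multiset \<nu>)"
  define c where "c i = (if i < length xs then xs ! i else 0)" for i
  have xs: "mset xs = \<nu>" "sorted_wrt (\<ge>) xs" by (simp_all add: xs_def sorted_wrt_rev)
  have pos: "xs ! i > 0" if "i < length xs" for i
    using that assms xs(1) unfolding partitions_def by (metis (mono_tags, lifting) bot_nat_0.not_eq_extremum mem_Collect_eq nth_mem set_mset_mset)
  have fin: "finite {i. c i > 0}" by (rule finite_subset[of _ "{..<length xs}"]) (auto simp: c_def split: if_splits)
  define m where "m = Abs_multiset c"
  have cm: "count m i = c i" for i unfolding m_def using fin by (simp add: Abs_multiset_inverse)
  have set: "set_mset m = {..<length xs}"
    using pos by (auto simp: cm c_def simp flip: count_greater_zero_iff split: if_splits)
  have "exponents m = image_mset (\<lambda>i. xs ! i) (mset_set {..<length xs})"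
    unfolding exponents_def set by (intro image_mset_cong) (simp add: cm c_def)
  also have "\<dots> = mset (map (\<lambda>i. xs ! i) [0..<length xs])"
    by (simp add: lessThan_atLeast0 flip: mset_upt)
  also have "\<dots> = \<nu>" using xs(1) by (simp add: map_nth)
  finally have "exponents m = \<nu>" .
  moreover have "count m j \<le> count m i" if "i \<le> j" for i j
    using sorted_wrt_nth_less[OF xs(2), of i j] that by (cases "i = j") (auto simp: cm c_def)
  ultimately show ?thesis using set by blast
qed

section \<open>Jack symmetric functions\<close>

lemma mcoeff_monomial_sym: "mcoeff (monomial_sym \<nu>) m = (if exponents m = \<nu> then 1 else 0)"
  by (simp add: monomial_sym.rep_eq)

lemma m_expansion:
  assumes "finite A" "A \<subseteq> partitions" "\<And>m. mcoeff f m \<noteq> 0 \<Longrightarrow> exponents m \<in> A"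
  shows "f = (\<Sum>\<mu>\<in>A. mcoeff f (mono_of \<mu>) *\<^sub>R monomial_sym \<mu>)"
proof (rule symfun_eqI)
  fix m
  have "mcoeff (\<Sum>\<mu>\<in>A. mcoeff f (mono_of \<mu>) *\<^sub>R monomial_sym \<mu>) m =
      (\<Sum>\<mu>\<in>A. if \<mu> = exponents m then mcoeff f (mono_of (exponents m)) else 0)"
    unfolding mcoeff_sum mcoeff_scaleR mcoeff_monomial_sym by (intro sum.cong) auto
  also have "\<dots> = mcoeff f m"
    using assms(1) assms(3)[of m] mcoeff_cong_exponents[of "mono_of (exponents m)" m f] by auto
  finally show "mcoeff f m = mcoeff (\<Sum>\<mu>\<in>A. mcoeff f (mono_of \<mu>) *\<^sub>R monomial_sym \<mu>) m" ..
qed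

lemma span_monomial_sym_iff:
  assumes "finite A" "A \<subseteq> partitions"
  shows "f \<in> span (monomial_sym ` A) \<longleftrightarrow> (\<forall>m. mcoeff f m \<noteq> 0 \<longrightarrow> exponents m \<in> A)"
proof
  assume "f \<in> span (monomial_sym ` A)"
  then show "\<forall>m. mcoeff f m \<noteq> 0 \<longrightarrow> exponents m \<in> A"
  proof (rule span_induct)
    have "{f. \<forall>m. mcoeff f m \<noteq> 0 \<longrightarrow> exponents m \<in> A} = {f. \<forall>m. exponents m \<notin> A \<longrightarrow> mcoeff f m = 0}"
      by blast
    also have "subspace \<dots>" by (auto simp: subspace_def)
    finally show "subspace {f. \<forall>m. mcoeff f m \<noteq> 0 \<longrightarrow> exponents m \<in> A}" .
  qed (auto simp: mcoeff_monomial_sym split: if_splits)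
next
  assume "\<forall>m. mcoeff f m \<noteq> 0 \<longrightarrow> exponents m \<in> A"
  then have "f = (\<Sum>\<mu>\<in>A. mcoeff f (mono_of \<mu>) *\<^sub>R monomial_sym \<mu>)"
    by (intro m_expansion assms) auto
  also have "\<dots> \<in> span (monomial_sym ` A)" by (intro span_sum span_scale span_base) auto
  finally show "f \<in> span (monomial_sym ` A)" .
qed

lemma supportedD: "supported \<nu> f \<Longrightarrow> \<not> dominated (exponents m) \<nu> \<Longrightarrow> mcoeff f m = 0"
  unfolding supported_def by blast

definition strictly_supported :: "nat multiset \<Rightarrow> symfun \<Rightarrow> bool" where
  "strictly_supported \<nu> f \<longleftrightarrow> (\<forall>m. mcoeff f m \<noteq> 0 \<longrightarrow> dominated (exponents m) \<nu> \<and> exponents m \<noteq> \<nu>)"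

lemma strictly_supported_imp: "strictly_supported \<nu> f \<Longrightarrow> supported \<nu> f"
  by (auto simp: strictly_supported_def supported_def)

lemma finite_dominated: "finite {\<mu> \<in> partitions. dominated \<mu> \<nu>}"
  by (rule finite_subset[OF _ finite_partitions_eq[of "sum_mset \<nu>"]]) (auto dest: dominated_sum)

lemma span_dominated_iff:
  "f \<in> span (monomial_sym ` {\<mu> \<in> partitions. dominated \<mu> \<nu>}) \<longleftrightarrow> supported \<nu> f"
  by (subst span_monomial_sym_iff[OF finite_dominated]) (auto simp: supported_def)

lemma span_strictly_dominated_iff:
  "f \<in> span (monomial_sym ` {\<mu> \<in> partitions. dominated \<mu> \<nu> \<and> \<mu> \<noteq> \<nu>}) \<longleftrightarrow> strictly_supported \<nu> f"
proof -
  have "finite {\<mu> \<in> partitions. dominated \<mu> \<nu> \<and> \<mu> \<noteq> \<nu>}"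
    by (rule finite_subset[OF _ finite_dominated[of \<nu>]]) auto
  then show ?thesis by (subst span_monomial_sym_iff) (auto simp: strictly_supported_def)
qed

section \<open>Gram-Schmidt and joint eigenvectors\<close>

lemma ex_jack_form_projection:
  assumes "finite B" "\<alpha> > 0"
  shows "\<exists>x\<in>span B. \<forall>y\<in>span B. jack_form \<alpha> (v - x) y = 0"
  using assms(1)
proof (induction B arbitrary: v rule: finite_induct)
  case empty
  then show ?case by (auto simp: jack_form_simps)
next
  case (insert b B)
  obtain pb where pb: "pb \<in> span B" "\<And>y. y \<in> span B \<Longrightarrow> jack_form \<alpha> (b - pb) y = 0"
    using insert.IH[of b] by blast
  obtain x0 where x0: "x0 \<in> span B" "\<And>y. y \<in> span B \<Longrightarrow> jack_form \<alpha> (v - x0) y = 0"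
    using insert.IH[of v] by blast
  define b' where "b' = b - pb"
  \<comment> \<open>When b' = 0 the quotient is 0 by the convention for division by zero, and the
    equation below still holds.\<close>
  define c where "c = jack_form \<alpha> (v - x0) b' / jack_form \<alpha> b' b'"
  have c: "c * jack_form \<alpha> b' b' = jack_form \<alpha> (v - x0) b'"
    using jack_form_pos[OF assms(2), of b'] by (cases "b' = 0") (auto simp: c_def jack_form_simps)
  have sub: "span B \<subseteq> span (insert b B)" by (intro span_mono) auto
  have "b' \<in> span (insert b B)" unfolding b'_def
    using span_diff[OF span_base[of b "insert b B"], of pb] sub pb(1) by auto
  then have "x0 + c *\<^sub>R b' \<in> span (insert b B)"
    using sub x0(1) by (intro span_add span_scale) auto
  moreover have "jack_form \<alpha> (v - (x0 + c *\<^sub>R b')) y = 0" if "y \<in> span (insert b B)" for y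
  proof -
    obtain k where k: "y - k *\<^sub>R b \<in> span B" using \<open>y \<in> span (insert b B)\<close> by (auto simp: span_breakdown_eq)
    define w where "w = (y - k *\<^sub>R b) + k *\<^sub>R pb"
    have w: "w \<in> span B" unfolding w_def by (intro span_add k span_scale pb(1))
    have y: "y = k *\<^sub>R b' + w" by (simp add: w_def b'_def algebra_simps)
    have "jack_form \<alpha> (v - (x0 + c *\<^sub>R b')) z = jack_form \<alpha> (v - x0) z - c * jack_form \<alpha> b' z" for z
      by (simp add: jack_form_simps)
    then show ?thesis using x0(2)[OF w] pb(2)[OF w] c
      by (simp add: y jack_form_simps b'_def[symmetric])
  qed
  ultimately show ?case by blast
qed

text \<open>Orthogonality is only required against lower monomials, so that existence is a Gram--Schmidt step. Orthogonality
  for incomparable partitions then follows from \<open>jack_monic_eigen\<close> and the separation of eigenvalues.\<close>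

definition jack_monic :: "real \<Rightarrow> nat multiset \<Rightarrow> symfun \<Rightarrow> bool" where
  "jack_monic \<alpha> \<nu> f \<longleftrightarrow> supported \<nu> f \<and> mcoeff f (mono_of \<nu>) = 1 \<and>
     (\<forall>g. strictly_supported \<nu> g \<longrightarrow> jack_form \<alpha> f g = 0)"

lemma ex_jack_monic:
  assumes "\<alpha> > 0" "\<nu> \<in> partitions"
  shows "\<exists>f. jack_monic \<alpha> \<nu> f"
proof -
  let ?B = "monomial_sym ` {\<mu> \<in> partitions. dominated \<mu> \<nu> \<and> \<mu> \<noteq> \<nu>}"
  have "finite ?B" by (rule finite_subset[OF _ finite_imageI[OF finite_dominated[of \<nu>]]]) auto
  then obtain x where x: "x \<in> span ?B" "\<And>y. y \<in> span ?B \<Longrightarrow> jack_form \<alpha> (monomial_sym \<nu> - x) y = 0"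
    using ex_jack_form_projection[OF _ assms(1)] by blast
  have sx: "strictly_supported \<nu> x" using x(1) by (simp add: span_strictly_dominated_iff)
  have "supported \<nu> (monomial_sym \<nu> - x)"
    using sx by (fastforce simp: supported_def strictly_supported_def mcoeff_monomial_sym split: if_splits)
  moreover have "mcoeff (monomial_sym \<nu> - x) (mono_of \<nu>) = 1"
    using sx assms(2) by (auto simp: strictly_supported_def mcoeff_monomial_sym)
  ultimately show ?thesis using x(2) unfolding jack_monic_def span_strictly_dominated_iff by blast
qed

lemma jack_monic_top: "jack_monic \<alpha> \<nu> f \<Longrightarrow> exponents m = \<nu> \<Longrightarrow> mcoeff f m = 1"
  using mcoeff_cong_exponents[of m "mono_of \<nu>" f] by (auto simp: jack_monic_def)

lemma jack_monic_supported: "jack_monic \<alpha> \<nu> f \<Longrightarrow> supported \<nu> f"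
  by (simp add: jack_monic_def)

text \<open>The difference h of both sides has no top coefficient, and neither has its image under
  \<open>ham\<close>. By self-adjointness the norm of h pairs f only with functions strictly below
  \<nu>, so it vanishes.\<close>

lemma jack_monic_eigen:
  assumes \<alpha>: "\<alpha> > 0" and f: "jack_monic \<alpha> \<nu> f" and m: "exponents m = \<nu>" and N: "sum_mset \<nu> \<le> N"
  shows "ham \<alpha> N k f = top_eigenvalue \<alpha> k m *\<^sub>R f"
proof -
  define h where "h = ham \<alpha> N k f - top_eigenvalue \<alpha> k m *\<^sub>R f"
  have sf: "supported \<nu> f" by (rule jack_monic_supported[OF f])
  have szm: "size m \<le> N" using m N by auto
  have h: "strictly_supported \<nu> h"
    unfolding strictly_supported_def
  proof (intro allI impI conjI)
    fix m' assume m': "mcoeff h m' \<noteq> 0"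
    show "dominated (exponents m') \<nu>"
    proof (rule ccontr)
      assume nd: "\<not> dominated (exponents m') \<nu>"
      show False using m' supportedD[OF sf nd] supportedD[OF supported_ham[OF sf N] nd, of \<alpha> k]
        by (simp add: h_def)
    qed
    show "exponents m' \<noteq> \<nu>"
    proof
      assume "exponents m' = \<nu>"
      then have "mcoeff h m' = mcoeff h m" using m by (intro mcoeff_cong_exponents) simp
      also have "\<dots> = 0" using ham_top[of m f N \<alpha> k] sf m szm by (simp add: h_def)
      finally show False using m' by simp
    qed
  qed
  have sh: "strictly_supported \<nu> (ham \<alpha> N k h)"
    unfolding strictly_supported_def
  proof (intro allI impI conjI)
    fix m' assume m': "mcoeff (ham \<alpha> N k h) m' \<noteq> 0"
    show "dominated (exponents m') \<nu>"
      using m' supportedD[OF supported_ham[OF strictly_supported_imp[OF h] N, of \<alpha> k], of m'] by auto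
    show "exponents m' \<noteq> \<nu>"
    proof
      assume e: "exponents m' = \<nu>"
      then have "size m' \<le> N" using N by auto
      then have "mcoeff (ham \<alpha> N k h) m' = top_eigenvalue \<alpha> k m' * mcoeff h m'"
        using strictly_supported_imp[OF h] e by (intro ham_top) auto
      also have "mcoeff h m' = 0" using h e by (auto simp: strictly_supported_def)
      finally show False using m' by simp
    qed
  qed
  have orth: "\<And>g. strictly_supported \<nu> g \<Longrightarrow> jack_form \<alpha> f g = 0" using f by (auto simp: jack_monic_def)
  have "jack_form \<alpha> h y = jack_form \<alpha> (ham \<alpha> N k f) y - top_eigenvalue \<alpha> k m * jack_form \<alpha> f y" for y
    unfolding h_def by (simp add: jack_form_simps)
  from this[of h] have "jack_form \<alpha> h h = jack_form \<alpha> (ham \<alpha> N k f) h - top_eigenvalue \<alpha> k m * jack_form \<alpha> f h" .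
  also have "\<dots> = 0" by (simp add: ham_selfadjoint orth[OF h] orth[OF sh])
  finally have "h = 0" using jack_form_pos[OF \<alpha>, of h] by fastforce
  then show ?thesis by (simp add: h_def)
qed

lemma jack_form_homogeneous:
  assumes "homogeneous n f" "homogeneous n' g" "n \<noteq> n'"
  shows "jack_form \<alpha> f g = 0"
  unfolding jack_form_def
  using homogeneous_p_coeff[OF assms(1)] homogeneous_p_coeff[OF assms(2)] assms(3)
  by (intro sum.neutral) auto

text \<open>Within one degree, f and g are eigenvectors of a self-adjoint moment with different
  eigenvalues; which moment works depends on the pair. Different degrees are orthogonal
  anyway.\<close>

lemma jack_monic_orthogonal:
  assumes \<alpha>: "\<alpha> > 0" and f: "jack_monic \<alpha> \<nu> f" and g: "jack_monic \<alpha> \<mu> g"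
    and part: "\<nu> \<in> partitions" "\<mu> \<in> partitions" "\<nu> \<noteq> \<mu>"
  shows "jack_form \<alpha> f g = 0"
proof (cases "sum_mset \<nu> = sum_mset \<mu>")
  case False
  then show ?thesis
    using supported_homogeneous[OF jack_monic_supported[OF f]]
      supported_homogeneous[OF jack_monic_supported[OF g]] by (intro jack_form_homogeneous)
next
  case True
  obtain m l where m: "exponents m = \<nu>" "set_mset m = {..<l}" "\<And>i j. i \<le> j \<Longrightarrow> count m j \<le> count m i"
    using ex_decreasing_monomial[OF part(1)] by blast
  obtain m' l' where m': "exponents m' = \<mu>" "set_mset m' = {..<l'}" "\<And>i j. i \<le> j \<Longrightarrow> count m' j \<le> count m' i"
    using ex_decreasing_monomial[OF part(2)] by blast
  have "\<exists>k. top_eigenvalue \<alpha> k m \<noteq> top_eigenvalue \<alpha> k m'"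
    using top_eigenvalue_separates[OF \<alpha> m(2,3) m'(2,3)] m(1) m'(1) part(3) by blast
  then obtain k where k: "top_eigenvalue \<alpha> k m \<noteq> top_eigenvalue \<alpha> k m'" by blast
  have "top_eigenvalue \<alpha> k m * jack_form \<alpha> f g = jack_form \<alpha> (ham \<alpha> (sum_mset \<nu>) k f) g"
    unfolding jack_monic_eigen[OF \<alpha> f m(1) order.refl] by (simp add: jack_form_simps)
  also have "\<dots> = jack_form \<alpha> f (ham \<alpha> (sum_mset \<nu>) k g)" by (rule ham_selfadjoint)
  also have "\<dots> = top_eigenvalue \<alpha> k m' * jack_form \<alpha> f g"
    using True by (subst jack_monic_eigen[OF \<alpha> g m'(1)]) (auto simp: jack_form_simps)
  finally show ?thesis using k by simp
qed

section \<open>The Laplace-Beltrami recurrence\<close>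

text \<open>For decreasing parts \<open>minsum\<close> is \<Sum> (2i - 1) \<nu>_i. The value is thus
  \<alpha> \<Sum> \<nu>_i^2 - 2 \<Sum> (i - 1) \<nu>_i = 2 (\<alpha> n(\<nu>') - n(\<nu>)) +
  \<alpha> |\<nu>|, with \<nu>' the conjugate partition.\<close>

definition jack_eigenvalue :: "real \<Rightarrow> nat multiset \<Rightarrow> real" where
  "jack_eigenvalue \<alpha> \<nu> = \<alpha> * real (sqsum \<nu>) - minsum \<nu> + real (sum_mset \<nu>)"

text \<open>The off-diagonal part of the operator; the weight is the gap between the two exponents
  after the move, hence positive and free of \<alpha>.\<close>

definition raise_sum :: "(nat multiset \<Rightarrow> real) \<Rightarrow> nat multiset \<Rightarrow> real" where
  "raise_sum F m = (\<Sum>i\<in>set_mset m. \<Sum>j\<in>set_mset m - {i}. \<Sum>s=1..min (count m i) (count m j).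
     (real (max (count m i) (count m j)) - real (min (count m i) (count m j)) + 2 * real s) *
       F (upd2 m i j (max (count m i) (count m j) + s) (min (count m i) (count m j) - s)))"

text \<open>The added moves carry the larger new exponent M + s as weight, the subtracted ones the
  smaller mm - s, so their difference is the gap. The unmatched term s = 0 gives the diagonal
  contribution -min.\<close>

lemma mcoeff_ham_one:
  assumes N: "size m \<le> N"
  shows "mcoeff (ham \<alpha> N 1 f) m =
    \<alpha> * (jack_eigenvalue \<alpha> (exponents m) * mcoeff f m + raise_sum (mcoeff f) m)"
proof -
  let ?M = "\<lambda>i j. max (count m i) (count m j)" and ?m = "\<lambda>i j. min (count m i) (count m j)"
  let ?F = "\<lambda>i j s. mcoeff f (upd2 m i j (?M i j + s) (?m i j - s))"
  let ?R = "\<lambda>i j. \<Sum>s=1..?m i j. (real (?M i j) - real (?m i j) + 2 * real s) * ?F i j s"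
  have phi1: "lax_series \<alpha> N f 1 i m = \<alpha> * (\<alpha> * (real (count m i))\<^sup>2 * mcoeff f m +
      (\<Sum>j\<in>set_mset m - {i}. ?R i j - real (?m i j) * mcoeff f m))" if i: "i \<in># m" for i
  proof -
    have "(\<Sum>s=1..?m i j. lax_series \<alpha> N f 0 i (upd2 m i j (?M i j + s) (?m i j - s))) -
        (\<Sum>s<?m i j. lax_series \<alpha> N f 0 i (upd2 m i j (?m i j - s) (?M i j + s))) =
        \<alpha> * (?R i j - real (?m i j) * mcoeff f m)" if j: "j \<in> set_mset m - {i}" for j
    proof -
      have ij: "i \<noteq> j" using j by auto
      have sz: "size (upd2 m i j x y) \<le> N" if "x + y = count m i + count m j" for x y
        using size_upd2[OF ij that] N by simp
      have 1: "(\<Sum>s=1..?m i j. lax_series \<alpha> N f 0 i (upd2 m i j (?M i j + s) (?m i j - s))) =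
          (\<Sum>s=1..?m i j. \<alpha> * real (?M i j + s) * ?F i j s)"
        by (intro sum.cong refl, subst lax_series_0) (auto intro!: sz simp: count_upd2[OF ij])
      have "(\<Sum>s<?m i j. lax_series \<alpha> N f 0 i (upd2 m i j (?m i j - s) (?M i j + s))) =
          (\<Sum>s<?m i j. \<alpha> * real (?m i j - s) * ?F i j s)"
        by (intro sum.cong refl, subst lax_series_0)
           (auto intro!: sz simp: count_upd2[OF ij] mcoeff_upd2_swap[OF ij, of f m "?m i j - _"])
      also have "\<dots> = (\<Sum>s=0..?m i j. \<alpha> * real (?m i j - s) * ?F i j s)"
        by (rule sum.mono_neutral_left) auto
      also have "\<dots> = \<alpha> * real (?m i j) * ?F i j 0 + (\<Sum>s=1..?m i j. \<alpha> * real (?m i j - s) * ?F i j s)"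
        by (simp add: sum.atLeast_Suc_atMost)
      also have "?F i j 0 = mcoeff f m"
      proof (cases "count m i \<le> count m j")
        case True
        then show ?thesis
          using mcoeff_upd2_swap[OF ij, of f m "count m i" "count m j"] by (simp add: upd2_id[OF ij] max_absorb2 min_absorb1)
      next
        case False
        then show ?thesis by (simp add: upd2_id[OF ij] max_absorb1 min_absorb2)
      qed
      finally have 2: "(\<Sum>s<?m i j. lax_series \<alpha> N f 0 i (upd2 m i j (?m i j - s) (?M i j + s))) =
          \<alpha> * real (?m i j) * mcoeff f m + (\<Sum>s=1..?m i j. \<alpha> * real (?m i j - s) * ?F i j s)" .
      have "(\<Sum>s=1..?m i j. \<alpha> * real (?M i j + s) * ?F i j s) - (\<Sum>s=1..?m i j. \<alpha> * real (?m i j - s) * ?F i j s)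
          = \<alpha> * ?R i j"
        unfolding sum_subtractf[symmetric] sum_distrib_left
        by (intro sum.cong refl) (auto simp: of_nat_diff algebra_simps)
      then show ?thesis unfolding 1 2 by (simp add: algebra_simps)
    qed
    then have "lax_series \<alpha> N f 1 i m = \<alpha> * real (count m i) * lax_series \<alpha> N f 0 i m +
        (\<Sum>j\<in>set_mset m - {i}. \<alpha> * (?R i j - real (?m i j) * mcoeff f m))"
      unfolding One_nat_def lax_series_Suc[OF i N] by (intro arg_cong2[where f = "(+)"] refl sum.cong)
    then show ?thesis
      by (simp add: lax_series_0[OF N] power2_eq_square distrib_left mult_ac flip: sum_distrib_left)
  qed
  have "mcoeff (ham \<alpha> N 1 f) m = \<alpha> * ((\<Sum>i\<in>set_mset m. \<alpha> * (real (count m i))\<^sup>2) * mcoeff f m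
      + raise_sum (mcoeff f) m
      - (\<Sum>i\<in>set_mset m. \<Sum>j\<in>set_mset m - {i}. real (?m i j)) * mcoeff f m)"
  proof -
    have gen: "(\<Sum>i\<in>S. a * (A i * F + (\<Sum>j\<in>S - {i}. R i j - B i j * F))) =
        a * ((\<Sum>i\<in>S. A i) * F + (\<Sum>i\<in>S. \<Sum>j\<in>S - {i}. R i j) - (\<Sum>i\<in>S. \<Sum>j\<in>S - {i}. B i j) * F)"
      for S :: "nat set" and a F :: real and A and R B
      by (simp add: sum_subtractf sum.distrib sum_distrib_left sum_distrib_right algebra_simps)
    have "mcoeff (ham \<alpha> N 1 f) m = (\<Sum>i\<in>set_mset m. \<alpha> * (\<alpha> * (real (count m i))\<^sup>2 * mcoeff f m +
      (\<Sum>j\<in>set_mset m - {i}. ?R i j - real (?m i j) * mcoeff f m)))"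
      unfolding mcoeff_ham by (intro sum.cong refl phi1)
    then show ?thesis unfolding gen raise_sum_def .
  qed
  also have "(\<Sum>i\<in>set_mset m. \<alpha> * (real (count m i))\<^sup>2) = \<alpha> * real (sqsum (exponents m))"
    by (simp add: sqsum_def sum_exponents power2_eq_square sum_distrib_left)
  also have "(\<Sum>i\<in>set_mset m. \<Sum>j\<in>set_mset m - {i}. real (?m i j)) = minsum (exponents m) - real (size m)"
  proof -
    have "(\<Sum>i\<in>set_mset m. \<Sum>j\<in>set_mset m. real (?m i j)) =
        (\<Sum>i\<in>set_mset m. real (count m i) + (\<Sum>j\<in>set_mset m - {i}. real (?m i j)))"
      by (intro sum.cong refl) (subst sum.remove, auto)
    also have "\<dots> = real (size m) + (\<Sum>i\<in>set_mset m. \<Sum>j\<in>set_mset m - {i}. real (?m i j))"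
      by (simp add: sum.distrib size_multiset_overloaded_eq)
    finally show ?thesis unfolding minsum_exponents by simp
  qed
  finally show ?thesis by (simp add: jack_eigenvalue_def algebra_simps)
qed

text \<open>Both terms help: \<open>sqsum\<close> grows strictly and \<open>minsum\<close> does not
  grow, so there is no coincidence of eigenvalues along dominance for any \<alpha> > 0.\<close>

lemma jack_eigenvalue_gap:
  assumes "dominated \<mu> \<nu>" "\<mu> \<noteq> \<nu>" "\<mu> \<in> partitions" "\<nu> \<in> partitions" "\<alpha> > 0"
  shows "jack_eigenvalue \<alpha> \<mu> < jack_eigenvalue \<alpha> \<nu>"
proof -
  have "\<alpha> * real (sqsum \<mu>) < \<alpha> * real (sqsum \<nu>)"
    using sqsum_strict_mono[OF assms(1-4)] assms(5) by simp
  then show ?thesis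
    using minsum_antimono[OF assms(1)] dominated_sum[OF assms(1)] by (simp add: jack_eigenvalue_def)
qed

lemma raise_sum_nonneg:
  "(\<And>i j s. i \<in># m \<Longrightarrow> j \<in># m \<Longrightarrow> i \<noteq> j \<Longrightarrow> 1 \<le> s \<Longrightarrow> s \<le> min (count m i) (count m j) \<Longrightarrow>
     F (upd2 m i j (max (count m i) (count m j) + s) (min (count m i) (count m j) - s)) \<ge> 0) \<Longrightarrow>
    raise_sum F m \<ge> 0"
  unfolding raise_sum_def by (intro sum_nonneg mult_nonneg_nonneg) auto

text \<open>This is the coefficient at \<open>m\<close> of the eigenvalue equation. The eigenvalue
  is identified at type \<nu>, where every raised monomial lies outside the support.\<close>

lemma jack_monic_recurrence:
  assumes \<alpha>: "\<alpha> > 0" and f: "jack_monic \<alpha> \<nu> f" and \<nu>: "\<nu> \<in> partitions" and m: "size m = sum_mset \<nu>"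
  shows "(jack_eigenvalue \<alpha> \<nu> - jack_eigenvalue \<alpha> (exponents m)) * mcoeff f m = raise_sum (mcoeff f) m"
proof -
  let ?n = "sum_mset \<nu>" and ?m0 = "mono_of \<nu>"
  have e0: "exponents ?m0 = \<nu>" using \<nu> by simp
  have eig: "ham \<alpha> ?n 1 f = top_eigenvalue \<alpha> 1 ?m0 *\<^sub>R f" by (rule jack_monic_eigen[OF \<alpha> f e0 order.refl])
  have "raise_sum (mcoeff f) ?m0 = 0"
    unfolding raise_sum_def
  proof (intro sum.neutral ballI)
    fix i j s assume *: "i \<in> set_mset ?m0" "j \<in> set_mset ?m0 - {i}" "s \<in> {1..min (count ?m0 i) (count ?m0 j)}"
    let ?u = "upd2 ?m0 i j (max (count ?m0 i) (count ?m0 j) + s) (min (count ?m0 i) (count ?m0 j) - s)"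
    have "sqsum \<nu> < sqsum (exponents ?u)" using sqsum_upd2(1)[of i j s ?m0] * e0 by auto
    moreover have "dominated \<nu> (exponents ?u)" using dominated_upd2(1)[of i j s ?m0] * e0 by auto
    ultimately have "\<not> dominated (exponents ?u) \<nu>"
      using dominated_antisym[of \<nu> "exponents ?u"] \<nu> by auto
    then have "mcoeff f ?u = 0" by (rule supportedD[OF jack_monic_supported[OF f]])
    then show "(real (max (count ?m0 i) (count ?m0 j)) - real (min (count ?m0 i) (count ?m0 j)) + 2 * real s) * mcoeff f ?u = 0"
      by simp
  qed
  then have "top_eigenvalue \<alpha> 1 ?m0 = \<alpha> * jack_eigenvalue \<alpha> \<nu>"
    using mcoeff_ham_one[of ?m0 ?n \<alpha> f] \<nu> jack_monic_top[OF f e0] eig by simp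
  then have "\<alpha> * (jack_eigenvalue \<alpha> \<nu> * mcoeff f m) =
      \<alpha> * (jack_eigenvalue \<alpha> (exponents m) * mcoeff f m + raise_sum (mcoeff f) m)"
    using mcoeff_ham_one[of m ?n \<alpha> f] m eig by simp
  then have "jack_eigenvalue \<alpha> \<nu> * mcoeff f m =
      jack_eigenvalue \<alpha> (exponents m) * mcoeff f m + raise_sum (mcoeff f) m"
    using \<alpha> by (simp only: mult_cancel_left) simp
  then show ?thesis by (simp add: left_diff_distrib)
qed

lemma jack_monic_nonneg:
  assumes \<alpha>: "\<alpha> > 0" and f: "jack_monic \<alpha> \<nu> f" and \<nu>: "\<nu> \<in> partitions"
  shows "mcoeff f m \<ge> 0"
\<comment> \<open>The truncated difference does decrease under raising, since below the top
  \<open>sqsum (exponents m)\<close> is strictly less than \<open>sqsum \<nu>\<close>.\<close>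
proof (induction "sqsum \<nu> - sqsum (exponents m)" arbitrary: m rule: less_induct)
  case less
  consider "exponents m = \<nu>" | "\<not> dominated (exponents m) \<nu>" | "dominated (exponents m) \<nu>" "exponents m \<noteq> \<nu>"
    by blast
  then show ?case
  proof cases
    case 1
    then show ?thesis using jack_monic_top[OF f] by simp
  next
    case 2
    then show ?thesis using supportedD[OF jack_monic_supported[OF f]] by simp
  next
    case 3
    have gap: "jack_eigenvalue \<alpha> (exponents m) < jack_eigenvalue \<alpha> \<nu>"
      by (rule jack_eigenvalue_gap[OF 3 exponents_partitions \<nu> \<alpha>])
    have "raise_sum (mcoeff f) m \<ge> 0"
    proof (rule raise_sum_nonneg)
      fix i j s assume *: "i \<in># m" "j \<in># m" "i \<noteq> j" "1 \<le> s" "s \<le> min (count m i) (count m j)"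
      let ?u = "upd2 m i j (max (count m i) (count m j) + s) (min (count m i) (count m j) - s)"
      have "sqsum (exponents m) < sqsum (exponents ?u)" using sqsum_upd2(1)[of i j s m] * by auto
      moreover have "sqsum (exponents m) < sqsum \<nu>" by (rule sqsum_strict_mono[OF 3 exponents_partitions \<nu>])
      ultimately show "mcoeff f ?u \<ge> 0" by (intro less) auto
    qed
    moreover have "size m = sum_mset \<nu>" using dominated_sum[OF 3(1)] by simp
    ultimately have "(jack_eigenvalue \<alpha> \<nu> - jack_eigenvalue \<alpha> (exponents m)) * mcoeff f m \<ge> 0"
      using jack_monic_recurrence[OF \<alpha> f \<nu>] by simp
    then show ?thesis using gap by (simp add: zero_le_mult_iff)
  qed
qed

section \<open>Positivity of the normalizing coefficient\<close>

lemma upd2_upd2: "i \<noteq> j \<Longrightarrow> upd2 (upd2 m i j x y) i j x' y' = upd2 m i j x' y'"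
  by (rule multiset_eqI) (simp add: count_upd2)

text \<open>By the recurrence the support of \<open>f\<close> is closed under splitting a part \<open>a \<ge> 2\<close> into \<open>a - 1\<close> and \<open>1\<close>.\<close>

lemma jack_monic_ex_squarefree:
  assumes \<alpha>: "\<alpha> > 0" and f: "jack_monic \<alpha> \<nu> f" and \<nu>: "\<nu> \<in> partitions"
  shows "\<exists>m. mcoeff f m > 0 \<and> size m = sum_mset \<nu> \<and> exponents m = replicate_mset (sum_mset \<nu>) 1"
proof -
  have hom: "size m = sum_mset \<nu>" if "mcoeff f m \<noteq> 0" for m
    using supported_homogeneous[OF jack_monic_supported[OF f]] that by (auto simp: homogeneous_def)
  have "mcoeff f (mono_of \<nu>) \<noteq> 0" using f by (simp add: jack_monic_def)
  then obtain m where m: "mcoeff f m \<noteq> 0" "\<And>m'. mcoeff f m' \<noteq> 0 \<Longrightarrow> sqsum (exponents m) \<le> sqsum (exponents m')"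
    using ex_has_least_nat[of "\<lambda>m. mcoeff f m \<noteq> 0" "mono_of \<nu>" "\<lambda>m. sqsum (exponents m)"] by auto
  have fm: "mcoeff f m > 0" using jack_monic_nonneg[OF \<alpha> f \<nu>, of m] m(1) by simp
  have one: "count m i = 1" if i: "i \<in># m" for i
  proof (rule ccontr)
    assume "count m i \<noteq> 1"
    moreover have "count m i \<noteq> 0" using i by auto
    ultimately have c: "count m i \<ge> 2" by linarith
    obtain j where j: "j \<notin># m" using ex_new_if_finite[OF infinite_UNIV_nat, of "set_mset m"] by auto
    then have ij: "i \<noteq> j" using i by auto
    have cj: "count m j = 0" using j by (simp add: not_in_iff)
    \<comment> \<open>One unit of the exponent of x_i is moved to a fresh variable x_j. The raising
      move with s = 1 leads back to \<open>m\<close>, so \<open>m\<close> occurs in the recurrence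
      at \<open>m'\<close>.\<close>
    define m' where "m' = upd2 m i j (count m i - 1) 1"
    have cm': "count m' i = count m i - 1" "count m' j = 1" using ij by (auto simp: m'_def count_upd2)
    have sz: "size m' = sum_mset \<nu>" unfolding m'_def using size_upd2[OF ij, of "count m i - 1" 1 m] cj c hom[OF m(1)] by simp
    have M: "max (count m' i) (count m' j) = count m i - 1" "min (count m' i) (count m' j) = 1" using cm' c by auto
    have restore: "upd2 m' i j (max (count m' i) (count m' j) + 1) (min (count m' i) (count m' j) - 1) = m"
      unfolding M unfolding m'_def upd2_upd2[OF ij] using c cj i upd2_id[OF ij, of m] by simp
    have sq: "sqsum (exponents m') < sqsum (exponents m)"
      using sqsum_upd2(1)[OF ij, of 1 m'] restore M by simp
    have "raise_sum (mcoeff f) m' > 0"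
    proof -
      let ?t = "\<lambda>i j s. (real (max (count m' i) (count m' j)) - real (min (count m' i) (count m' j)) + 2 * real s) *
        mcoeff f (upd2 m' i j (max (count m' i) (count m' j) + s) (min (count m' i) (count m' j) - s))"
      have nn: "?t i j s \<ge> 0" for i j s
        by (intro mult_nonneg_nonneg jack_monic_nonneg[OF \<alpha> f \<nu>]) auto
      have mem: "i \<in> set_mset m'" "j \<in> set_mset m' - {i}"
        using cm' c ij by (auto simp flip: count_greater_zero_iff)
      have "0 < ?t i j 1" unfolding restore using fm by (intro mult_pos_pos) auto
      also have "\<dots> \<le> (\<Sum>s=1..min (count m' i) (count m' j). ?t i j s)"
        using M by (intro member_le_sum nn) auto
      also have "\<dots> \<le> (\<Sum>j\<in>set_mset m' - {i}. \<Sum>s=1..min (count m' i) (count m' j). ?t i j s)"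
        using mem(2) by (intro member_le_sum[of j _ "\<lambda>j. \<Sum>s=1..min (count m' i) (count m' j). ?t i j s"] sum_nonneg nn) auto
      also have "\<dots> \<le> raise_sum (mcoeff f) m'"
        unfolding raise_sum_def using mem(1)
        by (intro member_le_sum[of i _ "\<lambda>i. \<Sum>j\<in>set_mset m' - {i}. \<Sum>s=1..min (count m' i) (count m' j). ?t i j s"]
            sum_nonneg nn) auto
      finally show ?thesis .
    qed
    then have "mcoeff f m' \<noteq> 0" using jack_monic_recurrence[OF \<alpha> f \<nu> sz] by auto
    then show False using m(2)[of m'] sq by simp
  qed
  have "image_mset (count m) (mset_set (set_mset m)) = image_mset (\<lambda>_. 1) (mset_set (set_mset m))"
    by (intro image_mset_cong) (simp add: one)
  then have "exponents m = replicate_mset (size (exponents m)) 1"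
    unfolding size_exponents by (simp add: exponents_def image_mset_const_eq)
  moreover have "size (exponents m) = sum_mset (exponents m)"
    by (subst (2) calculation) simp
  ultimately show ?thesis using fm hom[OF m(1)] by (intro exI[of _ m]) (simp del: sum_mset_exponents, simp)
qed

text \<open>Any other product of power sums of degree n has fewer than n factors, hence no monomial
  with n distinct variables.\<close>

lemma p_coeff_ones:
  assumes f: "homogeneous n f" and m: "exponents m = replicate_mset n 1"
  shows "mcoeff f m = p_coeff f (replicate_mset n 1) * mcoeff (power_prod (replicate_mset n 1)) m"
proof -
  let ?o = "replicate_mset n (1::nat)"
  have part: "?o \<in> partitions" using m exponents_partitions[of m] by simp
  have sz: "size m = n" using sum_mset_exponents[of m] m by simp
  have cardm: "card (set_mset m) = n" using size_exponents[of m] m by simp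
  let ?A = "{\<nu> \<in> partitions. p_coeff f \<nu> \<noteq> 0}"
  have "mcoeff f m = (\<Sum>\<nu>\<in>insert ?o ?A. p_coeff f \<nu> * mcoeff (power_prod \<nu>) m)"
    by (subst p_expansion_superset[of "insert ?o ?A" f]) (use part finite_p_coeff in auto)
  also have "\<dots> = (\<Sum>\<nu>\<in>{?o}. p_coeff f \<nu> * mcoeff (power_prod \<nu>) m)"
  proof (rule sum.mono_neutral_right)
    show "\<forall>\<nu>\<in>insert ?o ?A - {?o}. p_coeff f \<nu> * mcoeff (power_prod \<nu>) m = 0"
    proof (intro ballI, rule ccontr)
      fix \<nu> assume \<nu>: "\<nu> \<in> insert ?o ?A - {?o}" and nz: "p_coeff f \<nu> * mcoeff (power_prod \<nu>) m \<noteq> 0"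
      then have p: "\<nu> \<in> partitions" "mcoeff (power_prod \<nu>) m \<noteq> 0" by auto
      have "size \<nu> \<le> sum_mset \<nu>" using p(1) by (induction rule: partitions_induct) auto
      then have "size \<nu> \<le> n" using mcoeff_power_prod_size[OF p] sz by simp
      then have "exponents m = \<nu>" using mcoeff_power_prod_card[OF p] cardm by simp
      then show False using m \<nu> by simp
    qed
  qed (use finite_p_coeff in auto)
  finally show ?thesis by simp
qed

lemma jack_monic_p_coeff_pos:
  assumes \<alpha>: "\<alpha> > 0" and f: "jack_monic \<alpha> \<nu> f" and \<nu>: "\<nu> \<in> partitions"
  shows "p_coeff f (replicate_mset (sum_mset \<nu>) 1) > 0"
proof -
  obtain m where m: "mcoeff f m > 0" "exponents m = replicate_mset (sum_mset \<nu>) 1"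
    using jack_monic_ex_squarefree[OF assms] by blast
  have "mcoeff f m = p_coeff f (replicate_mset (sum_mset \<nu>) 1) * mcoeff (power_prod (replicate_mset (sum_mset \<nu>) 1)) m"
    by (rule p_coeff_ones[OF supported_homogeneous[OF jack_monic_supported[OF f]] m(2)])
  moreover have "mcoeff (power_prod (replicate_mset (sum_mset \<nu>) 1)) m > 0"
    using mcoeff_power_prod_exponents[of m] m(2) by simp
  ultimately show ?thesis using m(1) by (simp add: zero_less_mult_iff)
qed

section \<open>Existence and uniqueness of the Jack family\<close>

definition jack_P :: "real \<Rightarrow> nat multiset \<Rightarrow> symfun" where
  "jack_P \<alpha> \<nu> = (SOME f. jack_monic \<alpha> \<nu> f)"

lemma jack_P: "\<alpha> > 0 \<Longrightarrow> \<nu> \<in> partitions \<Longrightarrow> jack_monic \<alpha> \<nu> (jack_P \<alpha> \<nu>)"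
  unfolding jack_P_def by (rule someI_ex) (rule ex_jack_monic)

lemma span_jack_P:
  assumes \<alpha>: "\<alpha> > 0" and \<nu>: "\<nu> \<in> partitions"
  shows "supported \<nu> f \<Longrightarrow> f \<in> span (jack_P \<alpha> ` {\<mu> \<in> partitions. dominated \<mu> \<nu>})"
  using \<nu>
proof (induction "sqsum \<nu>" arbitrary: \<nu> f rule: less_induct)
  case less
  let ?S = "\<lambda>\<nu>. span (jack_P \<alpha> ` {\<mu> \<in> partitions. dominated \<mu> \<nu>})"
  define g where "g = f - mcoeff f (mono_of \<nu>) *\<^sub>R jack_P \<alpha> \<nu>"
  have P: "jack_monic \<alpha> \<nu> (jack_P \<alpha> \<nu>)" by (rule jack_P[OF \<alpha> less.prems(2)])
  have g: "strictly_supported \<nu> g"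
    unfolding strictly_supported_def
  proof (intro allI impI conjI)
    fix m assume m: "mcoeff g m \<noteq> 0"
    show "dominated (exponents m) \<nu>"
    proof (rule ccontr)
      assume nd: "\<not> dominated (exponents m) \<nu>"
      show False using m supportedD[OF less.prems(1) nd] supportedD[OF jack_monic_supported[OF P] nd]
        by (simp add: g_def)
    qed
    show "exponents m \<noteq> \<nu>"
    proof
      assume e: "exponents m = \<nu>"
      then have "mcoeff f m = mcoeff f (mono_of \<nu>)" using less.prems(2) by (intro mcoeff_cong_exponents) simp
      then show False using m jack_monic_top[OF P e] by (simp add: g_def)
    qed
  qed
  then have "g \<in> span (monomial_sym ` {\<mu> \<in> partitions. dominated \<mu> \<nu> \<and> \<mu> \<noteq> \<nu>})"
    by (simp add: span_strictly_dominated_iff)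
  also have "\<dots> \<subseteq> ?S \<nu>"
  proof (rule span_minimal)
    show "monomial_sym ` {\<mu> \<in> partitions. dominated \<mu> \<nu> \<and> \<mu> \<noteq> \<nu>} \<subseteq> ?S \<nu>"
    proof safe
      fix \<mu> assume \<mu>: "\<mu> \<in> partitions" "dominated \<mu> \<nu>" "\<mu> \<noteq> \<nu>"
      have "monomial_sym \<mu> \<in> ?S \<mu>"
        using sqsum_strict_mono[OF \<mu>(2,3,1) less.prems(2)] \<mu>(1)
        by (intro less.hyps) (auto simp: supported_def mcoeff_monomial_sym)
      moreover have "?S \<mu> \<subseteq> ?S \<nu>"
        by (intro span_mono image_mono) (use \<mu>(2) dominated_trans in blast)
      ultimately show "monomial_sym \<mu> \<in> ?S \<nu>" by blast
    qed
  qed simp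
  finally have "g \<in> ?S \<nu>" .
  moreover have "jack_P \<alpha> \<nu> \<in> ?S \<nu>" using less.prems(2) by (intro span_base) auto
  ultimately have "g + mcoeff f (mono_of \<nu>) *\<^sub>R jack_P \<alpha> \<nu> \<in> ?S \<nu>"
    by (intro span_add[OF _ span_scale])
  then show ?case by (simp add: g_def)
qed

lemma jack_family_exists:
  assumes \<alpha>: "\<alpha> > 0"
  shows "jack_family \<alpha> (\<lambda>\<nu>. (1 / p_coeff (jack_P \<alpha> \<nu>) (replicate_mset (sum_mset \<nu>) 1)) *\<^sub>R jack_P \<alpha> \<nu>)"
  unfolding jack_family_def
proof (intro conjI ballI impI)
  fix \<nu> \<mu> assume *: "\<nu> \<in> partitions" "\<mu> \<in> partitions" "\<nu> \<noteq> \<mu>"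
  show "jack_form \<alpha> ((1 / p_coeff (jack_P \<alpha> \<nu>) (replicate_mset (sum_mset \<nu>) 1)) *\<^sub>R jack_P \<alpha> \<nu>)
      ((1 / p_coeff (jack_P \<alpha> \<mu>) (replicate_mset (sum_mset \<mu>) 1)) *\<^sub>R jack_P \<alpha> \<mu>) = 0"
    using jack_monic_orthogonal[OF \<alpha> jack_P[OF \<alpha> *(1)] jack_P[OF \<alpha> *(2)] *] by (simp add: jack_form_simps)
next
  fix \<nu> assume *: "\<nu> \<in> partitions"
  show "(1 / p_coeff (jack_P \<alpha> \<nu>) (replicate_mset (sum_mset \<nu>) 1)) *\<^sub>R jack_P \<alpha> \<nu>
      \<in> span (monomial_sym ` {\<mu> \<in> partitions. dominated \<mu> \<nu>})"
    using jack_monic_supported[OF jack_P[OF \<alpha> *]] by (intro span_scale) (simp add: span_dominated_iff)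
  show "p_coeff ((1 / p_coeff (jack_P \<alpha> \<nu>) (replicate_mset (sum_mset \<nu>) 1)) *\<^sub>R jack_P \<alpha> \<nu>)
      (replicate_mset (sum_mset \<nu>) 1) = 1"
    using jack_monic_p_coeff_pos[OF \<alpha> jack_P[OF \<alpha> *] *] by (simp add: linear_scale[OF linear_p_coeff])
qed

text \<open>By induction the lower members are nonzero multiples of the monic functions, so J \<nu>
  is orthogonal to all of these. Removing its multiple of the monic function at \<nu> leaves an
  element of their span orthogonal to that span, which is 0; the normalization fixes the
  multiple.\<close>

lemma jack_family_unique:
  assumes \<alpha>: "\<alpha> > 0" and J: "jack_family \<alpha> J" and \<nu>: "\<nu> \<in> partitions"
  shows "J \<nu> = (1 / p_coeff (jack_P \<alpha> \<nu>) (replicate_mset (sum_mset \<nu>) 1)) *\<^sub>R jack_P \<alpha> \<nu>"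
  using \<nu>
proof (induction "sqsum \<nu>" arbitrary: \<nu> rule: less_induct)
  case less
  note \<nu> = \<open>\<nu> \<in> partitions\<close>
  let ?P = "jack_P \<alpha>" and ?c = "\<lambda>\<nu>. p_coeff (jack_P \<alpha> \<nu>) (replicate_mset (sum_mset \<nu>) 1)"
  have c: "?c \<mu> > 0" if "\<mu> \<in> partitions" for \<mu>
    by (rule jack_monic_p_coeff_pos[OF \<alpha> jack_P[OF \<alpha> that] that])
  have sup: "J \<nu> \<in> span (?P ` {\<mu> \<in> partitions. dominated \<mu> \<nu>})"
    using J \<nu> by (intro span_jack_P[OF \<alpha> \<nu>]) (auto simp: jack_family_def span_dominated_iff)
  have "{\<mu> \<in> partitions. dominated \<mu> \<nu>} = insert \<nu> {\<mu> \<in> partitions. dominated \<mu> \<nu> \<and> \<mu> \<noteq> \<nu>}"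
    using \<nu> by auto
  with sup obtain a where a: "J \<nu> - a *\<^sub>R ?P \<nu> \<in> span (?P ` {\<mu> \<in> partitions. dominated \<mu> \<nu> \<and> \<mu> \<noteq> \<nu>})"
    by (auto simp: span_breakdown_eq)
  let ?g = "J \<nu> - a *\<^sub>R ?P \<nu>"
  have "jack_form \<alpha> ?g h = 0" if "h \<in> span (?P ` {\<mu> \<in> partitions. dominated \<mu> \<nu> \<and> \<mu> \<noteq> \<nu>})" for h
    using that
  proof (rule span_induct)
    show "subspace {h. jack_form \<alpha> ?g h = 0}"
      by (auto simp: subspace_def jack_form_simps distrib_left)
    fix h assume "h \<in> ?P ` {\<mu> \<in> partitions. dominated \<mu> \<nu> \<and> \<mu> \<noteq> \<nu>}"
    then obtain \<mu> where \<mu>: "\<mu> \<in> partitions" "dominated \<mu> \<nu>" "\<mu> \<noteq> \<nu>" "h = ?P \<mu>" by auto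
    have "J \<mu> = (1 / ?c \<mu>) *\<^sub>R ?P \<mu>"
      by (rule less.hyps[OF sqsum_strict_mono[OF \<mu>(2,3,1) \<nu>] \<mu>(1)])
    then have "h = ?c \<mu> *\<^sub>R J \<mu>" using c[OF \<mu>(1)] \<mu>(4) by simp
    then have "jack_form \<alpha> (J \<nu>) h = 0"
      using J \<mu>(1,3) \<nu> by (auto simp: jack_family_def jack_form_simps)
    moreover have "jack_form \<alpha> (?P \<nu>) h = 0"
      unfolding \<mu>(4) using \<mu>(1,3) \<nu> by (intro jack_monic_orthogonal[OF \<alpha> jack_P jack_P] \<alpha>) auto
    ultimately show "jack_form \<alpha> ?g h = 0" by (simp add: jack_form_simps)
  qed
  from this[OF a] have "?g = 0" using jack_form_pos[OF \<alpha>, of ?g] by fastforce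
  then have Ja: "J \<nu> = a *\<^sub>R ?P \<nu>" by simp
  have "p_coeff (J \<nu>) (replicate_mset (sum_mset \<nu>) 1) = 1" using J \<nu> by (simp add: jack_family_def)
  then have "a * ?c \<nu> = 1" unfolding Ja by (simp add: linear_scale[OF linear_p_coeff])
  then show ?case using c[OF \<nu>] Ja by (simp add: field_simps)
qed

lemma jack_eq:
  assumes "\<alpha> > 0" "\<nu> \<in> partitions"
  shows "jack \<alpha> \<nu> = (1 / p_coeff (jack_P \<alpha> \<nu>) (replicate_mset (sum_mset \<nu>) 1)) *\<^sub>R jack_P \<alpha> \<nu>"
  unfolding jack_def
  using jack_family_exists[OF assms(1)] jack_family_unique[OF assms(1) _ assms(2)]
  by (intro the_equality) blast+

section \<open>Large \<alpha> and the reduction to monomial functions\<close>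

text \<open>Below the top, the raised coefficients converge by induction while the eigenvalue gap
  dividing them grows linearly in \<alpha>, with slope the difference of the \<open>sqsum\<close>
  values.\<close>

lemma tendsto_mcoeff_jack_P:
  assumes \<nu>: "\<nu> \<in> partitions"
  shows "((\<lambda>\<alpha>. mcoeff (jack_P \<alpha> \<nu>) m) \<longlongrightarrow> (if exponents m = \<nu> then 1 else 0)) at_top"
proof (induction "sqsum \<nu> - sqsum (exponents m)" arbitrary: m rule: less_induct)
  case less
  have ev: "\<forall>\<^sub>F \<alpha> in at_top. jack_monic \<alpha> \<nu> (jack_P \<alpha> \<nu>)"
    using eventually_gt_at_top[of 0] by eventually_elim (rule jack_P[OF _ \<nu>])
  consider "exponents m = \<nu>" | "\<not> dominated (exponents m) \<nu>" | "dominated (exponents m) \<nu>" "exponents m \<noteq> \<nu>"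
    by blast
  then show ?case
  proof cases
    case 1
    show ?thesis
      by (rule tendsto_eventually, use ev in eventually_elim) (simp add: 1 jack_monic_top)
  next
    case 2
    then have "exponents m \<noteq> \<nu>" by auto
    then show ?thesis
      by (intro tendsto_eventually, use ev in eventually_elim) (simp add: supportedD[OF jack_monic_supported 2])
  next
    case 3
    define d where "d \<alpha> = jack_eigenvalue \<alpha> \<nu> - jack_eigenvalue \<alpha> (exponents m)" for \<alpha>
    have sq: "sqsum (exponents m) < sqsum \<nu>" by (rule sqsum_strict_mono[OF 3 exponents_partitions \<nu>])
    let ?L = "raise_sum (\<lambda>u. if exponents u = \<nu> then 1 else 0) m"
    have "((\<lambda>\<alpha>. raise_sum (mcoeff (jack_P \<alpha> \<nu>)) m) \<longlongrightarrow> ?L) at_top"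
      unfolding raise_sum_def
    proof (intro tendsto_sum tendsto_mult tendsto_const)
      fix i j s assume *: "i \<in> set_mset m" "j \<in> set_mset m - {i}" "s \<in> {1..min (count m i) (count m j)}"
      let ?u = "upd2 m i j (max (count m i) (count m j) + s) (min (count m i) (count m j) - s)"
      have "sqsum (exponents m) < sqsum (exponents ?u)" using sqsum_upd2(1)[of i j s m] * by auto
      then show "((\<lambda>\<alpha>. mcoeff (jack_P \<alpha> \<nu>) ?u) \<longlongrightarrow> (if exponents ?u = \<nu> then 1 else 0)) at_top"
        using sq by (intro less) auto
    qed
    moreover have "filterlim d at_infinity at_top"
    proof -
      define A where "A = real (sqsum \<nu>) - real (sqsum (exponents m))"
      have "A > 0" using sq by (simp add: A_def)
      then have "filterlim (\<lambda>\<alpha>. - minsum \<nu> + minsum (exponents m) + A * \<alpha>) at_top at_top"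
        by (intro filterlim_tendsto_add_at_top[OF tendsto_const] filterlim_tendsto_pos_mult_at_top[OF tendsto_const] filterlim_ident)
      moreover have "d = (\<lambda>\<alpha>. - minsum \<nu> + minsum (exponents m) + A * \<alpha>)"
        using dominated_sum[OF 3(1)] by (simp add: d_def jack_eigenvalue_def A_def fun_eq_iff algebra_simps)
      ultimately show ?thesis by (simp add: filterlim_at_top_imp_at_infinity)
    qed
    ultimately have "((\<lambda>\<alpha>. raise_sum (mcoeff (jack_P \<alpha> \<nu>)) m / d \<alpha>) \<longlongrightarrow> 0) at_top"
      by (rule tendsto_divide_0)
    moreover have "\<forall>\<^sub>F \<alpha> in at_top. raise_sum (mcoeff (jack_P \<alpha> \<nu>)) m / d \<alpha> = mcoeff (jack_P \<alpha> \<nu>) m"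
      using eventually_gt_at_top[of 0]
    proof eventually_elim
      case (elim \<alpha>)
      have "d \<alpha> > 0" using jack_eigenvalue_gap[OF 3 exponents_partitions \<nu> elim] by (simp add: d_def)
      moreover have "d \<alpha> * mcoeff (jack_P \<alpha> \<nu>) m = raise_sum (mcoeff (jack_P \<alpha> \<nu>)) m"
        unfolding d_def using dominated_sum[OF 3(1)]
        by (intro jack_monic_recurrence[OF elim jack_P[OF elim \<nu>] \<nu>]) simp
      ultimately show ?case by (simp add: field_simps)
    qed
    ultimately show ?thesis using 3(2) by (simp add: Lim_transform_eventually)
  qed
qed

theorem totally_jack_positive_iff_monomial:
  assumes lin: "linear \<rho>"
  shows "totally_jack_positive \<rho> \<longleftrightarrow> (\<forall>\<nu>\<in>partitions. \<rho> (monomial_sym \<nu>) \<ge> 0)"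
proof -
  let ?A = "\<lambda>\<nu>. {\<mu> \<in> partitions. dominated \<mu> \<nu>}"
  have exp: "\<rho> (jack_P \<alpha> \<nu>) = (\<Sum>\<mu>\<in>?A \<nu>. mcoeff (jack_P \<alpha> \<nu>) (mono_of \<mu>) * \<rho> (monomial_sym \<mu>))"
    if "\<alpha> > 0" "\<nu> \<in> partitions" for \<alpha> \<nu>
  proof -
    have "jack_P \<alpha> \<nu> = (\<Sum>\<mu>\<in>?A \<nu>. mcoeff (jack_P \<alpha> \<nu>) (mono_of \<mu>) *\<^sub>R monomial_sym \<mu>)"
      using jack_monic_supported[OF jack_P[OF that]]
      by (intro m_expansion finite_dominated) (auto simp: supported_def)
    then have "\<rho> (jack_P \<alpha> \<nu>) = \<rho> (\<Sum>\<mu>\<in>?A \<nu>. mcoeff (jack_P \<alpha> \<nu>) (mono_of \<mu>) *\<^sub>R monomial_sym \<mu>)"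
      by simp
    then show ?thesis by (simp add: linear_sum[OF lin] linear_scale[OF lin])
  qed
  have pos: "\<rho> (jack \<alpha> \<nu>) \<ge> 0 \<longleftrightarrow> \<rho> (jack_P \<alpha> \<nu>) \<ge> 0" if "\<alpha> > 0" "\<nu> \<in> partitions" for \<alpha> \<nu>
    using jack_monic_p_coeff_pos[OF that(1) jack_P[OF that] that(2)]
    by (simp add: jack_eq[OF that] linear_scale[OF lin] zero_le_divide_iff)
  show ?thesis
  proof
    assume jp: "totally_jack_positive \<rho>"
    show "\<forall>\<nu>\<in>partitions. \<rho> (monomial_sym \<nu>) \<ge> 0"
    proof
      fix \<nu> assume \<nu>: "\<nu> \<in> partitions"
      have "((\<lambda>\<alpha>. \<Sum>\<mu>\<in>?A \<nu>. mcoeff (jack_P \<alpha> \<nu>) (mono_of \<mu>) * \<rho> (monomial_sym \<mu>)) \<longlongrightarrow>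
          (\<Sum>\<mu>\<in>?A \<nu>. (if exponents (mono_of \<mu>) = \<nu> then 1 else 0) * \<rho> (monomial_sym \<mu>))) at_top"
        by (intro tendsto_sum tendsto_mult tendsto_const tendsto_mcoeff_jack_P \<nu>)
      also have "(\<Sum>\<mu>\<in>?A \<nu>. (if exponents (mono_of \<mu>) = \<nu> then 1 else 0) * \<rho> (monomial_sym \<mu>)) =
          (\<Sum>\<mu>\<in>?A \<nu>. if \<mu> = \<nu> then \<rho> (monomial_sym \<nu>) else 0)"
        by (intro sum.cong) auto
      also have "\<dots> = \<rho> (monomial_sym \<nu>)" using \<nu> finite_dominated[of \<nu>] by simp
      finally have lim: "((\<lambda>\<alpha>. \<Sum>\<mu>\<in>?A \<nu>. mcoeff (jack_P \<alpha> \<nu>) (mono_of \<mu>) * \<rho> (monomial_sym \<mu>)) \<longlongrightarrow> \<rho> (monomial_sym \<nu>)) at_top" .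
      have "\<forall>\<^sub>F \<alpha> in at_top. (\<Sum>\<mu>\<in>?A \<nu>. mcoeff (jack_P \<alpha> \<nu>) (mono_of \<mu>) * \<rho> (monomial_sym \<mu>)) \<ge> 0"
        using eventually_gt_at_top[of 0]
      proof eventually_elim
        case (elim \<alpha>)
        have "\<rho> (jack \<alpha> \<nu>) \<ge> 0" using jp \<nu> elim by (auto simp: totally_jack_positive_def)
        then show ?case using pos[OF elim \<nu>] exp[OF elim \<nu>] by simp
      qed
      then show "\<rho> (monomial_sym \<nu>) \<ge> 0" using lim by (intro tendsto_lowerbound) auto
    qed
  next
    assume mp: "\<forall>\<nu>\<in>partitions. \<rho> (monomial_sym \<nu>) \<ge> 0"
    have "\<rho> (jack_P \<alpha> \<nu>) \<ge> 0" if "\<alpha> > 0" "\<nu> \<in> partitions" for \<alpha> \<nu>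
      unfolding exp[OF that] using mp
      by (intro sum_nonneg mult_nonneg_nonneg jack_monic_nonneg[OF that(1) jack_P[OF that] that(2)]) auto
    then show "totally_jack_positive \<rho>" using pos by (auto simp: totally_jack_positive_def)
  qed
qed

section \<open>Kingman's representation\<close>

text \<open>For \<open>k > x\<close> the truncated subtraction produces a factor \<open>0\<close>, as it should.\<close>

definition falling :: "nat \<Rightarrow> nat \<Rightarrow> real" where
  "falling x k = (\<Prod>i<k. real (x - i))"

lemma falling_nonneg: "falling x k \<ge> 0"
  by (simp add: falling_def prod_nonneg)

lemma falling_le_power: "falling x k \<le> real x ^ k"
proof -
  have "(\<Prod>i<k. real (x - i)) \<le> (\<Prod>i<k. real x)" by (rule prod_mono) auto
  then show ?thesis by (simp add: falling_def)
qed

lemma falling_eq_0: "x < k \<Longrightarrow> falling x k = 0"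
  by (auto simp: falling_def)

lemma falling_Suc: "falling x (Suc k) = falling x k * real (x - k)"
  by (simp add: falling_def)

lemma fact_ff: "k \<le> x \<Longrightarrow> fact (x - k) * falling x k = (fact x :: real)"
proof (induction k)
  case (Suc k)
  then have "fact (x - k) = real (x - k) * (fact (x - Suc k) :: real)"
    by (simp add: fact_reduce)
  then have "fact (x - Suc k) * falling x (Suc k) = fact (x - k) * falling x k" by (simp only: falling_Suc mult_ac)
  then show ?case using Suc by simp
qed (simp add: falling_def)

lemma falling_pos: "k \<le> x \<Longrightarrow> falling x k > 0"
  by (auto simp: falling_def intro!: prod_pos)

text \<open>The estimate \<Prod> (1 - i/x) >= 1 - k^2/x over i < k, multiplied by x^(k+1) so that no
  division occurs.\<close>

lemma falling_ge_aux: "real x ^ k * (real x - (real k)\<^sup>2) \<le> real x * falling x k"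
proof (induction k)
  case (Suc k)
  show ?case
  proof (cases "real x \<ge> (real k)\<^sup>2")
    case True
    have "real x ^ Suc k * (real x - (real (Suc k))\<^sup>2) \<le> real x ^ k * ((real x - (real k)\<^sup>2) * (real x - real k))"
    proof -
      have "real x * (real x - (real (Suc k))\<^sup>2) \<le> (real x - (real k)\<^sup>2) * (real x - real k)"
        by (simp add: power2_eq_square algebra_simps)
      then show ?thesis by (simp only: power_Suc2 mult.assoc mult_left_mono zero_le_power of_nat_0_le_iff)
    qed
    also have "\<dots> \<le> (real x ^ k * (real x - (real k)\<^sup>2)) * real (x - k)"
      unfolding mult.assoc[symmetric] using True by (intro mult_left_mono mult_nonneg_nonneg) auto
    also have "\<dots> \<le> (real x * falling x k) * real (x - k)"
      by (intro mult_right_mono Suc) auto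
    finally show ?thesis by (simp add: falling_def)
  next
    case False
    have "(real k)\<^sup>2 \<le> (real (Suc k))\<^sup>2" by (intro power_mono) auto
    then have "real x - (real (Suc k))\<^sup>2 \<le> 0" using False by linarith
    then have "real x ^ Suc k * (real x - (real (Suc k))\<^sup>2) \<le> 0"
      by (intro mult_nonneg_nonpos zero_le_power) simp_all
    also have "0 \<le> real x * falling x (Suc k)" by (intro mult_nonneg_nonneg falling_nonneg) auto
    finally show ?thesis .
  qed
qed (simp add: falling_def)

lemma falling_ge:
  assumes "k \<ge> 1"
  shows "real x ^ k - (real k)\<^sup>2 * real x ^ (k - 1) \<le> falling x k"
proof (cases "x = 0")
  case True
  then show ?thesis using falling_nonneg[of x k] assms by (cases "k = 1") (auto simp: power_0_left)
next
  case False
  have "real x ^ k = real x * real x ^ (k - 1)" using assms by (metis power_minus_mult mult.commute One_nat_def Suc_le_eq)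
  then have "real x * (real x ^ k - (real k)\<^sup>2 * real x ^ (k - 1)) = real x ^ k * (real x - (real k)\<^sup>2)"
    by (simp add: algebra_simps)
  also have "\<dots> \<le> real x * falling x k" by (rule falling_ge_aux)
  finally show ?thesis using False by simp
qed

text \<open>Bernoulli's inequality (1 - a/x)^k >= 1 - k a/x, multiplied by x^(k+1).\<close>

lemma power_diff_ge_aux:
  fixes x a :: real
  assumes "0 \<le> a" "a \<le> x"
  shows "x ^ k * (x - real k * a) \<le> x * (x - a) ^ k"
proof (induction k)
  case (Suc k)
  have "x ^ Suc k * (x - real (Suc k) * a) \<le> (x ^ k * (x - real k * a)) * (x - a)"
  proof -
    have "x * (x - real (Suc k) * a) \<le> (x - real k * a) * (x - a)"
      using assms by (simp add: algebra_simps)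
    then show ?thesis using assms by (simp only: power_Suc2 mult.assoc mult_left_mono zero_le_power)
  qed
  also have "\<dots> \<le> (x * (x - a) ^ k) * (x - a)" using assms by (intro mult_right_mono Suc) auto
  finally show ?case by (simp add: mult_ac)
qed simp

text \<open>One k^2 comes from Bernoulli's inequality with a = k, the other from replacing a power
  by a falling factorial.\<close>

lemma falling_shift_ge:
  assumes k: "k \<ge> 1" "k \<le> x"
  shows "falling x k - 2 * (real k)\<^sup>2 * real x ^ (k - 1) \<le> falling (x - k) k"
proof -
  have x: "real x > 0" using k by simp
  have xk: "real x ^ k = real x * real x ^ (k - 1)" using k by (metis power_minus_mult mult.commute One_nat_def Suc_le_eq)
  have "real x ^ k * (real x - real k * real k) \<le> real x * (real x - real k) ^ k"
    using k by (intro power_diff_ge_aux) auto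
  then have "real x * (real x ^ k - (real k)\<^sup>2 * real x ^ (k - 1)) \<le> real x * (real x - real k) ^ k"
    using xk by (simp add: algebra_simps power2_eq_square)
  then have 1: "real x ^ k - (real k)\<^sup>2 * real x ^ (k - 1) \<le> (real x - real k) ^ k"
    using x by simp
  have 2: "(real (x - k)) ^ (k - 1) \<le> real x ^ (k - 1)" by (intro power_mono) auto
  have "falling x k \<le> real x ^ k" by (rule falling_le_power)
  moreover have "real (x - k) ^ k - (real k)\<^sup>2 * real (x - k) ^ (k - 1) \<le> falling (x - k) k"
    by (rule falling_ge[OF k(1)])
  moreover have "(real k)\<^sup>2 * real (x - k) ^ (k - 1) \<le> (real k)\<^sup>2 * real x ^ (k - 1)"
    by (intro mult_left_mono 2) auto
  moreover have "real (x - k) = real x - real k" using k by simp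
  ultimately show ?thesis using 1 by simp
qed

section \<open>Coefficients of products with powers of p_1\<close>

text \<open>For a monomial of degree n, n! times this is the multinomial coefficient.\<close>

definition fact_weight :: "nat multiset \<Rightarrow> real" where
  "fact_weight m = (\<Prod>i\<in>set_mset m. 1 / fact (count m i))"

lemma fact_weight_superset:
  "finite S \<Longrightarrow> set_mset m \<subseteq> S \<Longrightarrow> fact_weight m = (\<Prod>i\<in>S. 1 / fact (count m i))"
  unfolding fact_weight_def by (rule prod.mono_neutral_left) (auto simp: not_in_iff)

lemma fact_weight_pos: "fact_weight m > 0"
  unfolding fact_weight_def by (intro prod_pos) auto

lemma fact_weight_diff:
  assumes "k \<le> count m i"
  shows "fact_weight (m - replicate_mset k i) = falling (count m i) k * fact_weight m"
proof -
  let ?S = "insert i (set_mset m)" and ?m = "m - replicate_mset k i"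
  have "set_mset ?m \<subseteq> ?S" by (auto dest: in_diffD)
  then have "fact_weight ?m = (\<Prod>j\<in>?S. 1 / fact (count ?m j))" by (intro fact_weight_superset) auto
  also have "\<dots> = 1 / fact (count ?m i) * (\<Prod>j\<in>?S - {i}. 1 / fact (count ?m j))"
    by (rule prod.remove) auto
  also have "(\<Prod>j\<in>?S - {i}. 1 / fact (count ?m j)) = (\<Prod>j\<in>?S - {i}. 1 / fact (count m j) :: real)"
    by (intro prod.cong) auto
  also have "1 / fact (count ?m i) = falling (count m i) k * (1 / fact (count m i))"
    using fact_ff[OF assms] by (simp add: field_simps)
  also have "\<dots> * (\<Prod>j\<in>?S - {i}. 1 / fact (count m j)) =
      falling (count m i) k * (1 / fact (count m i) * (\<Prod>j\<in>?S - {i}. 1 / fact (count m j)))" by simp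
  also have "1 / fact (count m i) * (\<Prod>j\<in>?S - {i}. 1 / fact (count m j)) = (\<Prod>j\<in>?S. 1 / fact (count m j) :: real)"
    by (rule prod.remove[symmetric]) auto
  also have "\<dots> = fact_weight m" by (intro fact_weight_superset[symmetric]) auto
  finally show ?thesis .
qed

lemma size_diff_replicate:
  assumes "k \<le> count m i"
  shows "size (m - replicate_mset k i) + k = size m"
proof -
  have "m - replicate_mset k i + replicate_mset k i = m"
    using assms by (simp add: count_le_replicate_mset_subset_eq)
  then show ?thesis by (metis size_replicate_mset size_union)
qed

definition falling_sum :: "nat \<Rightarrow> nat multiset \<Rightarrow> real" where
  "falling_sum k m = (\<Sum>i\<in>set_mset m. falling (count m i) k)"

text \<open>Removing x_i^k from a monomial multiplies its weight by a falling factorial of the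
  exponent. The shape with \<open>C\<close> and \<open>g\<close> is reproduced by the conclusion, so
  the lemma can be iterated, starting from g = 1 for powers of p_1.\<close>

lemma mcoeff_power_sum_mult_weighted:
  assumes "k > 0" and f: "\<And>m. mcoeff f m = (if size m = n then C * (fact_weight m * g m) else 0)"
  shows "mcoeff (power_sum k * f) m = (if size m = n + k then C * (fact_weight m *
     (\<Sum>i\<in>set_mset m. falling (count m i) k * g (m - replicate_mset k i))) else 0)"
proof -
  have "xmul i k (mcoeff f) m = (if size m = n + k then C * (fact_weight m * (falling (count m i) k * g (m - replicate_mset k i))) else 0)" for i
  proof (cases "k \<le> count m i")
    case True
    then show ?thesis using size_diff_replicate[OF True]
      by (auto simp: xmul_def f fact_weight_diff)
  next
    case False
    then show ?thesis by (simp add: xmul_def falling_eq_0)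
  qed
  then show ?thesis by (simp add: mcoeff_power_sum_mult[OF assms(1)] sum_distrib_left)
qed

lemma falling_1: "falling x 1 = real x"
  by (simp add: falling_def)

lemma mcoeff_power_sum_1_power:
  "mcoeff (power_sum 1 ^ n) m = (if size m = n then fact n * (fact_weight m * 1) else 0)"
proof (induction n arbitrary: m)
  case 0
  show ?case by (auto simp: mcoeff_one fact_weight_def)
next
  case (Suc n)
  have "mcoeff (power_sum 1 ^ Suc n) m = (if size m = n + 1 then fact n * (fact_weight m *
     (\<Sum>i\<in>set_mset m. falling (count m i) 1 * 1)) else 0)"
    unfolding power_Suc by (rule mcoeff_power_sum_mult_weighted[OF _ Suc.IH]) simp
  moreover have "(\<Sum>i\<in>set_mset m. falling (count m i) 1 * 1) = real (size m)"
    by (simp only: falling_1 size_multiset_overloaded_eq of_nat_sum mult_1_right)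
  ultimately show ?case by (simp add: algebra_simps)
qed

lemma mcoeff_power_sum_k:
  assumes "k > 0"
  shows "mcoeff (power_sum k * power_sum 1 ^ n) m =
    (if size m = n + k then fact n * (fact_weight m * falling_sum k m) else 0)"
  using mcoeff_power_sum_mult_weighted[OF assms mcoeff_power_sum_1_power[of n], of m] by (simp add: falling_sum_def)

lemma mcoeff_power_sum_kk:
  assumes "k > 0"
  shows "mcoeff (power_sum k * (power_sum k * power_sum 1 ^ n)) m =
    (if size m = n + 2 * k then fact n * (fact_weight m *
      (\<Sum>i\<in>set_mset m. falling (count m i) k * falling_sum k (m - replicate_mset k i))) else 0)"
  using mcoeff_power_sum_mult_weighted[OF assms mcoeff_power_sum_k[OF assms, of n], of m] by (simp add: mult_2)

lemma sum_count_power_le: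
  assumes "size m = n" "k \<ge> 1"
  shows "(\<Sum>i\<in>set_mset m. real (count m i) ^ k) \<le> real n ^ k"
proof -
  have k: "k = Suc (k - 1)" using assms(2) by simp
  have "(\<Sum>i\<in>set_mset m. real (count m i) ^ k) \<le> (\<Sum>i\<in>set_mset m. real (count m i) * real n ^ (k - 1))"
  proof (rule sum_mono)
    fix i
    have "real (count m i) ^ k = real (count m i) * real (count m i) ^ (k - 1)" by (subst k) simp
    also have "\<dots> \<le> real (count m i) * real n ^ (k - 1)"
      using count_le_size[of m i] assms(1) by (intro mult_left_mono power_mono) auto
    finally show "real (count m i) ^ k \<le> real (count m i) * real n ^ (k - 1)" .
  qed
  also have "\<dots> = real (size m) * real n ^ (k - 1)"
    by (simp add: size_multiset_overloaded_eq sum_distrib_right)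
  also have "\<dots> = real n ^ k" unfolding assms(1) by (metis k power_Suc)
  finally show ?thesis .
qed

lemma falling_sum_bounds:
  assumes "size m = n" "k \<ge> 2"
  shows "0 \<le> falling_sum k m" "falling_sum k m \<le> (\<Sum>i\<in>set_mset m. real (count m i) ^ k)" "falling_sum k m \<le> real n ^ k"
    "(\<Sum>i\<in>set_mset m. real (count m i) ^ k) - (real k)\<^sup>2 * real n ^ (k - 1) \<le> falling_sum k m"
proof -
  show "0 \<le> falling_sum k m" by (simp add: falling_sum_def sum_nonneg falling_nonneg)
  show le: "falling_sum k m \<le> (\<Sum>i\<in>set_mset m. real (count m i) ^ k)"
    unfolding falling_sum_def by (intro sum_mono falling_le_power)
  then show "falling_sum k m \<le> real n ^ k"
    using sum_count_power_le[OF assms(1), of k] assms(2) by simp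
  have "(\<Sum>i\<in>set_mset m. real (count m i) ^ k - (real k)\<^sup>2 * real (count m i) ^ (k - 1)) \<le> falling_sum k m"
    unfolding falling_sum_def by (intro sum_mono falling_ge) (use assms(2) in auto)
  moreover have "(real k)\<^sup>2 * (\<Sum>i\<in>set_mset m. real (count m i) ^ (k - 1)) \<le> (real k)\<^sup>2 * real n ^ (k - 1)"
    using sum_count_power_le[OF assms(1), of "k - 1"] assms(2) by (intro mult_left_mono) auto
  ultimately show "(\<Sum>i\<in>set_mset m. real (count m i) ^ k) - (real k)\<^sup>2 * real n ^ (k - 1) \<le> falling_sum k m"
    by (simp add: sum_subtractf sum_distrib_left)
qed

lemma falling_sum_diff_ge:
  assumes "size m = n" "k \<ge> 2" "k \<le> count m i"
  shows "falling_sum k m - 2 * (real k)\<^sup>2 * real n ^ (k - 1) \<le> falling_sum k (m - replicate_mset k i)"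
proof -
  let ?m = "m - replicate_mset k i"
  have i: "i \<in># m" using assms(2,3) by (metis count_greater_zero_iff le_trans not_numeral_le_zero not_gr_zero)
  have "falling_sum k ?m = (\<Sum>j\<in>set_mset m. falling (count ?m j) k)"
    unfolding falling_sum_def
  proof (rule sum.mono_neutral_left)
    show "\<forall>j\<in>set_mset m - set_mset ?m. falling (count ?m j) k = 0"
      using assms(2) by (auto simp: not_in_iff intro!: falling_eq_0 simp del: count_diff)
  qed (auto dest: in_diffD)
  also have "\<dots> = falling (count m i - k) k + (\<Sum>j\<in>set_mset m - {i}. falling (count m j) k)"
    using i by (subst sum.remove[of _ i]) (auto intro!: sum.cong)
  also have "\<dots> \<ge> (falling (count m i) k - 2 * (real k)\<^sup>2 * real (count m i) ^ (k - 1)) + (\<Sum>j\<in>set_mset m - {i}. falling (count m j) k)"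
    using assms by (intro add_right_mono falling_shift_ge) auto
  also have "(falling (count m i) k - 2 * (real k)\<^sup>2 * real (count m i) ^ (k - 1)) + (\<Sum>j\<in>set_mset m - {i}. falling (count m j) k)
     = falling_sum k m - 2 * (real k)\<^sup>2 * real (count m i) ^ (k - 1)"
    unfolding falling_sum_def using i by (subst (2) sum.remove[of _ i]) auto
  moreover have "2 * (real k)\<^sup>2 * real (count m i) ^ (k - 1) \<le> 2 * (real k)\<^sup>2 * real n ^ (k - 1)"
    using count_le_size[of m i] assms(1) by (intro mult_left_mono power_mono) auto
  ultimately show ?thesis by linarith
qed

text \<open>The coefficient of p_k^2 p_1^n is almost the square of the one factor sum. The loss
  arises when both factors p_k use the same variable, and it is of lower order in n.\<close>

lemma falling_sum_square_ge:
  assumes "size m = n" "k \<ge> 2"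
  shows "falling_sum k m * (falling_sum k m - 2 * (real k)\<^sup>2 * real n ^ (k - 1)) \<le>
    (\<Sum>i\<in>set_mset m. falling (count m i) k * falling_sum k (m - replicate_mset k i))"
proof -
  have "falling (count m i) k * (falling_sum k m - 2 * (real k)\<^sup>2 * real n ^ (k - 1)) \<le>
      falling (count m i) k * falling_sum k (m - replicate_mset k i)" for i
  proof (cases "k \<le> count m i")
    case True
    then show ?thesis by (intro mult_left_mono falling_sum_diff_ge assms falling_nonneg)
  next
    case False
    then show ?thesis by (simp add: falling_eq_0)
  qed
  then show ?thesis unfolding falling_sum_def[of k m] sum_distrib_right
    unfolding falling_sum_def[of k m, symmetric] by (intro sum_mono)
qed

lemma falling_ratio_tendsto: "(\<lambda>n. real n ^ k / falling n k) \<longlonglongrightarrow> 1"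
proof -
  have "(\<lambda>n. \<Prod>i<k. real n / real (n - i)) \<longlonglongrightarrow> (\<Prod>i<k. 1)"
  proof (intro tendsto_prod)
    fix i
    have "(\<lambda>n. 1 + real i / (real n - real i)) \<longlonglongrightarrow> 1 + 0"
      by (intro tendsto_intros tendsto_divide_0[OF tendsto_const] filterlim_at_top_imp_at_infinity)
         (use filterlim_tendsto_add_at_top[OF tendsto_const[of "- real i"] filterlim_real_sequentially] in simp)
    then have *: "(\<lambda>n. 1 + real i / (real n - real i)) \<longlonglongrightarrow> 1" by simp
    show "(\<lambda>n. real n / real (n - i)) \<longlonglongrightarrow> 1"
    proof (rule Lim_transform_eventually[OF *])
      show "\<forall>\<^sub>F n in sequentially. 1 + real i / (real n - real i) = real n / real (n - i)"
        using eventually_gt_at_top[of i] by eventually_elim (simp add: field_simps of_nat_diff)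
    qed
  qed
  then show ?thesis by (simp add: falling_def prod_dividef)
qed

lemma monomial_positive_imp_nonneg:
  fixes \<rho> :: "symfun \<Rightarrow> real"
  assumes lin: "linear \<rho>" and pos: "\<forall>\<nu>\<in>partitions. \<rho> (monomial_sym \<nu>) \<ge> 0" and f: "\<And>m. mcoeff f m \<ge> 0"
  shows "\<rho> f \<ge> 0"
proof -
  obtain n where n: "\<And>m. mcoeff f m \<noteq> 0 \<Longrightarrow> size m \<le> n" using mcoeff_bounded[of f] by blast
  let ?A = "{\<nu> \<in> partitions. sum_mset \<nu> \<le> n}"
  have "f = (\<Sum>\<mu>\<in>?A. mcoeff f (mono_of \<mu>) *\<^sub>R monomial_sym \<mu>)"
    using n by (intro m_expansion finite_partitions_le) auto
  then have "\<rho> f = \<rho> (\<Sum>\<mu>\<in>?A. mcoeff f (mono_of \<mu>) *\<^sub>R monomial_sym \<mu>)" by simp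
  also have "\<dots> = (\<Sum>\<mu>\<in>?A. mcoeff f (mono_of \<mu>) * \<rho> (monomial_sym \<mu>))"
    by (simp add: linear_sum[OF lin] linear_scale[OF lin])
  also have "\<dots> \<ge> 0" using pos f by (intro sum_nonneg mult_nonneg_nonneg) auto
  finally show ?thesis .
qed

lemma specialization_power:
  assumes "specialization \<rho>"
  shows "\<rho> (f ^ n) = \<rho> f ^ n"
  using assms by (induction n) (auto simp: specialization_def)

lemma mcoeff_power_sum_nonneg: "mcoeff (power_sum k) m \<ge> 0"
  by (simp add: power_sum.rep_eq)

section \<open>Approximation by frequency vectors of monomials\<close>

definition power_freq :: "nat \<Rightarrow> nat multiset \<Rightarrow> real" where
  "power_freq k m = (\<Sum>i\<in>set_mset m. (real (count m i) / real (size m)) ^ k)"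

text \<open>The coefficients of \<open>p\<^sub>k\<^sup>2 p\<^sub>1\<^sup>n\<^sup>-\<^sup>2\<^sup>k - 2 r p\<^sub>k p\<^sub>1\<^sup>n\<^sup>-\<^sup>k + r\<^sup>2 p\<^sub>1\<^sup>n\<close> are, up to a small error, the square deviations
  of the normalized power sums from \<open>r\<close>.\<close>

lemma mcoeff_square_deviation_ge:
  fixes r :: real
  assumes k: "k \<ge> 2" and r: "r \<ge> 0" and n: "n \<ge> 2 * k" and m: "size m = n"
  defines "F \<equiv> falling_sum k m / real n ^ k"
  shows "fact n * fact_weight m * ((F - r)\<^sup>2 - (2 * (real k)\<^sup>2 / real n + 2 * r * (real n ^ k / falling n k - 1))) \<le>
    mcoeff (power_sum k * (power_sum k * power_sum 1 ^ (n - 2 * k)) - (2 * r) *\<^sub>R (power_sum k * power_sum 1 ^ (n - k))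
      + r\<^sup>2 *\<^sub>R power_sum 1 ^ n) m"
proof -
  define S where "S = (\<Sum>i\<in>set_mset m. falling (count m i) k * falling_sum k (m - replicate_mset k i))"
  have n0: "real n > 0" using k n by simp
  have F: "0 \<le> F" "F \<le> 1" using falling_sum_bounds(1,3)[OF m k] n0 by (auto simp: F_def)
  have ffk: "falling n k > 0" "falling n (2 * k) > 0" using n k by (auto intro!: falling_pos)
  have f2: "fact (n - 2 * k) = (fact n / falling n (2 * k) :: real)" and f1: "fact (n - k) = (fact n / falling n k :: real)"
    using fact_ff[of "2 * k" n] fact_ff[of k n] n ffk by (auto simp: field_simps)
  have "mcoeff (power_sum k * (power_sum k * power_sum 1 ^ (n - 2 * k)) - (2 * r) *\<^sub>R (power_sum k * power_sum 1 ^ (n - k))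
      + r\<^sup>2 *\<^sub>R power_sum 1 ^ n) m = fact n * fact_weight m * (S / falling n (2 * k) - 2 * r * (falling_sum k m / falling n k) + r\<^sup>2)"
  proof -
    have e: "mcoeff (power_sum k * (power_sum k * power_sum 1 ^ (n - 2 * k))) m = fact (n - 2 * k) * (fact_weight m * S)"
      "mcoeff (power_sum k * power_sum 1 ^ (n - k)) m = fact (n - k) * (fact_weight m * falling_sum k m)"
      "mcoeff (power_sum 1 ^ n) m = fact n * (fact_weight m * 1)"
      using mcoeff_power_sum_kk[of k "n - 2 * k" m] mcoeff_power_sum_k[of k "n - k" m]
        mcoeff_power_sum_1_power[of n m] k n m by (simp_all add: S_def)
    show ?thesis unfolding mcoeff_add mcoeff_diff mcoeff_scaleR e f1 f2 by (simp add: algebra_simps)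
  qed
  \<comment> \<open>The first error term comes from the interaction of the two factors p_k, the
    second from replacing \<open>falling n k\<close> by n^k in the mixed term. Both estimates use 0
    <= F <= 1.\<close>
  moreover have "(F - r)\<^sup>2 - (2 * (real k)\<^sup>2 / real n + 2 * r * (real n ^ k / falling n k - 1)) \<le>
      S / falling n (2 * k) - 2 * r * (falling_sum k m / falling n k) + r\<^sup>2"
  proof -
    have S0: "S \<ge> 0" unfolding S_def by (intro sum_nonneg mult_nonneg_nonneg falling_nonneg) (simp add: falling_sum_def sum_nonneg falling_nonneg)
    have "F\<^sup>2 - 2 * (real k)\<^sup>2 / real n \<le> F * (F - 2 * (real k)\<^sup>2 / real n)"
    proof -
      have "F * (2 * (real k)\<^sup>2 / real n) \<le> 1 * (2 * (real k)\<^sup>2 / real n)"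
        using F n0 by (intro mult_right_mono) auto
      then show ?thesis by (simp add: power2_eq_square algebra_simps)
    qed
    also have "\<dots> = (falling_sum k m * (falling_sum k m - 2 * (real k)\<^sup>2 * real n ^ (k - 1))) / real n ^ (2 * k)"
    proof -
      have "real n ^ k = real n * real n ^ (k - 1)" using k by (metis One_nat_def Suc_le_eq le_trans mult.commute one_le_numeral power_minus_mult)
      then have e: "2 * (real k)\<^sup>2 / real n = 2 * (real k)\<^sup>2 * real n ^ (k - 1) / real n ^ k" using n0 by simp
      have "real n ^ (2 * k) = real n ^ k * real n ^ k" by (simp add: mult_2 power_add)
      then show ?thesis unfolding F_def e by (simp only: times_divide_times_eq diff_divide_distrib[symmetric])
    qed
    also have "\<dots> \<le> S / real n ^ (2 * k)"
      unfolding S_def by (intro divide_right_mono falling_sum_square_ge[OF m k]) auto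
    also have "\<dots> \<le> S / falling n (2 * k)"
      using S0 ffk n0 falling_le_power[of n "2 * k"] by (intro divide_left_mono mult_pos_pos zero_less_power) auto
    finally have 1: "F\<^sup>2 - 2 * (real k)\<^sup>2 / real n \<le> S / falling n (2 * k)" .
    have "r * (falling_sum k m / falling n k) = r * F + r * (F * (real n ^ k / falling n k - 1))"
      using n0 by (simp add: F_def field_simps)
    also have "\<dots> \<le> r * F + r * (1 * (real n ^ k / falling n k - 1))"
      using r F falling_le_power[of n k] ffk by (intro add_left_mono mult_left_mono mult_right_mono) (auto simp: field_simps)
    finally have 2: "r * (falling_sum k m / falling n k) \<le> r * F + r * (real n ^ k / falling n k - 1)" by simp
    have "(F - r)\<^sup>2 = F\<^sup>2 - 2 * (r * F) + r\<^sup>2" by (simp add: power2_eq_square algebra_simps)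
    moreover have "2 * r * (falling_sum k m / falling n k) = 2 * (r * (falling_sum k m / falling n k))"
      "2 * r * (real n ^ k / falling n k - 1) = 2 * (r * (real n ^ k / falling n k - 1))" by simp_all
    ultimately show ?thesis using 1 2 by linarith
  qed
  ultimately show ?thesis using fact_weight_pos[of m] by (simp only: mult_left_mono mult_pos_pos less_imp_le fact_gt_zero)
qed

lemma ex_approximating_monomial:
  assumes sp: "specialization \<rho>" and pos: "\<forall>\<nu>\<in>partitions. \<rho> (monomial_sym \<nu>) \<ge> 0"
    and c: "\<rho> (power_sum 1) > 0" and e: "e > 0"
  shows "\<exists>m. size m > 0 \<and> (\<forall>k\<in>{2..K}. \<bar>power_freq k m - \<rho> (power_sum k) / \<rho> (power_sum 1) ^ k\<bar> < e)"
proof -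
  define c where "c = \<rho> (power_sum 1)"
  define r where "r k = \<rho> (power_sum k) / c ^ k" for k
  have lin: "linear \<rho>" and mult: "\<And>f g. \<rho> (f * g) = \<rho> f * \<rho> g" using sp by (auto simp: specialization_def)
  have c0: "c > 0" using c by (simp add: c_def)
  have r0: "r k \<ge> 0" for k
    using monomial_positive_imp_nonneg[OF lin pos mcoeff_power_sum_nonneg] c0 by (simp add: r_def)
  define err where "err n k = 2 * (real k)\<^sup>2 / real n + 2 * r k * (real n ^ k / falling n k - 1)" for n k
  \<comment> \<open>The squared deviations will be bounded by \<delta> plus the accumulated errors,
    which are below \<delta>: in total (e/2)^2. The other e/2 pays for passing from falling
    factorials to powers.\<close>
  define \<delta> where "\<delta> = (e / 2)\<^sup>2 / 2"
  have \<delta>: "\<delta> > 0" using e by (simp add: \<delta>_def)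
  have "(\<lambda>n. \<Sum>k=2..K. err n k) \<longlonglongrightarrow> (\<Sum>k=2..K. 0 + 2 * r k * (1 - 1))"
    unfolding err_def
    by (intro tendsto_sum tendsto_add tendsto_mult tendsto_const tendsto_diff falling_ratio_tendsto
        tendsto_divide_0[OF tendsto_const] filterlim_at_top_imp_at_infinity filterlim_real_sequentially)
  then have ev1: "\<forall>\<^sub>F n in sequentially. (\<Sum>k=2..K. err n k) < \<delta>"
    using \<delta> by (intro order_tendstoD(2)[of _ 0]) auto
  have "(\<lambda>n. (real K)\<^sup>2 / real n) \<longlonglongrightarrow> 0"
    by (intro tendsto_divide_0[OF tendsto_const] filterlim_at_top_imp_at_infinity filterlim_real_sequentially)
  then have ev2: "\<forall>\<^sub>F n in sequentially. (real K)\<^sup>2 / real n < e / 2"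
    using e by (intro order_tendstoD(2)[of _ 0]) auto
  obtain n where n: "(\<Sum>k=2..K. err n k) < \<delta>" "(real K)\<^sup>2 / real n < e / 2" "n \<ge> 2 * K" "n > 0"
    using eventually_happens[OF eventually_conj[OF ev1 eventually_conj[OF ev2
      eventually_conj[OF eventually_ge_at_top[of "2 * K"] eventually_gt_at_top[of 0]]]]] by auto
  define g where "g k = power_sum k * (power_sum k * power_sum 1 ^ (n - 2 * k)) -
    (2 * r k) *\<^sub>R (power_sum k * power_sum 1 ^ (n - k)) + (r k)\<^sup>2 *\<^sub>R power_sum 1 ^ n" for k
  define G where "G = (\<Sum>k=2..K. g k) - \<delta> *\<^sub>R power_sum 1 ^ n"
  \<comment> \<open>Multiplicativity makes the value a perfect square, c^n (r k - r k)^2.\<close>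
  have \<rho>g: "\<rho> (g k) = 0" if k: "k \<in> {2..K}" for k
  proof -
    have pk: "\<rho> (power_sum k) = r k * c ^ k" using c0 by (simp add: r_def)
    have "n - k = k + (n - 2 * k)" "n = k + k + (n - 2 * k)" using k n(3) by auto
    then have "c ^ (n - k) = c ^ k * c ^ (n - 2 * k)" "c ^ n = c ^ k * c ^ k * c ^ (n - 2 * k)"
      by (metis power_add)+
    moreover have "\<rho> (g k) = r k * c ^ k * (r k * c ^ k * c ^ (n - 2 * k)) - 2 * r k * (r k * c ^ k * c ^ (n - k)) + (r k)\<^sup>2 * c ^ n"
      unfolding g_def linear_add[OF lin] linear_diff[OF lin] linear_scale[OF lin] mult specialization_power[OF sp]
        pk c_def[symmetric] real_scaleR_def ..
    ultimately show ?thesis by (simp add: power2_eq_square)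
  qed
  have "\<rho> G = - \<delta> * c ^ n" unfolding G_def
    by (simp add: linear_diff[OF lin] linear_scale[OF lin] linear_sum[OF lin] \<rho>g specialization_power[OF sp] c_def)
  \<comment> \<open>Hence \<open>G\<close> has a negative coefficient at some monomial, and this
    monomial supplies the frequencies.\<close>
  also have "\<dots> < 0" using \<delta> c0 by simp
  finally have "\<not> (\<forall>m. mcoeff G m \<ge> 0)"
    using monomial_positive_imp_nonneg[OF lin pos, of G] by auto
  then obtain m where m: "mcoeff G m < 0" by (auto simp: not_le)
  have sz: "size m = n"
  proof (rule ccontr)
    assume ne: "size m \<noteq> n"
    have "mcoeff (g k) m = 0" if "k \<in> {2..K}" for k
    proof -
      have e: "mcoeff (power_sum k * (power_sum k * power_sum 1 ^ (n - 2 * k))) m = 0"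
        "mcoeff (power_sum k * power_sum 1 ^ (n - k)) m = 0" "mcoeff (power_sum 1 ^ n) m = 0"
        using mcoeff_power_sum_kk[of k "n - 2 * k" m] mcoeff_power_sum_k[of k "n - k" m]
          mcoeff_power_sum_1_power[of n m] that n(3) ne by simp_all
      show ?thesis unfolding g_def mcoeff_add mcoeff_diff mcoeff_scaleR e by simp
    qed
    then have "mcoeff G m = 0" using ne mcoeff_power_sum_1_power[of n m] by (simp add: G_def)
    with m show False by simp
  qed
  define F where "F k = falling_sum k m / real n ^ k" for k
  let ?w = "fact n * fact_weight m"
  have w: "?w > 0" using fact_weight_pos[of m] by simp
  have "?w * ((F k - r k)\<^sup>2 - err n k) \<le> mcoeff (g k) m" if k: "k \<in> {2..K}" for k
    unfolding g_def F_def err_def using k n(3) r0 sz by (intro mcoeff_square_deviation_ge) auto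
  then have "(\<Sum>k=2..K. ?w * ((F k - r k)\<^sup>2 - err n k)) \<le> (\<Sum>k=2..K. mcoeff (g k) m)" by (rule sum_mono)
  also have "\<dots> < ?w * \<delta>" using m sz mcoeff_power_sum_1_power[of n m] by (simp add: G_def mult_ac)
  finally have "?w * (\<Sum>k=2..K. (F k - r k)\<^sup>2 - err n k) < ?w * \<delta>" by (simp add: sum_distrib_left)
  then have "(\<Sum>k=2..K. (F k - r k)\<^sup>2 - err n k) < \<delta>" by (simp only: mult_less_cancel_left_pos[OF w])
  then have "(\<Sum>k=2..K. (F k - r k)\<^sup>2) < \<delta> + (\<Sum>k=2..K. err n k)" by (simp add: sum_subtractf)
  then have sq: "(\<Sum>k=2..K. (F k - r k)\<^sup>2) < (e / 2)\<^sup>2" using n(1) by (simp add: \<delta>_def)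
  have "\<bar>power_freq k m - r k\<bar> < e" if k: "k \<in> {2..K}" for k
  proof -
    have "(F k - r k)\<^sup>2 \<le> (\<Sum>k=2..K. (F k - r k)\<^sup>2)" using k by (intro member_le_sum) auto
    then have "(F k - r k)\<^sup>2 < (e / 2)\<^sup>2" using sq by simp
    then have "\<bar>F k - r k\<bar>\<^sup>2 < (e / 2)\<^sup>2" by simp
    then have 1: "\<bar>F k - r k\<bar> < e / 2" by (rule power2_less_imp_less) (use e in simp)
    have n0: "real n > 0" using n(4) by simp
    have pf: "power_freq k m = (\<Sum>i\<in>set_mset m. real (count m i) ^ k) / real n ^ k"
      by (simp add: power_freq_def sz power_divide sum_divide_distrib)
    have k2: "2 \<le> k" using k by simp
    have "F k \<le> power_freq k m"
      unfolding pf F_def using falling_sum_bounds(2)[OF sz k2] by (intro divide_right_mono) auto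
    moreover have "power_freq k m - (real k)\<^sup>2 / real n \<le> F k"
    proof -
      have "real n ^ k = real n * real n ^ (k - 1)" using k by (metis One_nat_def Suc_le_eq atLeastAtMost_iff le_trans mult.commute one_le_numeral power_minus_mult)
      then have "(real k)\<^sup>2 / real n = (real k)\<^sup>2 * real n ^ (k - 1) / real n ^ k" using n0 by simp
      then have "power_freq k m - (real k)\<^sup>2 / real n = ((\<Sum>i\<in>set_mset m. real (count m i) ^ k) - (real k)\<^sup>2 * real n ^ (k - 1)) / real n ^ k"
        by (simp add: pf diff_divide_distrib)
      also have "\<dots> \<le> F k" unfolding F_def by (intro divide_right_mono falling_sum_bounds(4)[OF sz k2]) auto
      finally show ?thesis .
    qed
    moreover have "(real k)\<^sup>2 / real n \<le> (real K)\<^sup>2 / real n"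
      using k by (intro divide_right_mono power_mono) auto
    ultimately show ?thesis using 1 n(2) by linarith
  qed
  then show ?thesis using sz n(4) by (intro exI[of _ m]) (simp add: r_def c_def)
qed

lemma ex_approximating_sequence:
  assumes sp: "specialization \<rho>" and pos: "\<forall>\<nu>\<in>partitions. \<rho> (monomial_sym \<nu>) \<ge> 0"
    and c: "\<rho> (power_sum 1) > 0" and e: "e > 0"
  shows "\<exists>a :: nat \<Rightarrow> real. decseq a \<and> (\<forall>i. a i \<ge> 0) \<and> (\<forall>n. (\<Sum>i<n. a i) \<le> 1) \<and>
    (\<forall>k\<in>{2..K}. \<bar>(\<Sum>i. a i ^ k) - \<rho> (power_sum k) / \<rho> (power_sum 1) ^ k\<bar> < e)"
proof -
  obtain m0 where m0: "size m0 > 0"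
      "\<forall>k\<in>{2..K}. \<bar>power_freq k m0 - \<rho> (power_sum k) / \<rho> (power_sum 1) ^ k\<bar> < e"
    using ex_approximating_monomial[OF assms] by blast
  obtain m l where m: "exponents m = exponents m0" "set_mset m = {..<l}" "\<forall>i j. i \<le> j \<longrightarrow> count m j \<le> count m i"
    using ex_decreasing_monomial[OF exponents_partitions[of m0]] by blast
  have sz: "size m = size m0" using m(1) by (metis sum_mset_exponents)
  have pf: "power_freq k m = power_freq k m0" for k
  proof -
    have "power_freq k m' = (\<Sum>a\<in>#exponents m'. (real a / real (size m')) ^ k)" for m'
      by (simp add: power_freq_def sum_exponents)
    then show ?thesis using m(1) sz by simp
  qed
  define a where "a i = real (count m i) / real (size m)" for i
  have a0: "a i \<ge> 0" for i by (simp add: a_def)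
  have az: "a i = 0" if "i \<ge> l" for i
    using m(2) that by (auto simp: a_def not_in_iff[symmetric])
  have "decseq a" using m(3) by (auto simp: decseq_def a_def intro!: divide_right_mono)
  moreover have "(\<Sum>i<n. a i) \<le> 1" for n
  proof -
    have "(\<Sum>i<n. a i) = (\<Sum>i\<in>{..<n} \<inter> {..<l}. a i)"
    proof (rule sum.mono_neutral_right)
      show "\<forall>i\<in>{..<n} - {..<n} \<inter> {..<l}. a i = 0" by (intro ballI az) auto
    qed auto
    also have "\<dots> \<le> (\<Sum>i<l. a i)" by (rule sum_mono2) (use a0 in auto)
    also have "\<dots> = (\<Sum>i\<in>set_mset m. real (count m i)) / real (size m)"
      by (simp add: a_def m(2) sum_divide_distrib)
    also have "(\<Sum>i\<in>set_mset m. real (count m i)) = real (size m)" by (simp add: size_multiset_overloaded_eq)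
    finally show ?thesis using m0(1) sz by (simp split: if_splits)
  qed
  moreover have "(\<Sum>i. a i ^ k) = power_freq k m0" if "k \<in> {2..K}" for k
  proof -
    have "(\<Sum>i. a i ^ k) = (\<Sum>i<l. a i ^ k)"
      by (rule suminf_finite) (use that az in auto)
    then show ?thesis unfolding pf[symmetric] by (simp add: power_freq_def a_def m(2))
  qed
  ultimately show ?thesis using a0 m0(2) by (intro exI[of _ a]) auto
qed

section \<open>Compactness of decreasing frequency vectors\<close>

text \<open>The bound is uniform and its k-th powers are summable precisely for k >= 2. For k = 1
  mass may escape in the limit, whence an inequality for \<Sum> a_i.\<close>

lemma decseq_le_inverse:
  fixes a :: "nat \<Rightarrow> real"
  assumes "decseq a" "(\<Sum>j<Suc i. a j) \<le> 1"
  shows "a i \<le> 1 / real (Suc i)"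
proof -
  have "real (Suc i) * a i = (\<Sum>j<Suc i. a i)" by simp
  also have "\<dots> \<le> (\<Sum>j<Suc i. a j)" by (rule sum_mono) (use assms(1) in \<open>auto simp: decseq_def\<close>)
  finally show ?thesis using assms(2) by (simp add: field_simps)
qed

lemma pointwise_convergent_subsequence:
  fixes A :: "nat \<Rightarrow> nat \<Rightarrow> real"
  assumes "\<And>n i. \<bar>A n i\<bar> \<le> B"
  shows "\<exists>s b. strict_mono s \<and> (\<forall>i. (\<lambda>n. A (s n) i) \<longlonglongrightarrow> b i)"
proof -
  interpret subseqs "\<lambda>i s. convergent (\<lambda>n. A (s n) i)"
  proof
    fix i and s :: "nat \<Rightarrow> nat"
    have "bounded (range (\<lambda>n. A (s n) i))" using assms by (auto simp: bounded_iff)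
    then obtain l r where "strict_mono r" "((\<lambda>n. A (s n) i) \<circ> r) \<longlonglongrightarrow> l"
      using bounded_imp_convergent_subsequence by blast
    then show "\<exists>r. strict_mono r \<and> convergent (\<lambda>n. A ((s \<circ> r) n) i)"
      by (auto simp: o_def convergent_def)
  qed
  have "convergent (\<lambda>n. A (diagseq n) i)" for i
  proof -
    have "convergent (\<lambda>n. A ((diagseq \<circ> ((+) (Suc i))) n) i)"
    proof (rule diagseq_holds)
      fix r s :: "nat \<Rightarrow> nat" and n assume "strict_mono r" "convergent (\<lambda>x. A (s x) n)"
      then show "convergent (\<lambda>x. A ((s \<circ> r) x) n)"
        using convergent_subseq_convergent[of "\<lambda>x. A (s x) n" r] by (simp add: o_def)
    qed
    then have "convergent (\<lambda>n. A (diagseq (n + Suc i)) i)" by (simp add: o_def add.commute)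
    then show ?thesis using convergent_ignore_initial_segment[of "\<lambda>n. A (diagseq n) i" "Suc i"] by simp
  qed
  then have "\<forall>i. (\<lambda>n. A (diagseq n) i) \<longlonglongrightarrow> lim (\<lambda>n. A (diagseq n) i)"
    by (simp add: convergent_LIMSEQ_iff)
  then show ?thesis using subseq_diagseq
    by (intro exI[of _ diagseq] exI[of _ "\<lambda>i. lim (\<lambda>n. A (diagseq n) i)"]) simp
qed

lemma kingman_representation:
  assumes sp: "specialization \<rho>" and pos: "\<forall>\<nu>\<in>partitions. \<rho> (monomial_sym \<nu>) \<ge> 0"
  shows "\<exists>a :: nat \<Rightarrow> real. decseq a \<and> (\<forall>i. a i \<ge> 0) \<and> summable a \<and> (\<Sum>i. a i) \<le> \<rho> (power_sum 1) \<and>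
    (\<forall>k\<ge>2. (\<lambda>i. a i ^ k) sums \<rho> (power_sum k))"
proof (cases "\<rho> (power_sum 1) = 0")
  case True
  have lin: "linear \<rho>" using sp by (simp add: specialization_def)
  have "\<rho> (power_sum k) = 0" if k: "k \<ge> 2" for k
  proof -
    have "mcoeff (power_sum 1 ^ k - power_sum k) m \<ge> 0" for m
    proof (cases "\<exists>i. m = replicate_mset k i")
      case True
      then obtain i where i: "m = replicate_mset k i" by blast
      have "fact_weight m = 1 / fact k" using k by (simp add: fact_weight_def i)
      then show ?thesis using True mcoeff_power_sum_1_power[of k m] by (simp add: i power_sum.rep_eq)
    next
      case False
      then show ?thesis using mcoeff_power_sum_1_power[of k m] fact_weight_pos[of m] by (simp add: power_sum.rep_eq)
    qed
    then have "\<rho> (power_sum 1 ^ k - power_sum k) \<ge> 0" by (rule monomial_positive_imp_nonneg[OF lin pos])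
    then have "\<rho> (power_sum k) \<le> \<rho> (power_sum 1) ^ k"
      unfolding linear_diff[OF lin] specialization_power[OF sp] by simp
    moreover have "\<rho> (power_sum k) \<ge> 0" by (rule monomial_positive_imp_nonneg[OF lin pos mcoeff_power_sum_nonneg])
    ultimately show ?thesis using True k by (simp add: power_0_left)
  qed
  then show ?thesis using True by (intro exI[of _ "\<lambda>_. 0"]) (auto simp: decseq_def power_0_left)
next
  case False
  have lin: "linear \<rho>" using sp by (simp add: specialization_def)
  define c where "c = \<rho> (power_sum 1)"
  have c: "c > 0"
    using False monomial_positive_imp_nonneg[OF lin pos mcoeff_power_sum_nonneg, of 1] by (simp add: c_def)
  define r where "r k = \<rho> (power_sum k) / c ^ k" for k
  \<comment> \<open>Stage K controls the exponents 2, ..., K with error 1/(K+1), so every fixed k is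
    controlled eventually.\<close>
  have "\<forall>K. \<exists>a :: nat \<Rightarrow> real. decseq a \<and> (\<forall>i. a i \<ge> 0) \<and> (\<forall>n. (\<Sum>i<n. a i) \<le> 1) \<and>
    (\<forall>k\<in>{2..K}. \<bar>(\<Sum>i. a i ^ k) - r k\<bar> < 1 / real (Suc K))"
    using ex_approximating_sequence[OF sp pos] c unfolding c_def r_def by simp
  from choice[OF this] obtain A :: "nat \<Rightarrow> nat \<Rightarrow> real" where A0: "\<forall>K. decseq (A K) \<and>
    (\<forall>i. A K i \<ge> 0) \<and> (\<forall>n. (\<Sum>i<n. A K i) \<le> 1) \<and>
    (\<forall>k\<in>{2..K}. \<bar>(\<Sum>i. A K i ^ k) - r k\<bar> < 1 / real (Suc K))" by blast
  have A: "decseq (A K)" "A K i \<ge> 0" "(\<Sum>i<n. A K i) \<le> 1"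
    "k \<in> {2..K} \<Longrightarrow> \<bar>(\<Sum>i. A K i ^ k) - r k\<bar> < 1 / real (Suc K)" for K i n k
    using A0 by blast+
  have Ai: "A K i \<le> 1 / real (Suc i)" for K i by (rule decseq_le_inverse[OF A(1,3)])
  have A1: "\<bar>A K i\<bar> \<le> 1" for K i
  proof -
    have "1 / real (Suc i) \<le> 1" by simp
    then show ?thesis using Ai[of K i] A(2)[of K i] by linarith
  qed
  obtain s b where s: "strict_mono s" and b: "\<And>i. (\<lambda>n. A (s n) i) \<longlonglongrightarrow> b i"
    using pointwise_convergent_subsequence[of A 1, OF A1] by blast
  have b0: "b i \<ge> 0" for i by (rule LIMSEQ_le_const[OF b]) (use A(2) in auto)
  have bd: "decseq b"
    unfolding decseq_def by (intro allI impI LIMSEQ_le[OF b b]) (use A(1) in \<open>auto simp: decseq_def\<close>)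
  have bs: "(\<Sum>i<n. b i) \<le> 1" for n
    by (rule LIMSEQ_le_const2[OF tendsto_sum[OF b]]) (use A(3) in auto)
  have sb: "summable b" by (rule summableI_nonneg_bounded[OF b0 bs])
  have bk: "(\<lambda>i. b i ^ k) sums r k" if k: "k \<ge> 2" for k
  proof -
    have "summable (\<lambda>i. inverse (real (Suc i) ^ k))"
      using inverse_power_summable[of k, where 'a = real] k summable_Suc_iff[of "\<lambda>i. inverse (real i ^ k)"] by simp
    then have M: "summable (\<lambda>i. (1 / real (Suc i)) ^ k)" by (simp add: power_divide inverse_eq_divide)
    \<comment> \<open>Dominated convergence for series, with the k-th powers of 1/(i+1) as
      majorant.\<close>
    have t: "eventually (\<lambda>n. summable (\<lambda>i. norm (A (s n) i ^ k))) sequentially \<and>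
        summable (\<lambda>i. norm (b i ^ k)) \<and> (\<lambda>n. \<Sum>i. A (s n) i ^ k) \<longlonglongrightarrow> (\<Sum>i. b i ^ k)"
    proof (rule tannerys_theorem[where M = "\<lambda>i. (1 / real (Suc i)) ^ k"])
      show "(\<lambda>n. A (s n) i ^ k) \<longlonglongrightarrow> b i ^ k" for i by (intro tendsto_power b)
      have "norm (A (s n) i ^ k) \<le> (1 / real (Suc i)) ^ k" for n i
        unfolding norm_power using A(2) Ai by (intro power_mono) auto
      then show "eventually (\<lambda>(i, n). norm (A (s n) i ^ k) \<le> (1 / real (Suc i)) ^ k) (at_top \<times>\<^sub>F sequentially)"
        by (intro always_eventually) auto
    qed (use M in auto)
    have "(\<lambda>n. (\<Sum>i. A (s n) i ^ k) - r k) \<longlonglongrightarrow> 0"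
    proof (rule Lim_null_comparison)
      show "\<forall>\<^sub>F n in sequentially. norm ((\<Sum>i. A (s n) i ^ k) - r k) \<le> 1 / real (Suc n)"
        using eventually_ge_at_top[of k]
      proof eventually_elim
        case (elim n)
        have "n \<le> s n" by (rule seq_suble[OF s])
        then have "\<bar>(\<Sum>i. A (s n) i ^ k) - r k\<bar> < 1 / real (Suc (s n))" using elim k by (intro A(4)) auto
        also have "\<dots> \<le> 1 / real (Suc n)" using \<open>n \<le> s n\<close> by (simp add: frac_le)
        finally show ?case by simp
      qed
      show "(\<lambda>n. 1 / real (Suc n)) \<longlonglongrightarrow> 0" using LIMSEQ_inverse_real_of_nat by (simp add: inverse_eq_divide)
    qed
    then have "(\<lambda>n. \<Sum>i. A (s n) i ^ k) \<longlonglongrightarrow> r k" by (simp add: LIM_zero_iff)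
    then have "(\<Sum>i. b i ^ k) = r k" using t LIMSEQ_unique by blast
    moreover have "summable (\<lambda>i. b i ^ k)" by (rule summable_norm_cancel) (use t in blast)
    ultimately show ?thesis by (simp add: sums_iff)
  qed
  show ?thesis
  proof (intro exI[of _ "\<lambda>i. c * b i"] conjI allI impI)
    show "decseq (\<lambda>i. c * b i)" using bd c by (auto simp: decseq_def)
    show "c * b i \<ge> 0" for i using b0 c by simp
    show "summable (\<lambda>i. c * b i)" using sb by (rule summable_mult)
    have "(\<Sum>i. c * b i) = c * (\<Sum>i. b i)" using sb by (simp add: suminf_mult)
    also have "\<dots> \<le> c * 1" using suminf_le_const[OF sb bs] c by (intro mult_left_mono) auto
    finally show "(\<Sum>i. c * b i) \<le> \<rho> (power_sum 1)" by (simp add: c_def)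
    fix k :: nat assume "k \<ge> 2"
    from sums_mult[OF bk[OF this], of "c ^ k"] show "(\<lambda>i. (c * b i) ^ k) sums \<rho> (power_sum k)"
      using c by (simp add: power_mult_distrib r_def)
  qed
qed

section \<open>The converse by evaluation at finitely many variables\<close>

text \<open>The degree n part of f evaluated at x_0, ..., x_(V-1), the other variables being 0.
  Fixing the degree keeps the sum finite.\<close>

definition eval_hom :: "(nat \<Rightarrow> real) \<Rightarrow> nat \<Rightarrow> nat \<Rightarrow> symfun \<Rightarrow> real" where
  "eval_hom x V n f = (\<Sum>m\<in>multisets_of_size {..<V} n. mcoeff f m * (\<Prod>i\<in>#m. x i))"

lemma linear_eval_hom: "linear (eval_hom x V n)"
  by (rule linearI) (simp_all add: eval_hom_def algebra_simps sum.distrib sum_distrib_left)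

lemma eval_hom_nonneg:
  assumes "\<And>m. mcoeff f m \<ge> 0" "\<And>i. x i \<ge> 0"
  shows "eval_hom x V n f \<ge> 0"
proof -
  have "(\<Prod>i\<in>#m. x i) \<ge> 0" for m by (induction m) (auto simp: assms(2))
  then show ?thesis unfolding eval_hom_def by (intro sum_nonneg mult_nonneg_nonneg assms)
qed

lemma eval_hom_power_sum_mult:
  assumes k: "k > 0"
  shows "eval_hom x V (n + k) (power_sum k * f) = (\<Sum>i<V. x i ^ k) * eval_hom x V n f"
proof -
  let ?M = "multisets_of_size {..<V}" and ?x = "\<lambda>m. \<Prod>i\<in>#m. x i"
  have fin: "finite (?M n)" for n by (rule finite_multisets_of_size) simp
  have "eval_hom x V (n + k) (power_sum k * f) = (\<Sum>m\<in>?M (n + k). \<Sum>i<V. xmul i k (mcoeff f) m * ?x m)"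
    unfolding eval_hom_def
  proof (intro sum.cong refl)
    fix m assume m: "m \<in> ?M (n + k)"
    have "(\<Sum>i\<in>set_mset m. xmul i k (mcoeff f) m) = (\<Sum>i<V. xmul i k (mcoeff f) m)"
      using m k by (intro sum.mono_neutral_left) (auto simp: multisets_of_size_def not_in_iff intro!: xmul_eq_0)
    then show "mcoeff (power_sum k * f) m * ?x m = (\<Sum>i<V. xmul i k (mcoeff f) m * ?x m)"
      by (simp add: mcoeff_power_sum_mult[OF k] sum_distrib_right)
  qed
  also have "\<dots> = (\<Sum>i<V. \<Sum>m\<in>?M (n + k). xmul i k (mcoeff f) m * ?x m)" by (rule sum.swap)
  also have "\<dots> = (\<Sum>i<V. x i ^ k * eval_hom x V n f)"
  proof (intro sum.cong refl)
    fix i assume i: "i \<in> {..<V}"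
    have "(\<Sum>m\<in>?M (n + k). xmul i k (mcoeff f) m * ?x m) =
        (\<Sum>m\<in>{m \<in> ?M (n + k). k \<le> count m i}. xmul i k (mcoeff f) m * ?x m)"
      using fin by (intro sum.mono_neutral_right) (auto simp: not_le intro!: xmul_eq_0)
    also have "\<dots> = (\<Sum>m\<in>?M n. x i ^ k * (mcoeff f m * ?x m))"
    proof (rule sum.reindex_bij_witness[where i = "\<lambda>m. m + replicate_mset k i" and j = "\<lambda>m. m - replicate_mset k i"])
      fix m assume "m \<in> {m \<in> ?M (n + k). k \<le> count m i}"
      then have m: "set_mset m \<subseteq> {..<V}" "size m = n + k" "k \<le> count m i" by (auto simp: multisets_of_size_def)
      show eq: "m - replicate_mset k i + replicate_mset k i = m"
        using m(3) by (simp add: count_le_replicate_mset_subset_eq)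
      show "m - replicate_mset k i \<in> ?M n"
        using m size_diff_replicate[OF m(3)] by (auto simp: multisets_of_size_def dest: in_diffD)
      have "?x m = ?x (m - replicate_mset k i + replicate_mset k i)" by (simp only: eq)
      also have "\<dots> = ?x (m - replicate_mset k i) * x i ^ k" by simp
      finally show "x i ^ k * (mcoeff f (m - replicate_mset k i) * ?x (m - replicate_mset k i)) = xmul i k (mcoeff f) m * ?x m"
        using m(3) by (simp add: xmul_def)
    next
      fix m assume "m \<in> ?M n"
      then show "m + replicate_mset k i \<in> {m \<in> ?M (n + k). k \<le> count m i}"
        using i by (auto simp: multisets_of_size_def split: if_splits)
    qed auto
    finally show "(\<Sum>m\<in>?M (n + k). xmul i k (mcoeff f) m * ?x m) = x i ^ k * eval_hom x V n f"
      by (simp add: eval_hom_def sum_distrib_left)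
  qed
  finally show ?thesis by (simp add: sum_distrib_right)
qed

lemma eval_hom_power_prod:
  assumes "\<nu> \<in> partitions"
  shows "eval_hom x V (sum_mset \<nu>) (power_prod \<nu>) = (\<Prod>k\<in>#\<nu>. \<Sum>i<V. x i ^ k)"
  using assms
proof (induction \<nu> rule: partitions_induct)
  case empty
  show ?case by (simp add: eval_hom_def mcoeff_one)
next
  case (add k \<nu>)
  then show ?case using eval_hom_power_sum_mult[OF add.hyps(1), of x V "sum_mset \<nu>" "power_prod \<nu>"]
    by (simp add: add.commute)
qed

lemma specialization_power_prod:
  assumes "specialization \<rho>"
  shows "\<rho> (power_prod \<nu>) = (\<Prod>k\<in>#\<nu>. \<rho> (power_sum k))"
  using assms by (induction \<nu>) (auto simp: specialization_def)

lemma kingman_imp_monomial_positive: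
  fixes a :: "nat \<Rightarrow> real"
  assumes sp: "specialization \<rho>"
    and a: "\<And>i. a i \<ge> 0" "summable a" "(\<Sum>i. a i) \<le> \<rho> (power_sum 1)"
      "\<And>k. k \<ge> 2 \<Longrightarrow> (\<lambda>i. a i ^ k) sums \<rho> (power_sum k)"
    and \<mu>: "\<mu> \<in> partitions"
  shows "\<rho> (monomial_sym \<mu>) \<ge> 0"
proof -
  define c where "c = \<rho> (power_sum 1)"
  have lin: "linear \<rho>" using sp by (simp add: specialization_def)
  define \<gamma> where "\<gamma> N = c - (\<Sum>i<N. a i)" for N
  have \<gamma>: "0 \<le> \<gamma> N" "\<gamma> N \<le> c" for N
  proof -
    have "(\<Sum>i<N. a i) \<le> (\<Sum>i. a i)" by (rule sum_le_suminf[OF a(2)]) (use a(1) in auto)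
    then show "0 \<le> \<gamma> N" using a(3) by (simp add: \<gamma>_def c_def)
    show "\<gamma> N \<le> c" using a(1) by (simp add: \<gamma>_def sum_nonneg)
  qed
  \<comment> \<open>After the first N parameters the whole deficit \<gamma> N, including the tail of
    the series, is shared equally by N further variables. Then p_1 takes the value c exactly once N
    > 0, while for k >= 2 these variables contribute at most c^k / N.\<close>
  define x where "x N i = (if i < N then a i else \<gamma> N / real N)" for N i
  have x0: "x N i \<ge> 0" for N i using a(1) \<gamma>(1) by (simp add: x_def)
  define pw where "pw N k = (\<Sum>i<2*N. x N i ^ k)" for N k
  have pw: "pw N k = (\<Sum>i<N. a i ^ k) + real N * (\<gamma> N / real N) ^ k" for N k
  proof -
    have "pw N k = (\<Sum>i\<in>{..<N} \<union> {N..<2*N}. x N i ^ k)"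
      unfolding pw_def by (rule sum.cong) auto
    also have "\<dots> = (\<Sum>i<N. x N i ^ k) + (\<Sum>i=N..<2*N. x N i ^ k)" by (rule sum.union_disjoint) auto
    also have "(\<Sum>i<N. x N i ^ k) = (\<Sum>i<N. a i ^ k)" by (rule sum.cong) (auto simp: x_def)
    also have "(\<Sum>i=N..<2*N. x N i ^ k) = (\<Sum>i=N..<2*N. (\<gamma> N / real N) ^ k)" by (rule sum.cong) (auto simp: x_def)
    finally show ?thesis by simp
  qed
  have lim: "(\<lambda>N. pw N k) \<longlonglongrightarrow> \<rho> (power_sum k)" if k: "k > 0" for k
  proof (cases "k = 1")
    case True
    have "\<forall>\<^sub>F N in sequentially. pw N k = \<rho> (power_sum k)"
      using eventually_gt_at_top[of 0] by eventually_elim (simp add: pw True \<gamma>_def c_def)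
    then show ?thesis by (rule tendsto_eventually)
  next
    case False
    then have k2: "k \<ge> 2" using k by simp
    have "(\<lambda>N. real N * (\<gamma> N / real N) ^ k) \<longlonglongrightarrow> 0"
    proof (rule Lim_null_comparison)
      show "\<forall>\<^sub>F N in sequentially. norm (real N * (\<gamma> N / real N) ^ k) \<le> c ^ k / real N"
        using eventually_gt_at_top[of 0]
      proof eventually_elim
        case (elim N)
        have "real N ^ 2 \<le> real N ^ k" using k2 elim by (intro power_increasing) auto
        have "norm (real N * (\<gamma> N / real N) ^ k) = real N * \<gamma> N ^ k / real N ^ k"
          using \<gamma>(1)[of N] by (simp add: power_divide abs_mult)
        also have "\<dots> \<le> real N * c ^ k / real N ^ 2"
          using \<gamma>[of N] \<open>real N ^ 2 \<le> real N ^ k\<close> elim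
          by (intro frac_le mult_left_mono power_mono mult_nonneg_nonneg zero_le_power) auto
        also have "\<dots> = c ^ k / real N" using elim by (simp add: power2_eq_square)
        finally show ?case .
      qed
      show "(\<lambda>N. c ^ k / real N) \<longlonglongrightarrow> 0"
        by (intro tendsto_divide_0[OF tendsto_const] filterlim_at_top_imp_at_infinity filterlim_real_sequentially)
    qed
    then have "(\<lambda>N. (\<Sum>i<N. a i ^ k) + real N * (\<gamma> N / real N) ^ k) \<longlonglongrightarrow> \<rho> (power_sum k) + 0"
      using a(4)[OF k2] by (intro tendsto_add) (auto simp: sums_def)
    then show ?thesis by (simp add: pw)
  qed
  let ?f = "monomial_sym \<mu>"
  let ?A = "{\<nu> \<in> partitions. p_coeff ?f \<nu> \<noteq> 0}"
  have hom: "homogeneous (sum_mset \<mu>) ?f"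
    by (auto simp: homogeneous_def mcoeff_monomial_sym split: if_splits)
  \<comment> \<open>Writing the monomial function in power sums reduces the passage to the limit to
    the power sums alone, while the right-hand side shows nonnegativity for each N.\<close>
  have ev: "(\<Sum>\<nu>\<in>?A. p_coeff ?f \<nu> * (\<Prod>k\<in>#\<nu>. pw N k)) = eval_hom (x N) (2 * N) (sum_mset \<mu>) ?f" for N
  proof -
    have "eval_hom (x N) (2 * N) (sum_mset \<mu>) ?f =
        (\<Sum>\<nu>\<in>?A. p_coeff ?f \<nu> * eval_hom (x N) (2 * N) (sum_mset \<mu>) (power_prod \<nu>))"
      by (subst p_expansion[of ?f]) (simp add: linear_sum[OF linear_eval_hom] linear_scale[OF linear_eval_hom])
    also have "\<dots> = (\<Sum>\<nu>\<in>?A. p_coeff ?f \<nu> * (\<Prod>k\<in>#\<nu>. pw N k))"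
    proof (intro sum.cong refl)
      fix \<nu> assume \<nu>: "\<nu> \<in> ?A"
      then have "sum_mset \<nu> = sum_mset \<mu>" using homogeneous_p_coeff[OF hom] by auto
      then show "p_coeff ?f \<nu> * eval_hom (x N) (2 * N) (sum_mset \<mu>) (power_prod \<nu>) = p_coeff ?f \<nu> * (\<Prod>k\<in>#\<nu>. pw N k)"
        using eval_hom_power_prod[of \<nu> "x N" "2 * N"] \<nu> by (simp add: pw_def)
    qed
    finally show ?thesis ..
  qed
  have prod_lim: "(\<lambda>N. \<Prod>k\<in>#\<nu>. pw N k) \<longlonglongrightarrow> (\<Prod>k\<in>#\<nu>. \<rho> (power_sum k))" if "\<nu> \<in> partitions" for \<nu>
    using that by (induction \<nu> rule: partitions_induct) (auto intro!: tendsto_mult lim)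
  have "(\<lambda>N. \<Sum>\<nu>\<in>?A. p_coeff ?f \<nu> * (\<Prod>k\<in>#\<nu>. pw N k)) \<longlonglongrightarrow> (\<Sum>\<nu>\<in>?A. p_coeff ?f \<nu> * (\<Prod>k\<in>#\<nu>. \<rho> (power_sum k)))"
    by (intro tendsto_sum tendsto_mult tendsto_const prod_lim) auto
  also have "(\<Sum>\<nu>\<in>?A. p_coeff ?f \<nu> * (\<Prod>k\<in>#\<nu>. \<rho> (power_sum k))) = \<rho> ?f"
    by (subst (3) p_expansion[of ?f])
       (simp add: linear_sum[OF lin] linear_scale[OF lin] specialization_power_prod[OF sp])
  finally show ?thesis
    unfolding ev
    by (rule LIMSEQ_le_const) (auto intro!: eval_hom_nonneg x0 simp: mcoeff_monomial_sym)
qed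

theorem theorem4p4:
  fixes \<rho> :: "symfun \<Rightarrow> real"
  assumes "specialization \<rho>"
  shows "totally_jack_positive \<rho> \<longleftrightarrow>
    (\<exists>(c :: real) (a :: nat \<Rightarrow> real).
        c \<ge> 0 \<and> decseq a \<and> (\<forall>i. a i \<ge> 0) \<and> summable a \<and> (\<Sum>i. a i) \<le> c \<and>
        \<rho> (power_sum 1) = c \<and>
        (\<forall>k\<ge>2. (\<lambda>i. a i ^ k) sums \<rho> (power_sum k)))"
proof -
  have lin: "linear \<rho>" using assms by (simp add: specialization_def)
  show ?thesis
    unfolding totally_jack_positive_iff_monomial[OF lin]
  proof
    assume pos: "\<forall>\<nu>\<in>partitions. \<rho> (monomial_sym \<nu>) \<ge> 0"
    have "\<rho> (power_sum 1) \<ge> 0"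
      by (rule monomial_positive_imp_nonneg[OF lin pos mcoeff_power_sum_nonneg])
    then show "\<exists>(c :: real) (a :: nat \<Rightarrow> real).
        c \<ge> 0 \<and> decseq a \<and> (\<forall>i. a i \<ge> 0) \<and> summable a \<and> (\<Sum>i. a i) \<le> c \<and>
        \<rho> (power_sum 1) = c \<and> (\<forall>k\<ge>2. (\<lambda>i. a i ^ k) sums \<rho> (power_sum k))"
      using kingman_representation[OF assms pos] by blast
  next
    assume "\<exists>(c :: real) (a :: nat \<Rightarrow> real).
        c \<ge> 0 \<and> decseq a \<and> (\<forall>i. a i \<ge> 0) \<and> summable a \<and> (\<Sum>i. a i) \<le> c \<and>
        \<rho> (power_sum 1) = c \<and> (\<forall>k\<ge>2. (\<lambda>i. a i ^ k) sums \<rho> (power_sum k))"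
    then show "\<forall>\<nu>\<in>partitions. \<rho> (monomial_sym \<nu>) \<ge> 0"
      using kingman_imp_monomial_positive[OF assms] by blast
  qed
qed

end
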